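(* Let $X$ be a smooth complex projective variety and $D=D_1+\cdots+D_c$ ($c\geqslant 1$) a simple normal crossing divisor on $X$; write $D'=D_1+\cdots+D_{c-1}$, so $D=D'+D_c$. Let $m\geqslant 1$. For any $1\leqslant k\leqslant m$ there is an exact sequence $$0\to S^m\Omega_X^1(\log D)_{(k-1),D_c}\to S^m\Omega_X^1(\log D)_{(k),D_c}\to S^{m-k}\Omega_X^1(\log D')|_{D_c}\to 0.$$
   Context: $D_1,\dots,D_c$ are the irreducible components of $D$. $\Omega^1_X(\log D)$ is the logarithmic cotangent bundle, $S^m$ denotes symmetric powers. For $0\leqslant k\leqslant m$, $S^m\Omega_X^1(\log D)_{(k),D_c}\subset S^m\Omega_X^1(\log D)$ is the subsheaf of forms with pole order at most $k$ along $D_c$: on an open subset $U$ on which $D_c$ is defined by $\sigma_c\in\mathcal{O}(U)$, $$S^m\Omega_X^1(\log D)_{(k),D_c}(U)=\{\omega\in S^m\Omega_X^1(\log D)(U)\;:\;\sigma_c^k\,\omega\in S^m\Omega_X^1(\log D')(U)\}.$$ The first map in the exact sequence is the natural inclusion. *)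

theory Defs
  imports
    "HOL-Analysis.Analysis"
    "HOL-Library.Function_Algebras"
    "HOL-Library.Set_Algebras"
begin

section \<open>Projective space and its Zariski topology\<close>

text \<open>The points of \<open>'n proj\<close> are the lines through the origin of \<open>complex ^ 'n\<close>.\<close>

typedef 'n proj = "{L :: (complex ^ 'n::finite) set. vec.subspace L \<and> vec.dim L = 1}"
proof -
  have "vec.dim (vec.span {1 :: complex ^ 'n}) = 1"
    using vec.independent_empty[where 'a = complex and 'b = 'n]
    by (subst vec.dim_span, subst vec.dim_eq_card_independent) (auto simp: vec.dependent_single)
  then show ?thesis
    using vec.subspace_span by blast
qed

text \<open>Homogeneous coordinate vectors of a point.\<close>

definition coords :: "'n::finite proj \<Rightarrow> (complex ^ 'n) set" where
  "coords p = Rep_proj p - {0}"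

text \<open>The index set of the sum is finite. Since \<open>complex\<close> is infinite, polynomials may be
  identified with polynomial functions.\<close>

definition homogeneous_poly :: "nat \<Rightarrow> (complex ^ 'n::finite \<Rightarrow> complex) \<Rightarrow> bool" where
  "homogeneous_poly d F \<longleftrightarrow>
     (\<exists>a :: ('n \<Rightarrow> nat) \<Rightarrow> complex.
        F = (\<lambda>x. \<Sum>e | sum e UNIV = d. a e * (\<Prod>i\<in>UNIV. (x $ i) ^ e i)))"

definition zariski :: "'n::finite proj topology" where
  "zariski = topology_generated_by
     {{p. \<forall>x\<in>coords p. F x \<noteq> 0} | F. \<exists>d. homogeneous_poly d F}"

definition irreducible_in :: "'p topology \<Rightarrow> 'p set \<Rightarrow> bool" where
  "irreducible_in T Y \<longleftrightarrow>
     Y \<noteq> {} \<and> Y \<subseteq> topspace T \<and>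
     (\<forall>A B. closedin T A \<longrightarrow> closedin T B \<longrightarrow> Y \<subseteq> A \<union> B \<longrightarrow> Y \<subseteq> A \<or> Y \<subseteq> B)"

text \<open>Krull dimension of a closed subset: the supremum of the lengths of chains
  \<open>Z 0 \<subset> \<dots> \<subset> Z n\<close> of irreducible closed subsets.\<close>

definition krull_dim :: "'n::finite proj set \<Rightarrow> enat" where
  "krull_dim Y = Sup {enat n | n. \<exists>Z.
     (\<forall>i\<le>n. closedin zariski (Z i) \<and> irreducible_in zariski (Z i) \<and> Z i \<subseteq> Y) \<and>
     (\<forall>i<n. Z i \<subset> Z (Suc i))}"

definition projective_variety :: "'n::finite proj set \<Rightarrow> bool" where
  "projective_variety X \<longleftrightarrow> closedin zariski X \<and> irreducible_in zariski X"

abbreviation open_in_variety :: "'n::finite proj set \<Rightarrow> 'n proj set \<Rightarrow> bool" where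
  "open_in_variety X \<equiv> openin (subtopology zariski X)"


section \<open>Regular functions, tangent spaces, smoothness\<close>

text \<open>A section over \<open>U\<close> of a sheaf of functions is a total function that is \<open>0\<close> outside \<open>U\<close>;
  \<open>restr V\<close> is the restriction to \<open>V\<close>. This is used for functions on \<open>X\<close> as well as for
  forms, whose values are functions of a tangent vector.\<close>

definition restr :: "'p set \<Rightarrow> ('p \<Rightarrow> 'a::zero) \<Rightarrow> 'p \<Rightarrow> 'a" where
  "restr V f = (\<lambda>q. if q \<in> V then f q else 0)"

text \<open>The structure sheaf.\<close>

definition regular :: "'n::finite proj set \<Rightarrow> 'n proj set \<Rightarrow> ('n proj \<Rightarrow> complex) set" where
  "regular X U = {h. (\<forall>q. q \<notin> U \<longrightarrow> h q = 0) \<and>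
     (\<forall>p\<in>U. \<exists>V d F G. open_in_variety X V \<and> p \<in> V \<and> V \<subseteq> U \<and>
        homogeneous_poly d F \<and> homogeneous_poly d G \<and>
        (\<forall>q\<in>V. \<forall>x\<in>coords q. G x \<noteq> 0 \<and> h q = F x / G x))}"

text \<open>Functions representing an element of the stalk at \<open>p\<close> of a sheaf of functions: those whose
  restriction to some neighbourhood of \<open>p\<close> is a section. Two of them have the same germ iff they
  agree near \<open>p\<close>.\<close>

definition stalk ::
  "'n::finite proj set \<Rightarrow> ('n proj set \<Rightarrow> ('n proj \<Rightarrow> 'a::zero) set) \<Rightarrow> 'n proj \<Rightarrow> ('n proj \<Rightarrow> 'a) set"
  where "stalk X S p = {f. \<exists>V. open_in_variety X V \<and> p \<in> V \<and> restr V f \<in> S V}"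

text \<open>Tangent vectors at \<open>p\<close> are the derivations at \<open>p\<close> of the local ring. The first condition only
  normalises their values on functions that are not regular at \<open>p\<close>.\<close>

type_synonym 'n tangent_vector = "('n proj \<Rightarrow> complex) \<Rightarrow> complex"

definition tangent_space :: "'n::finite proj set \<Rightarrow> 'n proj \<Rightarrow> 'n tangent_vector set" where
  "tangent_space X p = {v.
     (\<forall>f. f \<notin> stalk X (regular X) p \<longrightarrow> v f = 0) \<and>
     (\<forall>f\<in>stalk X (regular X) p. \<forall>g\<in>stalk X (regular X) p.
        v (\<lambda>q. f q + g q) = v f + v g \<and>
        v (\<lambda>q. f q * g q) = f p * v g + g p * v f \<and>
        ((\<exists>V. open_in_variety X V \<and> p \<in> V \<and> (\<forall>q\<in>V. f q = g q)) \<longrightarrow> v f = v g)) \<and>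
     (\<forall>c. \<forall>f\<in>stalk X (regular X) p. v (\<lambda>q. c * f q) = c * v f)}"

definition smooth :: "'n::finite proj set \<Rightarrow> bool" where
  "smooth X \<longleftrightarrow>
     (\<forall>p\<in>X. enat (vector_space.dim (\<lambda>(c :: complex) v f. c * v f) (tangent_space X p)) = krull_dim X)"


section \<open>Simple normal crossing divisors\<close>

definition prime_divisor :: "'n::finite proj set \<Rightarrow> 'n proj set \<Rightarrow> bool" where
  "prime_divisor X Y \<longleftrightarrow> projective_variety Y \<and> Y \<subseteq> X \<and> krull_dim Y + 1 = krull_dim X"

text \<open>\<open>\<sigma>\<close> defines \<open>Y\<close> on \<open>V\<close>: it generates the ideal sheaf of \<open>Y\<close> over \<open>V\<close>.\<close>

definition local_equation ::
  "'n::finite proj set \<Rightarrow> 'n proj set \<Rightarrow> 'n proj set \<Rightarrow> ('n proj \<Rightarrow> complex) \<Rightarrow> bool" where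
  "local_equation X Y V \<sigma> \<longleftrightarrow> open_in_variety X V \<and> \<sigma> \<in> regular X V \<and>
     (\<forall>W f. open_in_variety X W \<longrightarrow> W \<subseteq> V \<longrightarrow> f \<in> regular X W \<longrightarrow>
        ((\<forall>q\<in>W \<inter> Y. f q = 0) \<longleftrightarrow> (\<exists>g\<in>regular X W. \<forall>q\<in>W. f q = \<sigma> q * g q)))"

text \<open>\<open>z 0, \<dots>, z (n - 1)\<close> generate the maximal ideal of the local ring at \<open>p\<close>. They are local
  coordinates if moreover \<open>n\<close> is the dimension, as is required where this is used.\<close>

definition generate_maximal_ideal ::
  "'n::finite proj set \<Rightarrow> 'n proj \<Rightarrow> nat \<Rightarrow> (nat \<Rightarrow> 'n proj \<Rightarrow> complex) \<Rightarrow> bool" where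
  "generate_maximal_ideal X p n z \<longleftrightarrow>
     (\<forall>j<n. z j \<in> stalk X (regular X) p \<and> z j p = 0) \<and>
     (\<forall>f\<in>stalk X (regular X) p. f p = 0 \<longrightarrow>
        (\<exists>a V. (\<forall>j<n. a j \<in> stalk X (regular X) p) \<and> open_in_variety X V \<and> p \<in> V \<and>
           (\<forall>q\<in>V. f q = (\<Sum>j<n. a j q * z j q))))"

text \<open>The components \<open>D i\<close>, \<open>i \<in> I\<close>, are distinct smooth prime divisors, and around each point
  there are local coordinates such that the components through the point are
  defined by pairwise different coordinates.\<close>

definition snc_divisor :: "'n::finite proj set \<Rightarrow> 'i set \<Rightarrow> ('i \<Rightarrow> 'n proj set) \<Rightarrow> bool" where
  "snc_divisor X I D \<longleftrightarrow> finite I \<and> inj_on D I \<and>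
     (\<forall>i\<in>I. prime_divisor X (D i) \<and> smooth (D i)) \<and>
     (\<forall>p\<in>X. \<exists>n z \<tau>. enat n = krull_dim X \<and> generate_maximal_ideal X p n z \<and>
        inj_on \<tau> {i \<in> I. p \<in> D i} \<and>
        (\<forall>i\<in>I. p \<in> D i \<longrightarrow> \<tau> i < n \<and>
           (\<exists>V. p \<in> V \<and> local_equation X (D i) V (restr V (z (\<tau> i))))))"


section \<open>Sheaves of modules and exact sequences\<close>

text \<open>A sheaf of modules over the structure sheaf of \<open>X\<close>: sections over an open set, restriction
  to a smaller open set, zero section over an open set, addition, and multiplication by
  regular functions.\<close>

record ('p, 's) module_sheaf =
  sections :: "'p set \<Rightarrow> 's set"
  restriction :: "'p set \<Rightarrow> 's \<Rightarrow> 's"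
  zero_section :: "'p set \<Rightarrow> 's"
  plus_section :: "'s \<Rightarrow> 's \<Rightarrow> 's"
  scale_section :: "('p \<Rightarrow> complex) \<Rightarrow> 's \<Rightarrow> 's"

definition sheaf_hom ::
  "'n::finite proj set \<Rightarrow> ('n proj, 's) module_sheaf \<Rightarrow> ('n proj, 't) module_sheaf
     \<Rightarrow> ('n proj set \<Rightarrow> 's \<Rightarrow> 't) \<Rightarrow> bool" where
  "sheaf_hom X F G \<phi> \<longleftrightarrow>
     (\<forall>U. open_in_variety X U \<longrightarrow>
        (\<forall>s\<in>sections F U. \<phi> U s \<in> sections G U) \<and>
        (\<forall>s\<in>sections F U. \<forall>t\<in>sections F U.
           \<phi> U (plus_section F s t) = plus_section G (\<phi> U s) (\<phi> U t)) \<and>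
        (\<forall>f\<in>regular X U. \<forall>s\<in>sections F U.
           \<phi> U (scale_section F f s) = scale_section G f (\<phi> U s)) \<and>
        (\<forall>V. open_in_variety X V \<longrightarrow> V \<subseteq> U \<longrightarrow>
           (\<forall>s\<in>sections F U. \<phi> V (restriction F V s) = restriction G V (\<phi> U s))))"

text \<open>Section \<open>s\<close> over \<open>U\<close> is locally in the image of \<open>\<phi>\<close>, i.e. it is a section of the image sheaf.\<close>

definition in_image_sheaf ::
  "'n::finite proj set \<Rightarrow> ('n proj, 's) module_sheaf \<Rightarrow> ('n proj, 't) module_sheaf
     \<Rightarrow> ('n proj set \<Rightarrow> 's \<Rightarrow> 't) \<Rightarrow> 'n proj set \<Rightarrow> 't \<Rightarrow> bool" where
  "in_image_sheaf X F G \<phi> U s \<longleftrightarrow>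
     (\<forall>p\<in>U. \<exists>V. open_in_variety X V \<and> p \<in> V \<and> V \<subseteq> U \<and>
        (\<exists>t\<in>sections F V. \<phi> V t = restriction G V s))"

text \<open>Exactness of \<open>0 \<rightarrow> F \<rightarrow> G \<rightarrow> H \<rightarrow> 0\<close>.\<close>

definition short_exact ::
  "'n::finite proj set \<Rightarrow> ('n proj, 's) module_sheaf \<Rightarrow> ('n proj, 't) module_sheaf
     \<Rightarrow> ('n proj, 'u) module_sheaf
     \<Rightarrow> ('n proj set \<Rightarrow> 's \<Rightarrow> 't) \<Rightarrow> ('n proj set \<Rightarrow> 't \<Rightarrow> 'u) \<Rightarrow> bool" where
  "short_exact X F G H \<phi> \<psi> \<longleftrightarrow>
     sheaf_hom X F G \<phi> \<and> sheaf_hom X G H \<psi> \<and>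
     (\<forall>U. open_in_variety X U \<longrightarrow>
        inj_on (\<phi> U) (sections F U) \<and>
        (\<forall>s\<in>sections G U. \<psi> U s = zero_section H U \<longleftrightarrow> in_image_sheaf X F G \<phi> U s) \<and>
        (\<forall>s\<in>sections H U. in_image_sheaf X G H \<psi> U s))"


section \<open>Logarithmic symmetric forms\<close>

text \<open>A symmetric form assigns to a point \<open>q\<close> and a tangent vector \<open>v\<close> at \<open>q\<close> the value of a
  homogeneous polynomial function on the tangent space at \<open>q\<close>. As the tangent spaces are
  finite-dimensional over an infinite field, such functions are the elements of the symmetric power
  of the cotangent space.\<close>

type_synonym 'n form = "'n proj \<Rightarrow> 'n tangent_vector \<Rightarrow> complex"

definition scale_form :: "('n proj \<Rightarrow> complex) \<Rightarrow> 'n form \<Rightarrow> 'n form" where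
  "scale_form f \<omega> = (\<lambda>q v. f q * \<omega> q v)"

text \<open>The one-forms \<open>df\<close>, and \<open>d\<sigma>/\<sigma>\<close> for \<open>\<sigma>\<close> a local equation of a component, on \<open>V\<close>.\<close>

definition log_generators ::
  "'n::finite proj set \<Rightarrow> 'i set \<Rightarrow> ('i \<Rightarrow> 'n proj set) \<Rightarrow> 'n proj set \<Rightarrow> 'n form set" where
  "log_generators X I D V =
     {\<lambda>q v. v f | f. f \<in> regular X V} \<union>
     {\<lambda>q v. v \<sigma> / \<sigma> q | \<sigma> i. i \<in> I \<and> local_equation X (D i) V \<sigma>}"

text \<open>Logarithmic symmetric forms of degree \<open>m\<close> on \<open>U\<close>, with divisor \<open>D\<close> the sum of the \<open>D i\<close>,
  \<open>i \<in> I\<close>, as forms on the complement of \<open>D\<close> in \<open>U\<close> (that is, as a subsheaf of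
  the direct image of the symmetric forms on the complement). Locally on \<open>U\<close> they are
  combinations of products of \<open>m\<close> generators with coefficients regular on \<open>U\<close>, across \<open>D\<close>.\<close>

definition log_forms ::
  "'n::finite proj set \<Rightarrow> 'i set \<Rightarrow> ('i \<Rightarrow> 'n proj set) \<Rightarrow> nat \<Rightarrow> 'n proj set \<Rightarrow> 'n form set" where
  "log_forms X I D m U = {\<omega>.
     (\<forall>q v. q \<notin> U - (\<Union>i\<in>I. D i) \<or> v \<notin> tangent_space X q \<longrightarrow> \<omega> q v = 0) \<and>
     (\<forall>p\<in>U. \<exists>V. open_in_variety X V \<and> p \<in> V \<and> V \<subseteq> U \<and>
        (\<exists>(r::nat) f \<theta>. (\<forall>j<r. f j \<in> regular X V) \<and>
           (\<forall>j<r. \<forall>l<m. \<theta> j l \<in> log_generators X I D V) \<and>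
           (\<forall>q\<in>V - (\<Union>i\<in>I. D i). \<forall>v\<in>tangent_space X q.
              \<omega> q v = (\<Sum>j<r. f j q * (\<Prod>l<m. \<theta> j l q v)))))}"

text \<open>Forms with pole order at most \<open>k\<close> along \<open>D c\<close>. The condition is imposed on all open subsets
  on which \<open>D c\<close> has an equation, since it need not have one on \<open>U\<close>. A form \<open>\<eta>\<close> with poles
  along the remaining components only is identified with its restriction to the complement of
  all components.\<close>

definition pole_forms ::
  "'n::finite proj set \<Rightarrow> 'i set \<Rightarrow> ('i \<Rightarrow> 'n proj set) \<Rightarrow> 'i \<Rightarrow> nat \<Rightarrow> nat \<Rightarrow> 'n proj set \<Rightarrow> 'n form set"
  where
  "pole_forms X I D c m k U = {\<omega> \<in> log_forms X I D m U.
     \<forall>V \<sigma>. V \<subseteq> U \<longrightarrow> local_equation X (D c) V \<sigma> \<longrightarrow>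
       (\<exists>\<eta>\<in>log_forms X (I - {c}) D m V.
          \<forall>q\<in>V - (\<Union>i\<in>I. D i). \<forall>v. \<eta> q v = \<sigma> q ^ k * \<omega> q v)}"

definition form_sheaf :: "('n::finite proj set \<Rightarrow> 'n form set) \<Rightarrow> ('n proj, 'n form) module_sheaf" where
  "form_sheaf S = \<lparr>sections = S, restriction = restr, zero_section = (\<lambda>U. 0),
     plus_section = (+), scale_section = scale_form\<rparr>"


section \<open>Restriction of a sheaf to a closed subset\<close>

text \<open>The stalk at \<open>q\<close> of the submodule generated by the products of sections of \<open>S\<close> with
  functions vanishing on \<open>Y\<close>.\<close>

definition ideal_times_stalk ::
  "'n::finite proj set \<Rightarrow> 'n proj set \<Rightarrow> ('n proj set \<Rightarrow> 'n form set) \<Rightarrow> 'n proj \<Rightarrow> 'n form set" where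
  "ideal_times_stalk X Y S q = {\<omega>. \<exists>V. open_in_variety X V \<and> q \<in> V \<and>
     (\<exists>(r::nat) f e. (\<forall>j<r. f j \<in> regular X V \<and> (\<forall>x\<in>V \<inter> Y. f j x = 0) \<and> e j \<in> S V) \<and>
        restr V \<omega> = (\<Sum>j<r. scale_form (f j) (e j)))}"

text \<open>\<open>S|\<^sub>Y\<close>, regarded as a sheaf on \<open>X\<close> supported on \<open>Y\<close>, i.e. the quotient of \<open>S\<close> by its product
  with the ideal sheaf of \<open>Y\<close>. Since this is a sheaf quotient, a section over \<open>U\<close>
  is a family of elements of the quotients of the stalks that is locally induced by sections of
  \<open>S\<close>. The elements of these quotients are cosets, added with the setwise sum.\<close>

definition restrict_sheaf ::
  "'n::finite proj set \<Rightarrow> 'n proj set \<Rightarrow> ('n proj set \<Rightarrow> 'n form set)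
     \<Rightarrow> ('n proj, 'n proj \<Rightarrow> 'n form set) module_sheaf" where
  "restrict_sheaf X Y S = \<lparr>
     sections = (\<lambda>U. {s. (\<forall>q. q \<notin> U \<longrightarrow> s q = {}) \<and>
       (\<forall>p\<in>U. \<exists>V. open_in_variety X V \<and> p \<in> V \<and> V \<subseteq> U \<and>
          (\<exists>e\<in>S V. \<forall>q\<in>V. s q = e +o ideal_times_stalk X Y S q))}),
     restriction = (\<lambda>V s q. if q \<in> V then s q else {}),
     zero_section = (\<lambda>U q. if q \<in> U then ideal_times_stalk X Y S q else {}),
     plus_section = (\<lambda>s t q. s q + t q),
     scale_section = (\<lambda>f s q. scale_form f ` s q + ideal_times_stalk X Y S q)\<rparr>"

end

theory Submission
  imports Defs
begin

text \<open>Near a point of \<open>D c\<close> let \<open>\<sigma>\<close> be an equation of \<open>D c\<close>. A form of pole order at most \<open>k\<close> is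
  \<open>(d\<sigma>/\<sigma>)\<^sup>k \<epsilon>\<close> modulo forms of pole order at most \<open>k - 1\<close>, where \<open>\<epsilon>\<close> is a form of degree \<open>m - k\<close>
  with logarithmic poles along the other components only, and the class of \<open>\<epsilon>\<close> modulo \<open>\<sigma>\<close> is
  unique: this class is the second map. It does not depend on \<open>\<sigma>\<close>, since for a unit \<open>u\<close> the
  forms \<open>d(u\<sigma>)/(u\<sigma>)\<close> and \<open>d\<sigma>/\<sigma>\<close> differ by the regular form \<open>du/u\<close>. Existence and uniqueness of
  \<open>\<epsilon>\<close> are read off from the coefficients of the monomials in a logarithmic coframe. The coefficients
  are unique off \<open>D\<close>, where smoothness makes the differentials of local coordinates a basis of
  each cotangent space, hence everywhere by density.\<close>

section \<open>Germs of regular functions and tangent vectors\<close>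

text \<open>The data are pointwise: generators of the maximal ideal at a point \<open>p\<close> and
  a dimension for each tangent space. The argument needs them on a neighbourhood. Once the dz_j
  generate the differentials at \<open>p\<close>, finitely many affine coordinates suffice to carry
  this to all nearby points, and the dimension of the tangent spaces there leaves no room for
  relations between the dz_j.

  The main obstacle is that forms are functions of tangent vectors off \<open>D\<close> only, so an
  identity between forms says nothing on \<open>D c\<close>, which is where the third sheaf lives.
  Identities are therefore moved to coefficients in a coframe, which are regular across
  \<open>D\<close>. The coframe with a pole along \<open>D c\<close> and the one without differ in
  one entry, by the factor \<sigma>, so pole order is measured by the exponent of that entry in a
  monomial.

  All sheaf conditions are rephrased as conditions on germs, with a filter of Zariski
  neighbourhoods; forms are compared only off the divisor and on tangent vectors. Passing back to
  sections means restricting to an open set and cutting to 0 elsewhere.\<close>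

lemma finite_exponents: "finite {e :: 'n::finite \<Rightarrow> nat. sum e UNIV = d}"
proof (rule finite_subset)
  show "{e :: 'n \<Rightarrow> nat. sum e UNIV = d} \<subseteq> Pi\<^sub>E UNIV (\<lambda>_. {..d})"
    by (auto simp: PiE_UNIV_domain intro: member_le_sum)
qed (auto intro!: finite_PiE)

lemma homogeneous_poly_monomial:
  assumes "sum e UNIV = d"
  shows "homogeneous_poly d (\<lambda>x :: complex ^ 'n::finite. a * (\<Prod>i\<in>UNIV. (x $ i) ^ e i))"
  unfolding homogeneous_poly_def
proof (intro exI ext)
  fix x :: "complex ^ 'n"
  have "(\<Sum>e' | sum e' UNIV = d. (if e' = e then a else 0) * (\<Prod>i\<in>UNIV. (x $ i) ^ e' i)) =
    (\<Sum>e' | sum e' UNIV = d. if e' = e then a * (\<Prod>i\<in>UNIV. (x $ i) ^ e' i) else 0)"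
    by (intro sum.cong) auto
  also have "\<dots> = a * (\<Prod>i\<in>UNIV. (x $ i) ^ e i)"
    using assms finite_exponents by (subst sum.delta) auto
  finally show "a * (\<Prod>i\<in>UNIV. (x $ i) ^ e i) =
      (\<Sum>e' | sum e' UNIV = d. (if e' = e then a else 0) * (\<Prod>i\<in>UNIV. (x $ i) ^ e' i))" ..
qed

lemma homogeneous_poly_zero: "homogeneous_poly d (\<lambda>x. 0)"
  unfolding homogeneous_poly_def by (intro exI[of _ "\<lambda>_. 0"]) auto

lemma homogeneous_poly_add:
  assumes "homogeneous_poly d F" "homogeneous_poly d G"
  shows "homogeneous_poly d (\<lambda>x. F x + G x)"
proof -
  obtain a b where F: "F = (\<lambda>x. \<Sum>e | sum e UNIV = d. a e * (\<Prod>i\<in>UNIV. (x $ i) ^ e i))"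
    and G: "G = (\<lambda>x. \<Sum>e | sum e UNIV = d. b e * (\<Prod>i\<in>UNIV. (x $ i) ^ e i))"
    using assms unfolding homogeneous_poly_def by blast
  show ?thesis
    unfolding homogeneous_poly_def F G
    by (rule exI[of _ "\<lambda>e. a e + b e"]) (auto simp: ring_distribs sum.distrib)
qed

lemma homogeneous_poly_sum:
  "(\<And>i. i \<in> A \<Longrightarrow> homogeneous_poly d (F i)) \<Longrightarrow> homogeneous_poly d (\<lambda>x. \<Sum>i\<in>A. F i x)"
  by (induction A rule: infinite_finite_induct)
     (auto intro: homogeneous_poly_zero homogeneous_poly_add)

lemma homogeneous_poly_mult:
  assumes "homogeneous_poly d F" "homogeneous_poly d' G"
  shows "homogeneous_poly (d + d') (\<lambda>x :: complex ^ 'n::finite. F x * G x)"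
proof -
  obtain a b where F: "F = (\<lambda>x. \<Sum>e | sum e UNIV = d. a e * (\<Prod>i\<in>UNIV. (x $ i) ^ e i))"
    and G: "G = (\<lambda>x. \<Sum>e | sum e UNIV = d'. b e * (\<Prod>i\<in>UNIV. (x $ i) ^ e i))"
    using assms unfolding homogeneous_poly_def by blast
  have eq: "(\<lambda>x. F x * G x) = (\<lambda>x. \<Sum>e | sum e UNIV = d. \<Sum>e' | sum e' UNIV = d'.
       (a e * b e') * (\<Prod>i\<in>UNIV. (x $ i) ^ (e i + e' i)))"
    unfolding F G by (auto simp: sum_product power_add prod.distrib algebra_simps)
  show ?thesis
    unfolding eq
    by (intro homogeneous_poly_sum homogeneous_poly_monomial) (auto simp: sum.distrib)
qed

lemma homogeneous_poly_const: "homogeneous_poly 0 (\<lambda>x. a)"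
  using homogeneous_poly_monomial[of "\<lambda>_. 0" 0 a] by simp

lemma homogeneous_poly_coordinate: "homogeneous_poly 1 (\<lambda>x :: complex ^ 'n::finite. x $ i)"
proof -
  have "(\<Prod>j\<in>UNIV. (x $ j) ^ (if j = i then 1 else 0)) = x $ i" for x :: "complex ^ 'n"
    by (subst prod.cong[OF refl, where h = "\<lambda>j. if j = i then x $ j else 1"]) auto
  then show ?thesis
    using homogeneous_poly_monomial[of "\<lambda>j. if j = i then 1 else 0" 1 1] by simp
qed

section \<open>Points and their homogeneous coordinate vectors\<close>

lemma coords_nonempty: "coords p \<noteq> {}"
proof
  assume "coords p = {}"
  then have "Rep_proj p \<subseteq> vec.span {}" by (auto simp: coords_def)
  then have "vec.dim (Rep_proj p) \<le> card ({} :: (complex ^ 'a) set)"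
    by (rule vec.dim_le_card) auto
  moreover have "vec.dim (Rep_proj p) = 1"
    using Rep_proj[of p] by blast
  ultimately show False by (metis card.empty not_one_le_zero)
qed

lemma coords_proportional:
  assumes "x \<in> coords p" "y \<in> coords p"
  shows "\<exists>a. a \<noteq> 0 \<and> y = a *s x"
proof -
  let ?L = "Rep_proj p"
  have L: "vec.subspace ?L" "vec.dim ?L = 1" using Rep_proj[of p] by auto
  have x: "x \<in> ?L" "x \<noteq> 0" and y: "y \<in> ?L" "y \<noteq> 0" using assms by (auto simp: coords_def)
  have "vec.independent {x}" using x by (simp add: vec.dependent_single)
  then have "?L \<subseteq> vec.span {x}"
    using vec.card_eq_dim[of "{x}" ?L] L x by simp
  then obtain a where "y = a *s x" using y vec.span_singleton[of x] by auto
  with y show ?thesis by (intro exI[of _ a]) auto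
qed

lemma coords_scale:
  assumes "x \<in> coords p" "a \<noteq> 0"
  shows "a *s x \<in> coords p"
  using assms Rep_proj[of p] by (auto simp: coords_def vec.subspace_scale)

section \<open>Zariski neighbourhoods as a filter\<close>

definition nbhd :: "'n::finite proj set \<Rightarrow> 'n proj \<Rightarrow> 'n proj filter" where
  "nbhd X p = (INF V\<in>{V. open_in_variety X V \<and> p \<in> V}. principal V)"

lemma topspace_zariski: "topspace (zariski :: 'n::finite proj topology) = UNIV"
proof -
  have "openin zariski ({p. \<forall>x\<in>coords p. (\<lambda>x. 1) x \<noteq> (0::complex)} :: 'n proj set)"
    unfolding zariski_def
    by (intro topology_generated_by_Basis CollectI exI[of _ "\<lambda>x. 1"] conjI refl
      exI[of _ "0::nat"] homogeneous_poly_const)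
  then show ?thesis using openin_subset by fastforce
qed

lemma openin_nonvanishing:
  assumes "homogeneous_poly d F"
  shows "open_in_variety X (X \<inter> {p. \<forall>x\<in>coords p. F x \<noteq> 0})"
proof -
  have "openin zariski {p. \<forall>x\<in>coords p. F x \<noteq> 0}"
    unfolding zariski_def by (rule topology_generated_by_Basis) (use assms in auto)
  then show ?thesis by (auto simp: openin_subtopology)
qed

lemma open_in_variety_subset: "open_in_variety X V \<Longrightarrow> V \<subseteq> X"
  using openin_subset by fastforce

lemma open_in_variety_self: "open_in_variety X X"
  using openin_nonvanishing[OF homogeneous_poly_const[of 1], of X] by simp

text \<open>Intersections of open neighbourhoods make the family directed, so a single neighbourhood
  witnesses the filter statement. For \<open>p\<close> outside \<open>X\<close> the family is empty
  and the filter is \<open>top\<close>, whence the condition \<open>p \<in> X\<close> here and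
  below.\<close>

lemma eventually_nbhd:
  assumes "p \<in> X"
  shows "eventually P (nbhd X p) \<longleftrightarrow> (\<exists>V. open_in_variety X V \<and> p \<in> V \<and> (\<forall>q\<in>V. P q))"
  unfolding nbhd_def
proof (subst eventually_INF_base)
  show "{V. open_in_variety X V \<and> p \<in> V} \<noteq> {}"
    using assms open_in_variety_self by blast
  show "\<exists>x\<in>{V. open_in_variety X V \<and> p \<in> V}. principal x \<le> inf (principal a) (principal b)"
    if "a \<in> {V. open_in_variety X V \<and> p \<in> V}" "b \<in> {V. open_in_variety X V \<and> p \<in> V}" for a b
    using that by (intro bexI[of _ "a \<inter> b"]) auto
qed (auto simp: eventually_principal)

lemma eventually_nbhdE:
  assumes "eventually P (nbhd X p)" "p \<in> X"
  obtains V where "open_in_variety X V" "p \<in> V" "\<And>q. q \<in> V \<Longrightarrow> P q"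
proof -
  from assms(1) obtain V where "open_in_variety X V \<and> p \<in> V \<and> (\<forall>q\<in>V. P q)"
    unfolding eventually_nbhd[OF assms(2)] ..
  then show thesis by (intro that[of V]) auto
qed

lemma eventually_nbhdI:
  assumes "open_in_variety X V" "p \<in> V" "\<And>q. q \<in> V \<Longrightarrow> P q"
  shows "eventually P (nbhd X p)"
proof -
  have "p \<in> X" using assms open_in_variety_subset by blast
  then show ?thesis using assms eventually_nbhd by blast
qed

text \<open>Neighbourhoods are not punctured, so what holds near \<open>p\<close> may be evaluated
  at \<open>p\<close> itself.\<close>

lemma eventually_nbhd_self:
  assumes "eventually P (nbhd X p)" "p \<in> X"
  shows "P p"
  using assms unfolding eventually_nbhd[OF assms(2)] by blast

lemma eventually_nbhd_in: "open_in_variety X V \<Longrightarrow> p \<in> V \<Longrightarrow> eventually (\<lambda>q. q \<in> V) (nbhd X p)"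
  by (rule eventually_nbhdI)

lemma eventually_nbhd_variety: "p \<in> X \<Longrightarrow> eventually (\<lambda>q. q \<in> X) (nbhd X p)"
  using eventually_nbhd_in[OF open_in_variety_self] .

text \<open>An open neighbourhood of \<open>p\<close> is a neighbourhood of each of its points. This
  moves an identity of germs at \<open>p\<close> to the germs at all nearby points, where tangent
  vectors can be applied to it.\<close>

lemma eventually_eventually_nbhd:
  assumes "eventually P (nbhd X p)" "p \<in> X"
  shows "eventually (\<lambda>q. eventually P (nbhd X q)) (nbhd X p)"
proof -
  obtain V where V: "open_in_variety X V" "p \<in> V" "\<And>q. q \<in> V \<Longrightarrow> P q"
    by (rule eventually_nbhdE[OF assms]) blast
  show ?thesis by (rule eventually_nbhdI[OF V(1,2)]) (rule eventually_nbhdI[OF V(1) _ V(3)])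
qed

section \<open>The local rings\<close>

abbreviation germs :: "'n::finite proj set \<Rightarrow> 'n proj \<Rightarrow> ('n proj \<Rightarrow> complex) set" where
  "germs X p \<equiv> stalk X (regular X) p"

text \<open>Near \<open>p\<close> a single quotient of homogeneous polynomials suffices, since
  \<open>regular\<close> already provides one on some neighbourhood. The ring operations are then
  carried out on such quotients without mention of open sets.\<close>

lemma germs_iff:
  assumes "p \<in> X"
  shows "f \<in> germs X p \<longleftrightarrow> (\<exists>d F G. homogeneous_poly d F \<and> homogeneous_poly d G \<and>
    (\<forall>\<^sub>F q in nbhd X p. \<forall>x\<in>coords q. G x \<noteq> 0 \<and> f q = F x / G x))" (is "?L \<longleftrightarrow> ?R")
proof
  assume ?L
  then obtain V where V: "open_in_variety X V" "p \<in> V" "restr V f \<in> regular X V"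
    by (auto simp: stalk_def)
  from V(2,3) obtain W d F G where W: "open_in_variety X W" "p \<in> W" "W \<subseteq> V"
    "homogeneous_poly d F" "homogeneous_poly d G"
    "\<forall>q\<in>W. \<forall>x\<in>coords q. G x \<noteq> 0 \<and> restr V f q = F x / G x"
    unfolding regular_def by blast
  have "\<forall>\<^sub>F q in nbhd X p. \<forall>x\<in>coords q. G x \<noteq> 0 \<and> f q = F x / G x"
    by (rule eventually_nbhdI[OF W(1,2)]) (use W(3,6) in \<open>simp add: restr_def subset_iff\<close>)
  then show ?R using W by blast
next
  assume ?R
  then obtain d F G where FG: "homogeneous_poly d F" "homogeneous_poly d G"
    "\<forall>\<^sub>F q in nbhd X p. \<forall>x\<in>coords q. G x \<noteq> 0 \<and> f q = F x / G x" by blast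
  obtain V where V: "open_in_variety X V" "p \<in> V"
    "\<And>q. q \<in> V \<Longrightarrow> \<forall>x\<in>coords q. G x \<noteq> 0 \<and> f q = F x / G x"
    using eventually_nbhdE[OF FG(3) assms] by blast
  have "restr V f \<in> regular X V"
    unfolding regular_def
  proof (intro CollectI conjI ballI)
    fix q assume "q \<in> V"
    with V FG show "\<exists>W d F G. open_in_variety X W \<and> q \<in> W \<and> W \<subseteq> V \<and> homogeneous_poly d F \<and>
      homogeneous_poly d G \<and> (\<forall>q\<in>W. \<forall>x\<in>coords q. G x \<noteq> 0 \<and> restr V f q = F x / G x)"
      by (intro exI[of _ V] exI[of _ d] exI[of _ F] exI[of _ G]) (auto simp: restr_def)
  qed (auto simp: restr_def)
  with V show ?L by (auto simp: stalk_def)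
qed

lemma germsE:
  assumes "f \<in> germs X p" "p \<in> X"
  obtains d F G where "homogeneous_poly d F" "homogeneous_poly d G"
    "\<forall>\<^sub>F q in nbhd X p. \<forall>x\<in>coords q. G x \<noteq> 0 \<and> f q = F x / G x"
  using assms germs_iff by blast

lemma germs_cong:
  assumes "f \<in> germs X p" "p \<in> X" "\<forall>\<^sub>F q in nbhd X p. f q = g q"
  shows "g \<in> germs X p"
proof -
  obtain d F G where FG: "homogeneous_poly d F" "homogeneous_poly d G"
    "\<forall>\<^sub>F q in nbhd X p. \<forall>x\<in>coords q. G x \<noteq> 0 \<and> f q = F x / G x"
    using germsE[OF assms(1,2)] .
  have "\<forall>\<^sub>F q in nbhd X p. \<forall>x\<in>coords q. G x \<noteq> 0 \<and> g q = F x / G x"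
    using FG(3) assms(3) by eventually_elim auto
  then show ?thesis using FG assms(2) germs_iff by blast
qed

lemma germs_eventually:
  assumes "f \<in> germs X p" "p \<in> X"
  shows "\<forall>\<^sub>F q in nbhd X p. f \<in> germs X q"
proof -
  obtain d F G where FG: "homogeneous_poly d F" "homogeneous_poly d G"
    "\<forall>\<^sub>F q in nbhd X p. \<forall>x\<in>coords q. G x \<noteq> 0 \<and> f q = F x / G x"
    using germsE[OF assms] .
  show ?thesis
    using eventually_eventually_nbhd[OF FG(3) assms(2)] eventually_nbhd_variety[OF assms(2)]
    by eventually_elim (use FG germs_iff in blast)
qed

lemma germs_const:
  assumes "p \<in> X"
  shows "(\<lambda>q. a) \<in> germs X p"
proof -
  have "\<forall>\<^sub>F q in nbhd X p. \<forall>x\<in>coords q. 1 \<noteq> (0::complex) \<and> a = a / 1" by simp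
  then show ?thesis
    using homogeneous_poly_const[of a] homogeneous_poly_const[of 1] germs_iff[OF assms] by blast
qed

lemma germs_add:
  assumes "f \<in> germs X p" "g \<in> germs X p" "p \<in> X"
  shows "(\<lambda>q. f q + g q) \<in> germs X p"
proof -
  obtain d F G where FG: "homogeneous_poly d F" "homogeneous_poly d G"
    "\<forall>\<^sub>F q in nbhd X p. \<forall>x\<in>coords q. G x \<noteq> 0 \<and> f q = F x / G x"
    using germsE[OF assms(1,3)] .
  obtain d' F' G' where FG': "homogeneous_poly d' F'" "homogeneous_poly d' G'"
    "\<forall>\<^sub>F q in nbhd X p. \<forall>x\<in>coords q. G' x \<noteq> 0 \<and> g q = F' x / G' x"
    using germsE[OF assms(2,3)] .
  have 1: "homogeneous_poly (d + d') (\<lambda>x. F x * G' x + G x * F' x)"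
    using FG FG' by (intro homogeneous_poly_add homogeneous_poly_mult)
  have 2: "homogeneous_poly (d + d') (\<lambda>x. G x * G' x)"
    using FG FG' by (intro homogeneous_poly_mult)
  have "\<forall>\<^sub>F q in nbhd X p. \<forall>x\<in>coords q. G x * G' x \<noteq> 0 \<and>
      f q + g q = (F x * G' x + G x * F' x) / (G x * G' x)"
    using FG(3) FG'(3) by eventually_elim (auto simp: field_simps)
  with 1 2 show ?thesis using germs_iff[OF assms(3)] by blast
qed

lemma germs_mult:
  assumes "f \<in> germs X p" "g \<in> germs X p" "p \<in> X"
  shows "(\<lambda>q. f q * g q) \<in> germs X p"
proof -
  obtain d F G where FG: "homogeneous_poly d F" "homogeneous_poly d G"
    "\<forall>\<^sub>F q in nbhd X p. \<forall>x\<in>coords q. G x \<noteq> 0 \<and> f q = F x / G x"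
    using germsE[OF assms(1,3)] .
  obtain d' F' G' where FG': "homogeneous_poly d' F'" "homogeneous_poly d' G'"
    "\<forall>\<^sub>F q in nbhd X p. \<forall>x\<in>coords q. G' x \<noteq> 0 \<and> g q = F' x / G' x"
    using germsE[OF assms(2,3)] .
  have 1: "homogeneous_poly (d + d') (\<lambda>x. F x * F' x)"
    using FG FG' by (intro homogeneous_poly_mult)
  have 2: "homogeneous_poly (d + d') (\<lambda>x. G x * G' x)"
    using FG FG' by (intro homogeneous_poly_mult)
  have "\<forall>\<^sub>F q in nbhd X p. \<forall>x\<in>coords q. G x * G' x \<noteq> 0 \<and>
      f q * g q = (F x * F' x) / (G x * G' x)"
    using FG(3) FG'(3) by eventually_elim (auto simp: field_simps)
  with 1 2 show ?thesis using germs_iff[OF assms(3)] by blast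
qed

lemma germs_uminus:
  assumes "f \<in> germs X p" "p \<in> X"
  shows "(\<lambda>q. - f q) \<in> germs X p"
  using germs_mult[OF germs_const[OF assms(2), of "-1"] assms] by simp

lemma germs_diff:
  assumes "f \<in> germs X p" "g \<in> germs X p" "p \<in> X"
  shows "(\<lambda>q. f q - g q) \<in> germs X p"
  using germs_add[OF assms(1) germs_uminus[OF assms(2,3)] assms(3)] by simp

lemma germs_sum:
  assumes "\<And>i. i \<in> A \<Longrightarrow> f i \<in> germs X p" "p \<in> X"
  shows "(\<lambda>q. \<Sum>i\<in>A. f i q) \<in> germs X p"
  using assms(1)
  by (induction A rule: infinite_finite_induct) (auto intro: germs_add germs_const assms(2))

lemma germs_power:
  assumes "f \<in> germs X p" "p \<in> X"
  shows "(\<lambda>q. f q ^ k) \<in> germs X p"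
  by (induction k) (auto intro: germs_mult germs_const assms)

text \<open>The nonvanishing locus of the numerator is one of the generating open sets. This also
  shows that a germ with nonzero value is a unit: its quotient may be turned upside down.\<close>

lemma germs_eventually_nonzero:
  assumes "f \<in> germs X p" "p \<in> X" "f p \<noteq> 0"
  shows "\<forall>\<^sub>F q in nbhd X p. f q \<noteq> 0"
proof -
  obtain d F G where FG: "homogeneous_poly d F" "homogeneous_poly d G"
    "\<forall>\<^sub>F q in nbhd X p. \<forall>x\<in>coords q. G x \<noteq> 0 \<and> f q = F x / G x"
    using germsE[OF assms(1,2)] .
  have "p \<in> X \<inter> {p. \<forall>x\<in>coords p. F x \<noteq> 0}"
    using eventually_nbhd_self[OF FG(3) assms(2)] assms by fastforce
  then have "\<forall>\<^sub>F q in nbhd X p. q \<in> X \<inter> {p. \<forall>x\<in>coords p. F x \<noteq> 0}"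
    using eventually_nbhd_in openin_nonvanishing[OF FG(1)] by blast
  with FG(3) show ?thesis
    by eventually_elim (use coords_nonempty in fastforce)
qed

lemma germs_inverse:
  assumes "f \<in> germs X p" "p \<in> X" "f p \<noteq> 0"
  shows "(\<lambda>q. inverse (f q)) \<in> germs X p"
proof -
  obtain d F G where FG: "homogeneous_poly d F" "homogeneous_poly d G"
    "\<forall>\<^sub>F q in nbhd X p. \<forall>x\<in>coords q. G x \<noteq> 0 \<and> f q = F x / G x"
    using germsE[OF assms(1,2)] .
  have "\<forall>\<^sub>F q in nbhd X p. \<forall>x\<in>coords q. F x \<noteq> 0 \<and> inverse (f q) = G x / F x"
    using FG(3) germs_eventually_nonzero[OF assms]
    by eventually_elim (auto simp: field_simps)
  then show ?thesis using FG germs_iff[OF assms(2)] by blast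
qed

lemma regular_iff:
  assumes "open_in_variety X U"
  shows "f \<in> regular X U \<longleftrightarrow> (\<forall>q. q \<notin> U \<longrightarrow> f q = 0) \<and> (\<forall>p\<in>U. f \<in> germs X p)"
proof safe
  fix p assume f: "f \<in> regular X U" "p \<in> U"
  then have "restr U f = f" by (auto simp: restr_def regular_def)
  then show "f \<in> germs X p" using f assms by (auto simp: stalk_def)
next
  fix q assume "f \<in> regular X U" "q \<notin> U"
  then show "f q = 0" by (auto simp: regular_def)
next
  assume f: "\<forall>q. q \<notin> U \<longrightarrow> f q = 0" "\<forall>p\<in>U. f \<in> germs X p"
  show "f \<in> regular X U"
    unfolding regular_def
  proof (intro CollectI conjI ballI)
    fix p assume p: "p \<in> U"
    then have pX: "p \<in> X" using assms open_in_variety_subset by blast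
    obtain d F G where FG: "homogeneous_poly d F" "homogeneous_poly d G"
      "\<forall>\<^sub>F q in nbhd X p. \<forall>x\<in>coords q. G x \<noteq> 0 \<and> f q = F x / G x"
      using germsE f(2) p pX by blast
    have "\<forall>\<^sub>F q in nbhd X p. q \<in> U \<and> (\<forall>x\<in>coords q. G x \<noteq> 0 \<and> f q = F x / G x)"
      using FG(3) eventually_nbhd_in[OF assms p] by eventually_elim auto
    then obtain V where "open_in_variety X V" "p \<in> V" 
      "\<And>q. q \<in> V \<Longrightarrow> q \<in> U \<and> (\<forall>x\<in>coords q. G x \<noteq> 0 \<and> f q = F x / G x)"
      using eventually_nbhdE pX by blast
    then show "\<exists>V d F G. open_in_variety X V \<and> p \<in> V \<and> V \<subseteq> U \<and> homogeneous_poly d F \<and>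
      homogeneous_poly d G \<and> (\<forall>q\<in>V. \<forall>x\<in>coords q. G x \<noteq> 0 \<and> f q = F x / G x)"
      using FG by (intro exI[of _ V] exI[of _ d] exI[of _ F] exI[of _ G]) auto
  qed (use f in auto)
qed

lemma regular_germs:
  assumes "f \<in> regular X U" "open_in_variety X U" "p \<in> U"
  shows "f \<in> germs X p"
  using assms regular_iff by blast

lemma restr_regular:
  assumes "open_in_variety X U" "\<And>p. p \<in> U \<Longrightarrow> f \<in> germs X p"
  shows "restr U f \<in> regular X U"
  unfolding regular_iff[OF assms(1)]
proof safe
  fix p assume p: "p \<in> U"
  have "\<forall>\<^sub>F q in nbhd X p. f q = restr U f q"
    using eventually_nbhd_in[OF assms(1) p] by eventually_elim (auto simp: restr_def)
  then show "restr U f \<in> germs X p"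
    using germs_cong assms p open_in_variety_subset by blast
qed (auto simp: restr_def)

section \<open>Rules for tangent vectors\<close>

lemma tangent_add:
  "v \<in> tangent_space X p \<Longrightarrow> f \<in> germs X p \<Longrightarrow> g \<in> germs X p \<Longrightarrow> v (\<lambda>q. f q + g q) = v f + v g"
  by (auto simp: tangent_space_def)

lemma tangent_mult:
  "v \<in> tangent_space X p \<Longrightarrow> f \<in> germs X p \<Longrightarrow> g \<in> germs X p \<Longrightarrow>
     v (\<lambda>q. f q * g q) = f p * v g + g p * v f"
  by (auto simp: tangent_space_def)

lemma tangent_cmult:
  "v \<in> tangent_space X p \<Longrightarrow> f \<in> germs X p \<Longrightarrow> v (\<lambda>q. a * f q) = a * v f"
  by (auto simp: tangent_space_def)

lemma tangent_cong:
  assumes "v \<in> tangent_space X p" "f \<in> germs X p" "p \<in> X" "\<forall>\<^sub>F q in nbhd X p. f q = g q"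
  shows "v f = v g"
proof -
  have "g \<in> germs X p" using germs_cong assms by blast
  moreover have "\<exists>V. open_in_variety X V \<and> p \<in> V \<and> (\<forall>q\<in>V. f q = g q)"
    using assms(3,4) eventually_nbhd by blast
  ultimately show ?thesis using assms(1,2) unfolding tangent_space_def by blast
qed

lemma tangent_const:
  assumes "v \<in> tangent_space X p" "p \<in> X"
  shows "v (\<lambda>q. a) = 0"
proof -
  have 1: "(\<lambda>q. 1) \<in> germs X p" using germs_const assms(2) .
  have "v (\<lambda>q. 1) = 0" using tangent_mult[OF assms(1) 1 1] by simp
  then show ?thesis using tangent_cmult[OF assms(1) 1, of a] by simp
qed

lemma tangent_sum:
  assumes "v \<in> tangent_space X p" "p \<in> X" "\<And>i. i \<in> A \<Longrightarrow> f i \<in> germs X p"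
  shows "v (\<lambda>q. \<Sum>i\<in>A. f i q) = (\<Sum>i\<in>A. v (f i))"
  using assms(3)
  by (induction A rule: infinite_finite_induct)
     (auto simp: tangent_const[OF assms(1,2)] tangent_add[OF assms(1)] germs_sum assms(2))

section \<open>Differentials and local coordinates\<close>

abbreviation support :: "('i \<Rightarrow> 'n::finite proj set) \<Rightarrow> 'i set \<Rightarrow> 'n proj set" where
  "support D I \<equiv> \<Union>i\<in>I. D i"

section \<open>Forms spanned by given forms\<close>

abbreviation agree ::
  "'n::finite proj set \<Rightarrow> 'n proj \<Rightarrow> 'n proj set \<Rightarrow> 'n form \<Rightarrow> 'n form \<Rightarrow> bool" where
  "agree X p E \<omega> \<omega>' \<equiv>
     \<forall>\<^sub>F q in nbhd X p. q \<notin> E \<longrightarrow> (\<forall>v\<in>tangent_space X q. \<omega> q v = \<omega>' q v)"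

text \<open>Membership in the module generated by the \<open>\<theta> j\<close>. The coefficients
  are regular at \<open>p\<close> itself although the identity is only required off
  \<open>E\<close>. With \<open>E\<close> a divisor this fits forms with poles, with
  \<open>E = {}\<close> it speaks of honest differentials.\<close>

definition spanned ::
  "'n::finite proj set \<Rightarrow> 'n proj \<Rightarrow> 'n proj set \<Rightarrow> 'j set \<Rightarrow> ('j \<Rightarrow> 'n form) \<Rightarrow> 'n form \<Rightarrow> bool" where
  "spanned X p E K \<theta> \<omega> \<longleftrightarrow> (\<exists>b. (\<forall>j\<in>K. b j \<in> germs X p) \<and>
     (agree X p E \<omega> (\<lambda>q v. \<Sum>j\<in>K. b j q * \<theta> j q v)))"

lemma spannedI:
  assumes "\<And>j. j \<in> K \<Longrightarrow> b j \<in> germs X p"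
    and "agree X p E \<omega> (\<lambda>q v. \<Sum>j\<in>K. b j q * \<theta> j q v)"
  shows "spanned X p E K \<theta> \<omega>"
  using assms unfolding spanned_def by blast

lemma spannedE:
  assumes "spanned X p E K \<theta> \<omega>"
  obtains b where "\<And>j. j \<in> K \<Longrightarrow> b j \<in> germs X p"
    "agree X p E \<omega> (\<lambda>q v. \<Sum>j\<in>K. b j q * \<theta> j q v)"
  using assms unfolding spanned_def by blast

lemma spanned_cong:
  assumes "spanned X p E K \<theta> \<omega>"
    and "agree X p E \<omega>' \<omega>"
  shows "spanned X p E K \<theta> \<omega>'"
proof -
  obtain b where b: "\<And>j. j \<in> K \<Longrightarrow> b j \<in> germs X p"
    "agree X p E \<omega> (\<lambda>q v. \<Sum>j\<in>K. b j q * \<theta> j q v)"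
    using spannedE[OF assms(1)] by blast
  have "agree X p E \<omega>' (\<lambda>q v. \<Sum>j\<in>K. b j q * \<theta> j q v)"
    using b(2) assms(2) by eventually_elim auto
  with b show ?thesis by (intro spannedI)
qed

lemma spanned_zero:
  assumes "p \<in> X"
  shows "spanned X p E K \<theta> (\<lambda>q v. 0)"
  by (rule spannedI[of _ "\<lambda>_ _. 0"]) (auto simp: germs_const[OF assms])

lemma spanned_add:
  assumes "spanned X p E K \<theta> \<omega>" "spanned X p E K \<theta> \<omega>'" "p \<in> X"
  shows "spanned X p E K \<theta> (\<lambda>q v. \<omega> q v + \<omega>' q v)"
proof -
  obtain b where b: "\<And>j. j \<in> K \<Longrightarrow> b j \<in> germs X p"
    "agree X p E \<omega> (\<lambda>q v. \<Sum>j\<in>K. b j q * \<theta> j q v)"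
    using spannedE[OF assms(1)] by blast
  obtain b' where b': "\<And>j. j \<in> K \<Longrightarrow> b' j \<in> germs X p"
    "agree X p E \<omega>' (\<lambda>q v. \<Sum>j\<in>K. b' j q * \<theta> j q v)"
    using spannedE[OF assms(2)] by blast
  show ?thesis
  proof (rule spannedI[of _ "\<lambda>j q. b j q + b' j q"])
    show "agree X p E (\<lambda>q v. \<omega> q v + \<omega>' q v)
        (\<lambda>q v. \<Sum>j\<in>K. (b j q + b' j q) * \<theta> j q v)"
      using b(2) b'(2) by eventually_elim (auto simp: ring_distribs sum.distrib)
  qed (use b b' assms in \<open>auto intro: germs_add\<close>)
qed

lemma spanned_scale:
  assumes "spanned X p E K \<theta> \<omega>" "g \<in> germs X p" "p \<in> X"
  shows "spanned X p E K \<theta> (\<lambda>q v. g q * \<omega> q v)"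
proof -
  obtain b where b: "\<And>j. j \<in> K \<Longrightarrow> b j \<in> germs X p"
    "agree X p E \<omega> (\<lambda>q v. \<Sum>j\<in>K. b j q * \<theta> j q v)"
    using spannedE[OF assms(1)] by blast
  show ?thesis
  proof (rule spannedI[of _ "\<lambda>j q. g q * b j q"])
    show "agree X p E (\<lambda>q v. g q * \<omega> q v)
        (\<lambda>q v. \<Sum>j\<in>K. g q * b j q * \<theta> j q v)"
      using b(2) by eventually_elim (auto simp: sum_distrib_left mult.assoc)
  qed (use b assms in \<open>auto intro: germs_mult\<close>)
qed

lemma spanned_sum:
  assumes "\<And>i. i \<in> A \<Longrightarrow> spanned X p E K \<theta> (\<omega> i)" "p \<in> X"
  shows "spanned X p E K \<theta> (\<lambda>q v. \<Sum>i\<in>A. \<omega> i q v)"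
  using assms(1)
  by (induction A rule: infinite_finite_induct) (auto intro: spanned_add spanned_zero assms(2))

lemma spanned_generator:
  assumes "j \<in> K" "finite K" "p \<in> X"
  shows "spanned X p E K \<theta> (\<theta> j)"
proof (rule spannedI[of _ "\<lambda>i q. if i = j then 1 else 0"])
  have "(\<Sum>i\<in>K. (if i = j then 1 else 0) * \<theta> i q v) = \<theta> j q v" for q v
    by (subst sum.cong[OF refl, where h = "\<lambda>i. if i = j then \<theta> i q v else 0"])
       (use assms in auto)
  then show "agree X p E (\<lambda>q v. \<theta> j q v)
      (\<lambda>q v. \<Sum>i\<in>K. (if i = j then 1 else 0) * \<theta> i q v)" by simp
qed (use germs_const[OF assms(3)] in auto)

lemma spanned_trans:
  assumes "spanned X p E K \<theta> \<omega>" "\<And>j. j \<in> K \<Longrightarrow> spanned X p E K' \<theta>' (\<theta> j)" "p \<in> X"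
  shows "spanned X p E K' \<theta>' \<omega>"
proof -
  obtain b where b: "\<And>j. j \<in> K \<Longrightarrow> b j \<in> germs X p"
    "agree X p E \<omega> (\<lambda>q v. \<Sum>j\<in>K. b j q * \<theta> j q v)"
    using spannedE[OF assms(1)] by blast
  have "spanned X p E K' \<theta>' (\<lambda>q v. \<Sum>j\<in>K. b j q * \<theta> j q v)"
    using b assms by (intro spanned_sum spanned_scale) auto
  then show ?thesis by (rule spanned_cong) (rule b(2))
qed

text \<open>Finitely many coefficients stay regular on a common neighbourhood. So a spanning
  statement obtained at \<open>p\<close>, such as the outcome of Nakayama's lemma, spreads to nearby
  points.\<close>

lemma spanned_eventually:
  assumes "spanned X p E K \<theta> \<omega>" "finite K" "p \<in> X"
  shows "\<forall>\<^sub>F q in nbhd X p. spanned X q E K \<theta> \<omega>"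
proof -
  obtain b where b: "\<And>j. j \<in> K \<Longrightarrow> b j \<in> germs X p"
    "agree X p E \<omega> (\<lambda>q v. \<Sum>j\<in>K. b j q * \<theta> j q v)"
    using spannedE[OF assms(1)] by blast
  have "\<forall>\<^sub>F q in nbhd X p. \<forall>j\<in>K. b j \<in> germs X q"
    using b(1) assms by (intro eventually_ball_finite) (auto intro: germs_eventually)
  with eventually_eventually_nbhd[OF b(2) assms(3)] show ?thesis
    by eventually_elim (auto intro: spannedI)
qed

section \<open>Differentials of sums, products and inverses\<close>

lemma spanned_differential_cong:
  assumes "spanned X p E K \<theta> (\<lambda>q v. v f)" "f \<in> germs X p" "p \<in> X" "\<forall>\<^sub>F q in nbhd X p. f q = g q"
  shows "spanned X p E K \<theta> (\<lambda>q v. v g)"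
proof (rule spanned_cong[OF assms(1)])
  show "agree X p E (\<lambda>q v. v g) (\<lambda>q v. v f)"
    using eventually_eventually_nbhd[OF assms(4,3)] germs_eventually[OF assms(2,3)]
      eventually_nbhd_variety[OF assms(3)]
    by eventually_elim (metis tangent_cong)
qed

lemma spanned_differential_const:
  assumes "p \<in> X"
  shows "spanned X p E K \<theta> (\<lambda>q v. v (\<lambda>q. a))"
proof (rule spanned_cong[OF spanned_zero[OF assms]])
  show "agree X p E (\<lambda>q v. v (\<lambda>q. a)) (\<lambda>q v. 0)"
    using eventually_nbhd_variety[OF assms] by eventually_elim (auto intro: tangent_const)
qed

lemma spanned_differential_add:
  assumes "spanned X p E K \<theta> (\<lambda>q v. v f)" "spanned X p E K \<theta> (\<lambda>q v. v g)"
    "f \<in> germs X p" "g \<in> germs X p" "p \<in> X"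
  shows "spanned X p E K \<theta> (\<lambda>q v. v (\<lambda>q. f q + g q))"
proof (rule spanned_cong[OF spanned_add[OF assms(1,2,5)]])
  show "agree X p E (\<lambda>q v. v (\<lambda>q. f q + g q)) (\<lambda>q v. v f + v g)"
    using germs_eventually[OF assms(3,5)] germs_eventually[OF assms(4,5)]
    by eventually_elim (auto intro: tangent_add)
qed

lemma spanned_differential_mult:
  assumes "spanned X p E K \<theta> (\<lambda>q v. v f)" "spanned X p E K \<theta> (\<lambda>q v. v g)"
    "f \<in> germs X p" "g \<in> germs X p" "p \<in> X"
  shows "spanned X p E K \<theta> (\<lambda>q v. v (\<lambda>q. f q * g q))"
proof (rule spanned_cong[OF spanned_add[OF
        spanned_scale[OF assms(2,3,5)] spanned_scale[OF assms(1,4,5)] assms(5)]])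
  show "agree X p E (\<lambda>q v. v (\<lambda>q. f q * g q)) (\<lambda>q v. f q * v g + g q * v f)"
    using germs_eventually[OF assms(3,5)] germs_eventually[OF assms(4,5)]
    by eventually_elim (auto intro: tangent_mult)
qed

lemma tangent_inverse:
  assumes "v \<in> tangent_space X p" "f \<in> germs X p" "p \<in> X" "f p \<noteq> 0"
  shows "v (\<lambda>q. inverse (f q)) = - inverse (f p) * inverse (f p) * v f"
proof -
  have i: "(\<lambda>q. inverse (f q)) \<in> germs X p"
    using germs_inverse assms by blast
  have "\<forall>\<^sub>F q in nbhd X p. f q * inverse (f q) = 1"
    using germs_eventually_nonzero[OF assms(2-4)] by eventually_elim auto
  then have "v (\<lambda>q. f q * inverse (f q)) = v (\<lambda>q. 1)"
    by (rule tangent_cong[OF assms(1) germs_mult[OF assms(2) i assms(3)] assms(3)])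
  then have "f p * v (\<lambda>q. inverse (f q)) + inverse (f p) * v f = 0"
    using tangent_mult[OF assms(1,2) i] tangent_const[OF assms(1,3)] by simp
  then show ?thesis using assms(4)
    by (auto simp: field_simps add_eq_0_iff2)
qed

lemma spanned_differential_inverse:
  assumes "spanned X p E K \<theta> (\<lambda>q v. v f)" "f \<in> germs X p" "p \<in> X" "f p \<noteq> 0"
  shows "spanned X p E K \<theta> (\<lambda>q v. v (\<lambda>q. inverse (f q)))"
proof (rule spanned_cong[OF spanned_scale[OF assms(1)]])
  show "(\<lambda>q. - inverse (f q) * inverse (f q)) \<in> germs X p"
    using germs_mult[OF germs_uminus] germs_inverse assms by blast
  show "agree X p E (\<lambda>q v. v (\<lambda>q. inverse (f q)))
      (\<lambda>q v. - inverse (f q) * inverse (f q) * v f)"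
    using germs_eventually[OF assms(2,3)] germs_eventually_nonzero[OF assms(2-4)]
      eventually_nbhd_variety[OF assms(3)]
    by eventually_elim (blast intro: tangent_inverse)
qed (fact assms)

text \<open>The functions \<open>y i\<close> are the affine coordinates \<open>x $ i / x $ l\<close> on a chart \<open>x $ l \<noteq> 0\<close> around
  \<open>p\<close>; germs are rational functions of them.\<close>

lemma affine_coordinates:
  fixes X :: "'n::finite proj set"
  assumes "p \<in> X"
  obtains y :: "'n \<Rightarrow> 'n proj \<Rightarrow> complex" where "\<And>i. y i \<in> germs X p"
    "\<forall>\<^sub>F q in nbhd X p. \<forall>f\<in>germs X q. spanned X q {} UNIV (\<lambda>i r v. v (y i)) (\<lambda>r v. v f)"
proof -
  obtain x0 where x0: "x0 \<in> coords p" using coords_nonempty by blast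
  then have "x0 \<noteq> 0" by (auto simp: coords_def)
  then obtain l where l: "x0 $ l \<noteq> 0" by (auto simp: vec_eq_iff)
  \<comment> \<open>A total function is obtained from the representative whose \<open>l\<close>-th
    coordinate is 1; outside the chart its values are arbitrary.\<close>
  define y where "y i q = (SOME x. x \<in> coords q \<and> x $ l = 1) $ i" for i q
  have pl: "\<forall>x\<in>coords p. x $ l \<noteq> 0"
    using coords_proportional[OF x0] l by fastforce
  have y: "(\<chi> i. y i q) \<in> coords q \<and> (\<forall>x\<in>coords q. y i q = x $ i / x $ l)"
    if q: "\<forall>x\<in>coords q. x $ l \<noteq> 0" for q i
  proof -
    let ?s = "SOME x. x \<in> coords q \<and> x $ l = 1"
    obtain x where x: "x \<in> coords q" using coords_nonempty by blast
    have "inverse (x $ l) *s x \<in> coords q \<and> (inverse (x $ l) *s x) $ l = 1"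
      using x q by (auto intro: coords_scale)
    then have s: "?s \<in> coords q \<and> ?s $ l = 1" by (rule someI)
    have "?s $ i = x' $ i / x' $ l" if x': "x' \<in> coords q" for x'
    proof -
      obtain a where "?s = a *s x'" using coords_proportional[OF x'] s by blast
      then show ?thesis using s q x' by (simp add: field_simps)
    qed
    moreover have "(\<chi> i. y i q) = ?s" by (simp add: y_def vec_eq_iff)
    ultimately show ?thesis using s by (auto simp: y_def)
  qed
  have L: "\<forall>\<^sub>F q in nbhd X p. \<forall>x\<in>coords q. x $ l \<noteq> 0"
    by (rule eventually_nbhdI[OF openin_nonvanishing[OF homogeneous_poly_coordinate]])
       (use pl assms in auto)
  have yg: "y i \<in> germs X q" if "q \<in> X" "\<forall>\<^sub>F r in nbhd X q. \<forall>x\<in>coords r. x $ l \<noteq> 0" for i q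
  proof -
    have "\<forall>\<^sub>F r in nbhd X q. \<forall>x\<in>coords r. x $ l \<noteq> 0 \<and> y i r = x $ i / x $ l"
      using that(2) by eventually_elim (use y in blast)
    then show ?thesis
      using germs_iff[OF that(1)] homogeneous_poly_coordinate by blast
  qed
  have "spanned X q {} UNIV (\<lambda>i r v. v (y i)) (\<lambda>r v. v f)"
    if q: "q \<in> X" "\<forall>\<^sub>F r in nbhd X q. \<forall>x\<in>coords r. x $ l \<noteq> 0" and f: "f \<in> germs X q" for q f
  proof -
    note yg = yg[OF q]
    \<comment> \<open>These germs form a ring that contains the constants and the \<open>y i\<close>
      and the inverses of its elements with nonzero value at \<open>q\<close>. As germs are
      quotients of polynomials in the \<open>y i\<close>, all of them satisfy
      \<open>P\<close>.\<close>
    define P where "P h \<longleftrightarrow> h \<in> germs X q \<and> spanned X q {} UNIV (\<lambda>i r v. v (y i)) (\<lambda>r v. v h)" for h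
    have P_const: "P (\<lambda>r. a)" for a
      by (simp add: P_def germs_const spanned_differential_const q)
    have P_y: "P (y i)" for i
      using spanned_generator[of i UNIV q X "{}" "\<lambda>i r v. v (y i)"] q by (simp add: P_def yg)
    have P_add: "P (\<lambda>r. g r + h r)" if "P g" "P h" for g h
      using that by (simp add: P_def germs_add spanned_differential_add q)
    have P_mult: "P (\<lambda>r. g r * h r)" if "P g" "P h" for g h
      using that by (simp add: P_def germs_mult spanned_differential_mult q)
    have P_sum: "(\<And>i. i \<in> A \<Longrightarrow> P (h i)) \<Longrightarrow> P (\<lambda>r. \<Sum>i\<in>A. h i r)"
      for A :: "('n \<Rightarrow> nat) set" and h
      by (induction A rule: infinite_finite_induct) (auto intro: P_add P_const)
    have P_prod: "(\<And>i. i \<in> A \<Longrightarrow> P (h i)) \<Longrightarrow> P (\<lambda>r. \<Prod>i\<in>A. h i r)"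
      for A :: "'n set" and h
      by (induction A rule: infinite_finite_induct) (auto intro: P_mult P_const)
    have P_power: "P h \<Longrightarrow> P (\<lambda>r. h r ^ k)" for h k
      by (induction k) (auto intro: P_mult P_const)
    have P_poly: "P (\<lambda>r. F (\<chi> i. y i r))" if "homogeneous_poly d F" for d F
    proof -
      obtain a where "F = (\<lambda>x. \<Sum>e | sum e UNIV = d. a e * (\<Prod>i\<in>UNIV. (x $ i) ^ e i))"
        using \<open>homogeneous_poly d F\<close> unfolding homogeneous_poly_def by blast
      then show ?thesis by (auto intro!: P_sum P_mult P_const P_prod P_power P_y)
    qed
    obtain d F G where FG: "homogeneous_poly d F" "homogeneous_poly d G"
      "\<forall>\<^sub>F r in nbhd X q. \<forall>x\<in>coords r. G x \<noteq> 0 \<and> f r = F x / G x"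
      using germsE[OF f q(1)] .
    \<comment> \<open>The vector of the \<open>y i r\<close> is itself a coordinate vector of
      \<open>r\<close>, so \<open>F\<close> and \<open>G\<close> may be evaluated there: this
      dehomogenises the quotient.\<close>
    have eq: "\<forall>\<^sub>F r in nbhd X q. G (\<chi> i. y i r) \<noteq> 0 \<and>
        F (\<chi> i. y i r) * inverse (G (\<chi> i. y i r)) = f r"
      using FG(3) q(2)
    proof eventually_elim
      case (elim r)
      then have "(\<chi> i. y i r) \<in> coords r" using y by blast
      then show ?case using elim by (simp add: divide_inverse)
    qed
    have "G (\<chi> i. y i q) \<noteq> 0"
      using eventually_nbhd_self[OF eq q(1)] by simp
    then have "P (\<lambda>r. inverse (G (\<chi> i. y i r)))"
      using P_poly[OF FG(2)] by (simp add: P_def germs_inverse spanned_differential_inverse q)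
    then have "P (\<lambda>r. F (\<chi> i. y i r) * inverse (G (\<chi> i. y i r)))"
      by (intro P_mult P_poly[OF FG(1)])
    moreover have "\<forall>\<^sub>F r in nbhd X q. F (\<chi> i. y i r) * inverse (G (\<chi> i. y i r)) = f r"
      using eq by eventually_elim simp
    ultimately show ?thesis
      using q(1) spanned_differential_cong unfolding P_def by blast
  qed
  then have "\<forall>\<^sub>F q in nbhd X p. \<forall>f\<in>germs X q. spanned X q {} UNIV (\<lambda>i r v. v (y i)) (\<lambda>r v. v f)"
    using eventually_eventually_nbhd[OF L assms] eventually_nbhd_variety[OF assms]
    by (auto elim: eventually_elim2)
  then show thesis using that yg[OF assms L] by blast
qed

text \<open>Nakayama's lemma for the differentials, by eliminating one \<open>dy i\<close> after the other:
  \<open>M i k\<close> vanishes at \<open>p\<close>, so \<open>1 - M k k\<close> is invertible there.\<close>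

lemma affine_differentials_spanned:
  fixes y :: "'i::finite \<Rightarrow> 'n::finite proj \<Rightarrow> complex"
  assumes p: "p \<in> X" and z: "generate_maximal_ideal X p n z" and y: "\<And>i. y i \<in> germs X p"
    and sp: "\<And>f. f \<in> germs X p \<Longrightarrow> spanned X p {} UNIV (\<lambda>i r v. v (y i)) (\<lambda>r v. v f)"
  shows "spanned X p {} {..<n} (\<lambda>j r v. v (z j)) (\<lambda>r v. v (y i))"
proof -
  have zg: "z j \<in> germs X p" "z j p = 0" if "j < n" for j
    using z that by (auto simp: generate_maximal_ideal_def)
  \<comment> \<open>An expression of dy_i through the dz_j with an error in the dy_k,
    \<open>k \<in> K\<close>, whose coefficients vanish at \<open>p\<close>. In the course of the
    proof \<open>K\<close> shrinks from all indices to none.\<close>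
  define Q where "Q K i c M \<longleftrightarrow> (\<forall>j<n. c j \<in> germs X p) \<and>
      (\<forall>k\<in>K. M k \<in> germs X p \<and> M k p = 0) \<and>
      (\<forall>\<^sub>F q in nbhd X p. \<forall>v\<in>tangent_space X q.
         v (y i) = (\<Sum>j<n. c j q * v (z j)) + (\<Sum>k\<in>K. M k q * v (y k)))" for K i c M
  define P where "P K \<longleftrightarrow> (\<forall>i. \<exists>c M. Q K i c M)" for K
  have "P UNIV"
    unfolding P_def
  proof
    fix i
    have "(\<lambda>q. y i q - y i p) \<in> germs X p" by (rule germs_diff[OF y germs_const[OF p] p])
    moreover have "\<forall>f\<in>germs X p. f p = 0 \<longrightarrow> (\<exists>a V. (\<forall>j<n. a j \<in> germs X p) \<and>
        open_in_variety X V \<and> p \<in> V \<and> (\<forall>q\<in>V. f q = (\<Sum>j<n. a j q * z j q)))"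
      using z unfolding generate_maximal_ideal_def by blast
    ultimately have "y i p - y i p = 0 \<longrightarrow> (\<exists>a V. (\<forall>j<n. a j \<in> germs X p) \<and>
        open_in_variety X V \<and> p \<in> V \<and> (\<forall>q\<in>V. y i q - y i p = (\<Sum>j<n. a j q * z j q)))"
      by (rule bspec[rotated])
    then obtain a V where aV: "\<And>j. j < n \<Longrightarrow> a j \<in> germs X p" "open_in_variety X V" "p \<in> V"
      "\<And>q. q \<in> V \<Longrightarrow> y i q - y i p = (\<Sum>j<n. a j q * z j q)"
      unfolding diff_self by blast
    have "\<forall>j\<in>{..<n}. \<exists>b. (\<forall>k. b k \<in> germs X p) \<and> (\<forall>\<^sub>F q in nbhd X p. \<forall>v\<in>tangent_space X q.
        v (a j) = (\<Sum>k\<in>UNIV. b k q * v (y k)))"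
      using sp[OF aV(1)] by (simp add: spanned_def)
    from bchoice[OF this] obtain b where b: "\<And>j k. j < n \<Longrightarrow> b j k \<in> germs X p"
      "\<And>j. j < n \<Longrightarrow> \<forall>\<^sub>F q in nbhd X p. \<forall>v\<in>tangent_space X q.
        v (a j) = (\<Sum>k\<in>UNIV. b j k q * v (y k))"
      by auto
    \<comment> \<open>Since y_i - y_i(p) is the sum of the a_j z_j, Leibniz' rule expresses dy_i
      through the a_j dz_j and the z_j da_j, and each da_j is again a combination of the dy_k. The
      factors z_j make the coefficients \<open>M k\<close> of the error vanish at
      \<open>p\<close>.\<close>
    define M where "M k = (\<lambda>q. \<Sum>j<n. z j q * b j k q)" for k
    have eq: "\<forall>\<^sub>F q in nbhd X p. (\<Sum>j<n. a j q * z j q) + y i p = y i q"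
      by (rule eventually_nbhdI[OF aV(2,3)]) (simp add: aV(4)[symmetric])
    have "\<forall>\<^sub>F q in nbhd X p. \<forall>j\<in>{..<n}. a j \<in> germs X q \<and> z j \<in> germs X q \<and>
        (\<forall>v\<in>tangent_space X q. v (a j) = (\<Sum>k\<in>UNIV. b j k q * v (y k)))"
      by (intro eventually_ball_finite ballI eventually_conj germs_eventually aV(1) b(2) zg(1) p) simp_all
    then have "\<forall>\<^sub>F q in nbhd X p. \<forall>v\<in>tangent_space X q.
        v (y i) = (\<Sum>j<n. a j q * v (z j)) + (\<Sum>k\<in>UNIV. M k q * v (y k))"
      using eventually_eventually_nbhd[OF eq p] eventually_nbhd_variety[OF p]
    proof eventually_elim
      case (elim q)
      show ?case
      proof
        fix v assume v: "v \<in> tangent_space X q"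
        have g: "(\<lambda>q. a j q * z j q) \<in> germs X q" if "j < n" for j
          using elim that by (auto intro: germs_mult)
        have "v (y i) = v (\<lambda>q. (\<Sum>j<n. a j q * z j q) + y i p)"
          by (rule tangent_cong[symmetric, OF v _ elim(3,2)])
             (use g elim in \<open>auto intro!: germs_add germs_sum germs_const\<close>)
        also have "\<dots> = (\<Sum>j<n. v (\<lambda>q. a j q * z j q))"
        proof -
          have s: "(\<lambda>q. \<Sum>j<n. a j q * z j q) \<in> germs X q"
            using g elim(3) by (intro germs_sum) auto
          show ?thesis
            unfolding tangent_add[OF v s germs_const[OF elim(3)]]
              tangent_const[OF v elim(3)] add_0_right
            using g by (intro tangent_sum[OF v elim(3)]) auto
        qed
        also have "\<dots> = (\<Sum>j<n. a j q * v (z j) + z j q * v (a j))"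
          using elim by (intro sum.cong tangent_mult[OF v]) auto
        also have "\<dots> = (\<Sum>j<n. a j q * v (z j)) + (\<Sum>j<n. \<Sum>k\<in>UNIV. z j q * b j k q * v (y k))"
        proof -
          have "v (a j) = (\<Sum>k\<in>UNIV. b j k q * v (y k))" if "j < n" for j
            using elim(1) v that by blast
          then have "(\<Sum>j<n. z j q * v (a j)) = (\<Sum>j<n. \<Sum>k\<in>UNIV. z j q * b j k q * v (y k))"
            by (intro sum.cong) (simp_all add: sum_distrib_left mult.assoc)
          then show ?thesis by (simp add: sum.distrib)
        qed
        also have "(\<Sum>j<n. \<Sum>k\<in>UNIV. z j q * b j k q * v (y k)) = (\<Sum>k\<in>UNIV. M k q * v (y k))"
          unfolding M_def sum_distrib_right by (rule sum.swap)
        finally show "v (y i) = (\<Sum>j<n. a j q * v (z j)) + (\<Sum>k\<in>UNIV. M k q * v (y k))" .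
      qed
    qed
    moreover have "M k \<in> germs X p \<and> M k p = 0" for k
      unfolding M_def using zg b(1) p by (auto intro!: germs_sum germs_mult sum.neutral)
    ultimately have "Q UNIV i a M"
      using aV(1) unfolding Q_def by blast
    then show "\<exists>c M. Q UNIV i c M" by blast
  qed
  have step: "P K" if K: "P (insert k0 K)" "finite K" "k0 \<notin> K" for K k0
    unfolding P_def
  proof
    fix i
    obtain c0 M0 where Q0: "Q (insert k0 K) k0 c0 M0" using K(1) unfolding P_def by blast
    have 0: "\<And>j. j < n \<Longrightarrow> c0 j \<in> germs X p" "\<And>k. k \<in> insert k0 K \<Longrightarrow> M0 k \<in> germs X p"
      "\<And>k. k \<in> insert k0 K \<Longrightarrow> M0 k p = 0"
      "\<forall>\<^sub>F q in nbhd X p. \<forall>v\<in>tangent_space X q.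
         v (y k0) = (\<Sum>j<n. c0 j q * v (z j)) + (\<Sum>k\<in>insert k0 K. M0 k q * v (y k))"
      using Q0 unfolding Q_def by blast+
    obtain c M where Q1: "Q (insert k0 K) i c M" using K(1) unfolding P_def by blast
    have 1: "\<And>j. j < n \<Longrightarrow> c j \<in> germs X p" "\<And>k. k \<in> insert k0 K \<Longrightarrow> M k \<in> germs X p"
      "\<And>k. k \<in> insert k0 K \<Longrightarrow> M k p = 0"
      "\<forall>\<^sub>F q in nbhd X p. \<forall>v\<in>tangent_space X q.
         v (y i) = (\<Sum>j<n. c j q * v (z j)) + (\<Sum>k\<in>insert k0 K. M k q * v (y k))"
      using Q1 unfolding Q_def by blast+
    define w where "w = (\<lambda>q. 1 - M0 k0 q)"
    have w: "w \<in> germs X p" "w p \<noteq> 0"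
      using 0 p by (auto simp: w_def intro!: germs_diff germs_const)
    \<comment> \<open>The factor with which the solved equation for \<open>y k0\<close> enters that
      for \<open>y i\<close>. It vanishes at \<open>p\<close> because \<open>M k0\<close> does, so
      the new error coefficients vanish there again.\<close>
    define h where "h = (\<lambda>q. M k0 q * inverse (w q))"
    have h: "h \<in> germs X p" "h p = 0"
      using w 1 p by (auto simp: h_def intro!: germs_mult germs_inverse)
    have "\<forall>\<^sub>F q in nbhd X p. \<forall>v\<in>tangent_space X q.
        v (y i) = (\<Sum>j<n. (c j q + h q * c0 j q) * v (z j)) + (\<Sum>k\<in>K. (M k q + h q * M0 k q) * v (y k))"
      using 0(4) 1(4) germs_eventually_nonzero[OF w(1) p w(2)]
    proof eventually_elim
      case (elim q)
      show ?case
      proof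
        fix v assume v: "v \<in> tangent_space X q"
        let ?A = "(\<Sum>j<n. c0 j q * v (z j)) + (\<Sum>k\<in>K. M0 k q * v (y k))"
        have "v (y k0) = (\<Sum>j<n. c0 j q * v (z j)) + (\<Sum>k\<in>insert k0 K. M0 k q * v (y k))"
          using elim(1) v by blast
        then have "w q * v (y k0) = ?A"
          using K by (simp add: w_def algebra_simps)
        then have "v (y k0) = inverse (w q) * ?A" using elim(3) by (simp add: field_simps)
        then have *: "M k0 q * v (y k0) = h q * ?A"
          by (simp add: h_def mult.assoc)
        have "v (y i) = (\<Sum>j<n. c j q * v (z j)) + (\<Sum>k\<in>insert k0 K. M k q * v (y k))"
          using elim(2) v by blast
        also have "\<dots> = (\<Sum>j<n. c j q * v (z j)) + (\<Sum>k\<in>K. M k q * v (y k)) + h q * ?A"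
          using K * by simp
        also have "\<dots> = (\<Sum>j<n. (c j q + h q * c0 j q) * v (z j)) + (\<Sum>k\<in>K. (M k q + h q * M0 k q) * v (y k))"
          by (simp add: ring_distribs sum.distrib sum_distrib_left mult.assoc)
        finally show "v (y i) = \<dots>" .
      qed
    qed
    moreover have "(\<lambda>q. c j q + h q * c0 j q) \<in> germs X p" if "j < n" for j
      using 0(1) 1(1) h(1) p that by (intro germs_add germs_mult) auto
    moreover have "(\<lambda>q. M k q + h q * M0 k q) \<in> germs X p" if "k \<in> K" for k
      using 0(2) 1(2) h(1) p that by (intro germs_add germs_mult) auto
    ultimately have "Q K i (\<lambda>j q. c j q + h q * c0 j q) (\<lambda>k q. M k q + h q * M0 k q)"
      using 1(3) h(2) by (simp add: Q_def)
    then show "\<exists>c M. Q K i c M" by blast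
  qed
  have "P (UNIV - S)" if "finite S" for S
    using that
  proof (induction S rule: finite_induct)
    case (insert k S)
    have "UNIV - S = insert k (UNIV - insert k S)" using insert by auto
    moreover have "k \<notin> UNIV - insert k S" by simp
    ultimately show ?case using insert.IH step[of k "UNIV - insert k S"] by simp
  qed (use \<open>P UNIV\<close> in simp)
  from this[of UNIV] have "P {}" by simp
  then obtain c M where "Q {} i c M" unfolding P_def by blast
  then show ?thesis unfolding Q_def by (intro spannedI[of _ c]) simp_all
qed

text \<open>The elimination takes place at \<open>p\<close> alone, but its result for the finitely
  many \<open>y i\<close> spreads to a neighbourhood. At a nearby \<open>q\<close> the dy_i span the
  differentials of all germs at \<open>q\<close>, also of those that are not regular at
  \<open>p\<close>; hence so do the dz_j.\<close>

lemma coordinate_differentials_spanned: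
  fixes X :: "'n::finite proj set"
  assumes p: "p \<in> X" and z: "generate_maximal_ideal X p n z"
  shows "\<forall>\<^sub>F q in nbhd X p. \<forall>f\<in>germs X q. spanned X q {} {..<n} (\<lambda>j r v. v (z j)) (\<lambda>r v. v f)"
proof -
  obtain y :: "'n \<Rightarrow> 'n proj \<Rightarrow> complex" where y: "\<And>i. y i \<in> germs X p"
    "\<forall>\<^sub>F q in nbhd X p. \<forall>f\<in>germs X q. spanned X q {} UNIV (\<lambda>i r v. v (y i)) (\<lambda>r v. v f)"
    using affine_coordinates[OF p] by blast
  have "spanned X p {} UNIV (\<lambda>i r v. v (y i)) (\<lambda>r v. v f)" if "f \<in> germs X p" for f
    using eventually_nbhd_self[OF y(2) p] that by (rule bspec)
  then have "spanned X p {} {..<n} (\<lambda>j r v. v (z j)) (\<lambda>r v. v (y i))" for i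
    by (rule affine_differentials_spanned[OF p z y(1)])
  then have "\<forall>\<^sub>F q in nbhd X p. \<forall>i\<in>UNIV. spanned X q {} {..<n} (\<lambda>j r v. v (z j)) (\<lambda>r v. v (y i))"
    by (intro eventually_ball_finite ballI spanned_eventually p) simp_all
  with y(2) eventually_nbhd_variety[OF p] show ?thesis
  proof eventually_elim
    case (elim q)
    show ?case
    proof
      fix f assume "f \<in> germs X q"
      with elim(1) have "spanned X q {} UNIV (\<lambda>i r v. v (y i)) (\<lambda>r v. v f)" by (rule bspec)
      then show "spanned X q {} {..<n} (\<lambda>j r v. v (z j)) (\<lambda>r v. v f)"
        by (rule spanned_trans) (use elim in simp_all)
    qed
  qed
qed

section \<open>Tangent vectors with prescribed coordinates\<close>

lemma sum_fun_apply: "(\<Sum>i\<in>A. f i) x = (\<Sum>i\<in>A. f i x)"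
  by (induction A rule: infinite_finite_induct) auto

text \<open>An injective linear map between spaces of the same finite dimension is onto.
  \<open>W\<close> will be a tangent space, which sits in the space of all functions on functions,
  and the map evaluates at \<open>z 0, ..., z (n - 1)\<close>.\<close>

lemma evaluation_surjective:
  fixes W :: "('b \<Rightarrow> complex) set"
  defines "s \<equiv> \<lambda>(c :: complex) v (f :: 'b). c * v f"
  assumes sub: "module.subspace s W" and dim: "vector_space.dim s W = n"
    and inj: "\<And>v. v \<in> W \<Longrightarrow> \<forall>j<n. v (z j) = 0 \<Longrightarrow> v = 0"
  shows "\<exists>v\<in>W. \<forall>j<n. v (z j) = T j"
proof -
  define t where "t = (\<lambda>(c :: complex) v (j :: nat). c * v j)"
  interpret A: vector_space s
    by unfold_locales (auto simp: s_def algebra_simps)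
  interpret B: vector_space t
    by unfold_locales (auto simp: t_def algebra_simps)
  interpret AB: vector_space_pair s t ..
  define \<phi> where "\<phi> v = (\<lambda>j. if j < n then v (z j) else 0)" for v :: "'b \<Rightarrow> complex"
  have lin: "Vector_Spaces.linear s t \<phi>"
    by unfold_locales (auto simp: s_def t_def \<phi>_def algebra_simps)
  show ?thesis
  \<comment> \<open>\<open>dim\<close> is 0 also for spaces without a finite basis. For
    \<open>n = 0\<close> only some element of \<open>W\<close> is asked for; for nonzero
    \<open>n\<close> the dimension guarantees a finite basis.\<close>
  proof (cases "n = 0")
    case True
    then show ?thesis using A.subspace_0[OF sub] by blast
  next
    case False
    obtain B where B: "B \<subseteq> W" "A.independent B" "W \<subseteq> A.span B" "card B = n"
      using A.basis_exists[of W] dim by metis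
    have fin: "finite B" using B(4) False card.infinite by force
    have WB: "A.span B = W" using B(1,3) A.span_minimal[OF _ sub] by blast
    have inj: "inj_on \<phi> W"
    proof (rule inj_onI)
      fix u v assume uv: "u \<in> W" "v \<in> W" "\<phi> u = \<phi> v"
      have "u - v = 0"
      proof (rule inj)
        show "u - v \<in> W" using uv A.subspace_diff[OF sub] by blast
        show "\<forall>j<n. (u - v) (z j) = 0" using uv(3) by (auto simp: \<phi>_def fun_eq_iff split: if_splits)
      qed
      then show "u = v" by simp
    qed
    have ind: "B.independent (\<phi> ` B)"
      by (rule AB.linear_independent_injective_image[OF lin B(2)]) (use inj WB in simp)
    have card: "card (\<phi> ` B) = n"
      using B(1,4) inj by (metis card_image inj_on_subset)
    define U where "U = (\<lambda>i j. if j = i then 1 else (0::complex)) ` {..<n}"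
    have U: "v \<in> B.span U" if "\<And>j. j \<ge> n \<Longrightarrow> v j = 0" for v
    proof -
      have "v j = (\<Sum>i<n. t (v i) (\<lambda>j. if j = i then 1 else 0)) j" for j
        using that[of j] by (cases "j < n") (simp_all add: t_def sum_fun_apply if_distrib cong: if_cong)
      then have eq: "v = (\<Sum>i<n. t (v i) (\<lambda>j. if j = i then 1 else 0))" by (rule ext)
      have "(\<Sum>i<n. t (v i) (\<lambda>j. if j = i then 1 else 0)) \<in> B.span U"
        by (intro B.span_sum B.span_scale B.span_base) (auto simp: U_def)
      then show ?thesis unfolding eq[symmetric] .
    qed
    have "card U \<le> n" "finite U"
      unfolding U_def using card_image_le[of "{..<n}"] by auto
    define T' where "T' = (\<lambda>j. if j < n then T j else 0)"
    have "T' \<in> B.span (\<phi> ` B)"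
    \<comment> \<open>Otherwise \<open>T'\<close> and the images of the basis would be n + 1
      independent vectors in the span of at most n unit vectors.\<close>
    proof (rule ccontr)
      assume T': "T' \<notin> B.span (\<phi> ` B)"
      then have "B.independent (insert T' (\<phi> ` B))"
        using ind by (rule B.independent_insertI)
      moreover have "insert T' (\<phi> ` B) \<subseteq> B.span U"
        by (auto intro!: U simp: T'_def \<phi>_def)
      ultimately have "card (insert T' (\<phi> ` B)) \<le> card U"
        using B.independent_span_bound[OF \<open>finite U\<close>] by blast
      moreover have "T' \<notin> \<phi> ` B" using T' B.span_base by blast
      ultimately show False using card fin \<open>card U \<le> n\<close> by simp
    qed
    then have "T' \<in> \<phi> ` W"
      using AB.linear_span_image[OF lin, of B] WB by simp
    then obtain v where "v \<in> W" "T' = \<phi> v" by blast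
    then show ?thesis by (intro bexI[of _ v]) (auto simp: T'_def \<phi>_def fun_eq_iff split: if_splits)
  qed
qed

lemma tangent_spaceI:
  assumes "\<And>f. f \<notin> germs X p \<Longrightarrow> v f = 0"
    and "\<And>f g. f \<in> germs X p \<Longrightarrow> g \<in> germs X p \<Longrightarrow> v (\<lambda>q. f q + g q) = v f + v g"
    and "\<And>f g. f \<in> germs X p \<Longrightarrow> g \<in> germs X p \<Longrightarrow> v (\<lambda>q. f q * g q) = f p * v g + g p * v f"
    and "\<And>f g V. f \<in> germs X p \<Longrightarrow> g \<in> germs X p \<Longrightarrow> open_in_variety X V \<Longrightarrow> p \<in> V \<Longrightarrow>
      \<forall>q\<in>V. f q = g q \<Longrightarrow> v f = v g"
    and "\<And>a f. f \<in> germs X p \<Longrightarrow> v (\<lambda>q. a * f q) = a * v f"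
  shows "v \<in> tangent_space X p"
proof -
  have "\<forall>f. f \<notin> germs X p \<longrightarrow> v f = 0" using assms(1) by simp
  moreover have "\<forall>a. \<forall>f\<in>germs X p. v (\<lambda>q. a * f q) = a * v f" using assms(5) by simp
  moreover have "v (\<lambda>q. f q + g q) = v f + v g \<and> v (\<lambda>q. f q * g q) = f p * v g + g p * v f \<and>
      ((\<exists>V. open_in_variety X V \<and> p \<in> V \<and> (\<forall>q\<in>V. f q = g q)) \<longrightarrow> v f = v g)"
    if fg: "f \<in> germs X p" "g \<in> germs X p" for f g
    using assms(2-4)[OF fg] by auto
  ultimately show ?thesis unfolding tangent_space_def by simp
qed

lemma subspace_tangent_space:
  "module.subspace (\<lambda>(c :: complex) v f. c * v f) (tangent_space X p)"
proof -
  interpret vector_space "\<lambda>(c :: complex) v (f :: 'a proj \<Rightarrow> complex). c * v f"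
    by unfold_locales (auto simp: algebra_simps)
  have out: "v f = 0" if "v \<in> tangent_space X p" "f \<notin> germs X p" for v f
    using that unfolding tangent_space_def by blast
  have X: "p \<in> X" if "open_in_variety X V" "p \<in> V" for V
    using that open_in_variety_subset by blast
  have loc: "v f = v g"
    if "v \<in> tangent_space X p" "f \<in> germs X p" "open_in_variety X V" "p \<in> V" "\<forall>q\<in>V. f q = g q" for v f g V
    by (rule tangent_cong[OF that(1,2) X[OF that(3,4)] eventually_nbhdI[OF that(3,4)]])
       (use that(5) in blast)
  show ?thesis
    unfolding subspace_def
  proof (intro conjI ballI allI)
    show "0 \<in> tangent_space X p" by (rule tangent_spaceI) auto
    fix u v assume u: "u \<in> tangent_space X p" and v: "v \<in> tangent_space X p"
    show "u + v \<in> tangent_space X p"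
    proof (rule tangent_spaceI)
      fix f g V assume *: "f \<in> germs X p" "g \<in> germs X p" "open_in_variety X V" "p \<in> V" "\<forall>q\<in>V. f q = g q"
      show "(u + v) f = (u + v) g"
        using loc[OF u *(1,3-5)] loc[OF v *(1,3-5)] by simp
    qed (simp_all add: tangent_mult[OF u] tangent_mult[OF v] tangent_add[OF u] tangent_add[OF v]
        tangent_cmult[OF u] tangent_cmult[OF v] out[OF u] out[OF v] algebra_simps)
  next
    fix c v assume v: "v \<in> tangent_space X p"
    show "(\<lambda>f. c * v f) \<in> tangent_space X p"
    proof (rule tangent_spaceI)
      fix f g V assume *: "f \<in> germs X p" "g \<in> germs X p" "open_in_variety X V" "p \<in> V" "\<forall>q\<in>V. f q = g q"
      show "c * v f = c * v g"
        using loc[OF v *(1,3-5)] by simp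
    qed (simp_all add: tangent_mult[OF v] tangent_add[OF v] tangent_cmult[OF v] out[OF v] algebra_simps)
  qed
qed

text \<open>As the dz_j span, a derivation that kills all \<open>z j\<close> kills every germ at
  \<open>p\<close>, and on other functions it is 0 by the normalisation in
  \<open>tangent_space\<close>. So evaluation at the \<open>z j\<close> is injective, and smoothness
  supplies the dimension n that makes it onto.\<close>

lemma tangent_vector_exists:
  assumes "smooth X" "p \<in> X" "krull_dim X = enat n"
    and sp: "\<And>f. f \<in> germs X p \<Longrightarrow> spanned X p {} {..<n} (\<lambda>j r v. v (z j)) (\<lambda>r v. v f)"
  shows "\<exists>v\<in>tangent_space X p. \<forall>j<n. v (z j) = T j"
proof (rule evaluation_surjective[OF subspace_tangent_space])
  show "vector_space.dim (\<lambda>(c :: complex) v f. c * v f) (tangent_space X p) = n"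
  proof -
    have "enat (vector_space.dim (\<lambda>(c :: complex) v f. c * v f) (tangent_space X p)) = krull_dim X"
      using assms(1,2) unfolding smooth_def by blast
    then show ?thesis using assms(3) by simp
  qed
  fix v assume v: "v \<in> tangent_space X p" "\<forall>j<n. v (z j) = 0"
  show "v = 0"
  proof
    fix f
    show "v f = 0 f"
    proof (cases "f \<in> germs X p")
      case True
      obtain b where "agree X p {} (\<lambda>q v. v f) (\<lambda>q v. \<Sum>j\<in>{..<n}. b j q * v (z j))"
        using spannedE[OF sp[OF True]] by blast
      from eventually_nbhd_self[OF this assms(2)] have "v f = (\<Sum>j\<in>{..<n}. b j p * v (z j))"
        using v(1) by blast
      then show ?thesis using v(2) by simp
    qed (use v in \<open>auto simp: tangent_space_def\<close>)
  qed
qed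

section \<open>Germs of logarithmic forms\<close>

definition equation_germ ::
  "'n::finite proj set \<Rightarrow> 'n proj set \<Rightarrow> 'n proj \<Rightarrow> ('n proj \<Rightarrow> complex) \<Rightarrow> bool" where
  "equation_germ X Y p \<sigma> \<longleftrightarrow> (\<exists>V. p \<in> V \<and> local_equation X Y V (restr V \<sigma>))"

lemma local_equation_restr:
  assumes "local_equation X Y V \<sigma>" "open_in_variety X W" "W \<subseteq> V"
  shows "local_equation X Y W (restr W \<sigma>)"
  unfolding local_equation_def
proof (intro conjI allI impI)
  have V: "open_in_variety X V" "\<sigma> \<in> regular X V" using assms by (auto simp: local_equation_def)
  then have "\<sigma> \<in> germs X q" if "q \<in> W" for q using regular_germs that assms(3) by blast
  then show "restr W \<sigma> \<in> regular X W" using restr_regular[OF assms(2)] by blast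
  fix W' f assume W': "open_in_variety X W'" "W' \<subseteq> W" "f \<in> regular X W'"
  then have "(\<forall>q\<in>W' \<inter> Y. f q = 0) \<longleftrightarrow> (\<exists>g\<in>regular X W'. \<forall>q\<in>W'. f q = \<sigma> q * g q)"
    using assms unfolding local_equation_def by blast
  also have "\<dots> \<longleftrightarrow> (\<exists>g\<in>regular X W'. \<forall>q\<in>W'. f q = restr W \<sigma> q * g q)"
    using W'(2) by (simp add: restr_def subset_iff)
  finally show "(\<forall>q\<in>W' \<inter> Y. f q = 0) \<longleftrightarrow> (\<exists>g\<in>regular X W'. \<forall>q\<in>W'. f q = restr W \<sigma> q * g q)" .
qed (fact assms)

lemma restr_restr: "W \<subseteq> V \<Longrightarrow> restr W (restr V f) = restr W f"
  by (auto simp: restr_def fun_eq_iff)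

lemma equation_germE:
  assumes "equation_germ X Y p \<sigma>"
  obtains V where "open_in_variety X V" "p \<in> V"
    "\<And>W. open_in_variety X W \<Longrightarrow> W \<subseteq> V \<Longrightarrow> local_equation X Y W (restr W \<sigma>)"
proof -
  obtain V where V: "p \<in> V" "local_equation X Y V (restr V \<sigma>)"
    using assms by (auto simp: equation_germ_def)
  then have "open_in_variety X V" by (simp add: local_equation_def)
  moreover have "local_equation X Y W (restr W \<sigma>)" if "open_in_variety X W" "W \<subseteq> V" for W
    using local_equation_restr[OF V(2) that] restr_restr[OF that(2), of \<sigma>] by simp
  ultimately show thesis using that V(1) by blast
qed

lemma local_equation_germ:
  assumes "local_equation X Y V \<sigma>" "p \<in> V"
  shows "equation_germ X Y p \<sigma>"
proof -
  have "restr V \<sigma> = \<sigma>"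
    using assms(1) by (auto simp: local_equation_def regular_def restr_def)
  then show ?thesis using assms by (auto simp: equation_germ_def)
qed

lemma equation_germ_variety: "equation_germ X Y p \<sigma> \<Longrightarrow> p \<in> X"
  using open_in_variety_subset by (blast elim: equation_germE)

lemma equation_germ_eventually:
  assumes "equation_germ X Y p \<sigma>"
  shows "\<forall>\<^sub>F q in nbhd X p. equation_germ X Y q \<sigma>"
proof -
  obtain V where V: "p \<in> V" "local_equation X Y V (restr V \<sigma>)"
    using assms by (auto simp: equation_germ_def)
  then have "open_in_variety X V" by (simp add: local_equation_def)
  then show ?thesis
    by (rule eventually_nbhdI) (use V in \<open>auto simp: equation_germ_def\<close>)
qed

lemma equation_germ_germs: "equation_germ X Y p \<sigma> \<Longrightarrow> \<sigma> \<in> germs X p"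
  by (auto simp: equation_germ_def local_equation_def stalk_def)

lemma equation_germ_divides:
  assumes eq: "equation_germ X Y p \<sigma>" and f: "f \<in> germs X p"
    and zero: "\<forall>\<^sub>F q in nbhd X p. q \<in> Y \<longrightarrow> f q = 0"
  obtains g where "g \<in> germs X p" "\<forall>\<^sub>F q in nbhd X p. f q = \<sigma> q * g q"
proof -
  obtain V where V: "open_in_variety X V" "p \<in> V"
    "\<And>W. open_in_variety X W \<Longrightarrow> W \<subseteq> V \<Longrightarrow> local_equation X Y W (restr W \<sigma>)"
    using equation_germE[OF eq] by metis
  have p: "p \<in> X" using eq by (rule equation_germ_variety)
  have "\<forall>\<^sub>F q in nbhd X p. q \<in> V \<and> f \<in> germs X q \<and> (q \<in> Y \<longrightarrow> f q = 0)"
    using eventually_nbhd_in[OF V(1,2)] germs_eventually[OF f p] zero by eventually_elim auto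
  then obtain W where W: "open_in_variety X W" "p \<in> W"
    "\<And>q. q \<in> W \<Longrightarrow> q \<in> V \<and> f \<in> germs X q \<and> (q \<in> Y \<longrightarrow> f q = 0)"
    by (rule eventually_nbhdE[OF _ p]) blast
  then have WV: "W \<subseteq> V" by blast
  have "restr W f \<in> regular X W" using W by (intro restr_regular) auto
  moreover have "\<forall>q\<in>W \<inter> Y. restr W f q = 0" using W by (auto simp: restr_def)
  ultimately obtain g where g: "g \<in> regular X W" "\<forall>q\<in>W. restr W f q = restr W \<sigma> q * g q"
    using V(3)[OF W(1) WV] W(1) unfolding local_equation_def by blast
  have "g \<in> germs X p" using regular_germs[OF g(1) W(1,2)] .
  moreover have "\<forall>\<^sub>F q in nbhd X p. f q = \<sigma> q * g q"
    by (rule eventually_nbhdI[OF W(1,2)]) (use g(2) in \<open>simp add: restr_def\<close>)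
  ultimately show thesis using that by blast
qed

lemma openin_variety_Diff:
  assumes "open_in_variety X V" "closedin zariski Y"
  shows "open_in_variety X (V - Y)"
proof -
  obtain T where "openin zariski T" "V = T \<inter> X" using assms(1) by (auto simp: openin_subtopology)
  moreover have "openin zariski (T - Y)" using \<open>openin zariski T\<close> assms(2) by (rule openin_diff)
  ultimately show ?thesis unfolding openin_subtopology by (intro exI[of _ "T - Y"]) auto
qed

text \<open>\<sigma> vanishes on \<open>Y\<close> because it is the multiple \<sigma> * 1 of itself.
  It has no zeros off \<open>Y\<close>: on \<open>V - Y\<close> the constant 1 vanishes vacuously at
  the points of \<open>Y\<close>, hence is a multiple of \<sigma>.\<close>

lemma equation_germ_zero_iff:
  assumes eq: "equation_germ X Y p \<sigma>" and Y: "closedin zariski Y"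
  shows "\<forall>\<^sub>F q in nbhd X p. \<sigma> q = 0 \<longleftrightarrow> q \<in> Y"
proof -
  obtain V where V: "open_in_variety X V" "p \<in> V"
    "\<And>W. open_in_variety X W \<Longrightarrow> W \<subseteq> V \<Longrightarrow> local_equation X Y W (restr W \<sigma>)"
    using equation_germE[OF eq] by metis
  have "\<forall>q\<in>V \<inter> Y. restr V \<sigma> q = 0"
  proof -
    have "restr V (\<lambda>q. 1) \<in> regular X V"
      using V(1) open_in_variety_subset by (intro restr_regular) (auto intro: germs_const)
    moreover have "\<forall>q\<in>V. restr V \<sigma> q = restr V \<sigma> q * restr V (\<lambda>q. 1) q"
      by (auto simp: restr_def)
    ultimately show ?thesis using V(3)[OF V(1) order_refl] V(1) unfolding local_equation_def by blast
  qed
  moreover have "restr V \<sigma> q \<noteq> 0" if "q \<in> V - Y" for q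
  proof -
    let ?W = "V - Y"
    have W: "open_in_variety X ?W" using openin_variety_Diff[OF V(1) Y] .
    have "restr ?W (\<lambda>q. 1) \<in> regular X ?W"
      using W open_in_variety_subset by (intro restr_regular) (auto intro: germs_const)
    moreover have "\<forall>q\<in>?W \<inter> Y. restr ?W (\<lambda>q. 1) q = (0 :: complex)" by blast
    ultimately obtain g where "\<forall>q\<in>?W. restr ?W (\<lambda>q. 1) q = restr V \<sigma> q * g q"
      using V(3)[OF V(1) order_refl] W unfolding local_equation_def by (metis Diff_subset)
    then show ?thesis using that by (force simp: restr_def)
  qed
  ultimately show ?thesis
    by (intro eventually_nbhdI[OF V(1,2)]) (auto simp: restr_def)
qed

text \<open>Away from \<open>Y\<close> the ideal sheaf is the whole structure sheaf. Admitting 1 as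
  an equation there gives \<open>D c\<close> an equation at every point of the variety, so that
  points on and off \<open>D c\<close> fall under the same definitions.\<close>

lemma equation_germ_unit:
  assumes "open_in_variety X U" "p \<in> U" "U \<inter> Y = {}"
  shows "equation_germ X Y p (\<lambda>q. 1)"
  unfolding equation_germ_def local_equation_def
proof (intro exI[of _ U] conjI allI impI)
  show "restr U (\<lambda>q. 1) \<in> regular X U"
    using assms(1) open_in_variety_subset by (intro restr_regular) (auto intro: germs_const)
  fix W f assume W: "open_in_variety X W" "W \<subseteq> U" "f \<in> regular X W"
  then have "\<exists>g\<in>regular X W. \<forall>q\<in>W. f q = restr U (\<lambda>q. 1) q * g q"
    by (intro bexI[of _ f]) (auto simp: restr_def)
  then show "(\<forall>q\<in>W \<inter> Y. f q = 0) \<longleftrightarrow> (\<exists>g\<in>regular X W. \<forall>q\<in>W. f q = restr U (\<lambda>q. 1) q * g q)"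
    using W(2) assms(3) by blast
qed (use assms in auto)

section \<open>Stalks of the sheaves of logarithmic forms\<close>

definition log_generator_germs ::
  "'n::finite proj set \<Rightarrow> 'i set \<Rightarrow> ('i \<Rightarrow> 'n proj set) \<Rightarrow> 'n proj \<Rightarrow> 'n form set" where
  "log_generator_germs X I D p =
     {\<lambda>q v. v f | f. f \<in> germs X p} \<union>
     {\<lambda>q v. v \<sigma> / \<sigma> q | \<sigma> i. i \<in> I \<and> equation_germ X (D i) p \<sigma>}"

lemma log_generator_germs_differential: "f \<in> germs X p \<Longrightarrow> (\<lambda>q v. v f) \<in> log_generator_germs X I D p"
  by (auto simp: log_generator_germs_def)

lemma log_generator_germs_dlog:
  "i \<in> I \<Longrightarrow> equation_germ X (D i) p \<sigma> \<Longrightarrow> (\<lambda>q v. v \<sigma> / \<sigma> q) \<in> log_generator_germs X I D p"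
  by (auto simp: log_generator_germs_def)

lemma log_generator_germs_mono:
  "I' \<subseteq> I \<Longrightarrow> log_generator_germs X I' D p \<subseteq> log_generator_germs X I D p"
  by (auto simp: log_generator_germs_def)

lemma log_generator_germs_eventually:
  assumes "\<theta> \<in> log_generator_germs X I D p" "p \<in> X"
  shows "\<forall>\<^sub>F q in nbhd X p. \<theta> \<in> log_generator_germs X I D q"
  using assms(1) unfolding log_generator_germs_def
proof (elim UnE CollectE exE conjE)
  fix f assume "\<theta> = (\<lambda>q v. v f)" "f \<in> germs X p"
  with germs_eventually[OF this(2) assms(2)]
  show "\<forall>\<^sub>F q in nbhd X p. \<theta> \<in> {\<lambda>q v. v f |f. f \<in> germs X q} \<union>
      {\<lambda>q v. v \<sigma> / \<sigma> q |\<sigma> i. i \<in> I \<and> equation_germ X (D i) q \<sigma>}"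
    by (auto elim: eventually_mono)
next
  fix \<sigma> i assume *: "\<theta> = (\<lambda>q v. v \<sigma> / \<sigma> q)" "i \<in> I" "equation_germ X (D i) p \<sigma>"
  show "\<forall>\<^sub>F q in nbhd X p. \<theta> \<in> {\<lambda>q v. v f |f. f \<in> germs X q} \<union>
      {\<lambda>q v. v \<sigma> / \<sigma> q |\<sigma> i. i \<in> I \<and> equation_germ X (D i) q \<sigma>}"
    using equation_germ_eventually[OF *(3)] by eventually_elim (use * in blast)
qed

lemma log_generators_germs:
  assumes "\<theta> \<in> log_generators X I D V" "open_in_variety X V" "p \<in> V"
  shows "\<theta> \<in> log_generator_germs X I D p"
  using assms regular_germs local_equation_germ
  unfolding log_generators_def log_generator_germs_def by blast

text \<open>Representability over every open \<open>V\<close> inside \<open>U\<close>, and not just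
  over one set, is what lets finitely many generators be represented over a common neighbourhood.
  Cutting a function to 0 outside \<open>V\<close> keeps its differential at the points of
  \<open>V\<close>, since tangent vectors depend on germs only.\<close>

lemma log_generator_germs_represented:
  assumes "\<theta> \<in> log_generator_germs X I D p" "p \<in> X"
  obtains U where "open_in_variety X U" "p \<in> U"
    "\<And>V. open_in_variety X V \<Longrightarrow> V \<subseteq> U \<Longrightarrow>
       \<exists>\<theta>'\<in>log_generators X I D V. \<forall>q\<in>V. \<forall>v\<in>tangent_space X q. \<theta>' q v = \<theta> q v"
proof -
  have cong: "v (restr V f) = v f"
    if "open_in_variety X V" "q \<in> V" "f \<in> germs X q" "v \<in> tangent_space X q" for V q f v
  proof (rule tangent_cong[symmetric, OF that(4,3)])
    show "q \<in> X" using that open_in_variety_subset by blast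
    show "\<forall>\<^sub>F r in nbhd X q. f r = restr V f r"
      by (rule eventually_nbhdI[OF that(1,2)]) (simp add: restr_def)
  qed
  from assms(1) consider (d) f where "\<theta> = (\<lambda>q v. v f)" "f \<in> germs X p"
    | (l) \<sigma> i where "\<theta> = (\<lambda>q v. v \<sigma> / \<sigma> q)" "i \<in> I" "equation_germ X (D i) p \<sigma>"
    unfolding log_generator_germs_def by blast
  then show thesis
  proof cases
    case d
    obtain U where U: "open_in_variety X U" "p \<in> U" "\<And>q. q \<in> U \<Longrightarrow> f \<in> germs X q"
      using germs_eventually[OF d(2) assms(2)] by (rule eventually_nbhdE[OF _ assms(2)]) blast
    have "\<exists>\<theta>'\<in>log_generators X I D V. \<forall>q\<in>V. \<forall>v\<in>tangent_space X q. \<theta>' q v = \<theta> q v"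
      if V: "open_in_variety X V" "V \<subseteq> U" for V
    proof (intro bexI ballI)
      show "(\<lambda>q v. v (restr V f)) \<in> log_generators X I D V"
        unfolding log_generators_def using restr_regular[OF V(1), of f] U(3) V(2) by blast
    qed (use cong[OF V(1)] U(3) V(2) d(1) in auto)
    then show thesis using that U by blast
  next
    case l
    obtain U where U: "open_in_variety X U" "p \<in> U"
      "\<And>W. open_in_variety X W \<Longrightarrow> W \<subseteq> U \<Longrightarrow> local_equation X (D i) W (restr W \<sigma>)"
      using equation_germE[OF l(3)] by metis
    have "\<exists>\<theta>'\<in>log_generators X I D V. \<forall>q\<in>V. \<forall>v\<in>tangent_space X q. \<theta>' q v = \<theta> q v"
      if V: "open_in_variety X V" "V \<subseteq> U" for V
    proof (intro bexI ballI)
      show "(\<lambda>q v. v (restr V \<sigma>) / restr V \<sigma> q) \<in> log_generators X I D V"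
        unfolding log_generators_def using U(3)[OF V] l(2) by blast
      fix q v assume qv: "q \<in> V" "v \<in> tangent_space X q"
      have "equation_germ X (D i) q \<sigma>" using U(3)[OF V] qv(1) by (auto simp: equation_germ_def)
      then have "v (restr V \<sigma>) = v \<sigma>" using cong[OF V(1)] qv equation_germ_germs by blast
      then show "v (restr V \<sigma>) / restr V \<sigma> q = \<theta> q v" using qv l(1) by (simp add: restr_def)
    qed
    then show thesis using that U by blast
  qed
qed

text \<open>Unlike for an element of \<open>stalk\<close>, nothing is said about values on the
  divisor or off the tangent spaces. The condition is therefore stable under the usual operations,
  and the normalisation is added only when sections are formed.\<close>

definition log_germ ::
  "'n::finite proj set \<Rightarrow> 'i set \<Rightarrow> ('i \<Rightarrow> 'n proj set) \<Rightarrow> nat \<Rightarrow> 'n proj \<Rightarrow> 'n form \<Rightarrow> bool" where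
  "log_germ X I D m p \<omega> \<longleftrightarrow> (\<exists>(r::nat) f \<theta>. (\<forall>j<r. f j \<in> germs X p) \<and>
     (\<forall>j<r. \<forall>l<m. \<theta> j l \<in> log_generator_germs X I D p) \<and>
     (agree X p (support D I) \<omega>
         (\<lambda>q v. \<Sum>j<r. f j q * (\<Prod>l<m. \<theta> j l q v))))"

lemma log_germE:
  assumes "log_germ X I D m p \<omega>"
  obtains r :: nat and f \<theta> where "\<And>j. j < r \<Longrightarrow> f j \<in> germs X p"
    "\<And>j l. j < r \<Longrightarrow> l < m \<Longrightarrow> \<theta> j l \<in> log_generator_germs X I D p"
    "agree X p (support D I) \<omega>
        (\<lambda>q v. \<Sum>j<r. f j q * (\<Prod>l<m. \<theta> j l q v))"
  using assms unfolding log_germ_def by blast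

lemma log_germI:
  fixes r :: nat
  assumes "\<And>j. j < r \<Longrightarrow> f j \<in> germs X p"
    and "\<And>j l. j < r \<Longrightarrow> l < m \<Longrightarrow> \<theta> j l \<in> log_generator_germs X I D p"
    and "agree X p (support D I) \<omega>
        (\<lambda>q v. \<Sum>j<r. f j q * (\<Prod>l<m. \<theta> j l q v))"
  shows "log_germ X I D m p \<omega>"
  using assms unfolding log_germ_def by blast

lemma log_germ_cong:
  assumes "log_germ X I D m p \<omega>"
    and "agree X p (support D I) \<omega>' \<omega>"
  shows "log_germ X I D m p \<omega>'"
proof (rule log_germE[OF assms(1)])
  fix r :: nat and f \<theta>
  assume *: "\<And>j. j < r \<Longrightarrow> f j \<in> germs X p"
    "\<And>j l. j < r \<Longrightarrow> l < m \<Longrightarrow> \<theta> j l \<in> log_generator_germs X I D p"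
    "agree X p (support D I) \<omega>
        (\<lambda>q v. \<Sum>j<r. f j q * (\<Prod>l<m. \<theta> j l q v))"
  show ?thesis
  proof (rule log_germI[OF *(1,2)])
    show "agree X p (support D I) \<omega>'
        (\<lambda>q v. \<Sum>j<r. f j q * (\<Prod>l<m. \<theta> j l q v))"
      using *(3) assms(2) by eventually_elim simp
  qed
qed

lemma log_germ_zero: "log_germ X I D m p (\<lambda>q v. 0)"
  by (rule log_germI[of 0]) auto

lemma log_germ_function:
  assumes "f \<in> germs X p"
  shows "log_germ X I D 0 p (\<lambda>q v. f q)"
  by (rule log_germI[of 1 "\<lambda>_. f"]) (use assms in auto)

lemma sum_lessThan_append:
  fixes f :: "nat \<Rightarrow> 'a::comm_monoid_add"
  shows "(\<Sum>j<r + s. if j < r then f j else g (j - r)) = (\<Sum>j<r. f j) + (\<Sum>j<s. g j)"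
  by (induction s) (simp_all add: add.assoc)

lemma log_germ_add:
  assumes "log_germ X I D m p \<omega>" "log_germ X I D m p \<omega>'"
  shows "log_germ X I D m p (\<lambda>q v. \<omega> q v + \<omega>' q v)"
proof (rule log_germE[OF assms(1)], rule log_germE[OF assms(2)])
  fix r :: nat and f \<theta> and r' :: nat and f' \<theta>'
  assume 1: "\<And>j. j < r \<Longrightarrow> f j \<in> germs X p"
    "\<And>j l. j < r \<Longrightarrow> l < m \<Longrightarrow> \<theta> j l \<in> log_generator_germs X I D p"
    "agree X p (support D I) \<omega>
        (\<lambda>q v. \<Sum>j<r. f j q * (\<Prod>l<m. \<theta> j l q v))"
  assume 2: "\<And>j. j < r' \<Longrightarrow> f' j \<in> germs X p"
    "\<And>j l. j < r' \<Longrightarrow> l < m \<Longrightarrow> \<theta>' j l \<in> log_generator_germs X I D p"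
    "agree X p (support D I) \<omega>'
        (\<lambda>q v. \<Sum>j<r'. f' j q * (\<Prod>l<m. \<theta>' j l q v))"
  define F where "F j = (if j < r then f j else f' (j - r))" for j
  define \<Theta> where "\<Theta> j = (if j < r then \<theta> j else \<theta>' (j - r))" for j
  have split: "(\<Sum>j<r + r'. F j q * (\<Prod>l<m. \<Theta> j l q v)) =
    (\<Sum>j<r. f j q * (\<Prod>l<m. \<theta> j l q v)) + (\<Sum>j<r'. f' j q * (\<Prod>l<m. \<theta>' j l q v))" for q v
    unfolding sum_lessThan_append[symmetric] F_def \<Theta>_def
    by (intro sum.cong) simp_all
  show ?thesis
  proof (rule log_germI[of "r + r'" F _ _ _ \<Theta>])
    show "agree X p (support D I) (\<lambda>q v. \<omega> q v + \<omega>' q v)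
        (\<lambda>q v. \<Sum>j<r + r'. F j q * (\<Prod>l<m. \<Theta> j l q v))"
      unfolding split using 1(3) 2(3) by eventually_elim simp
  qed (use 1(1,2) 2(1,2) in \<open>simp_all add: F_def \<Theta>_def\<close>)
qed

lemma log_germ_scale:
  assumes "log_germ X I D m p \<omega>" "g \<in> germs X p" "p \<in> X"
  shows "log_germ X I D m p (\<lambda>q v. g q * \<omega> q v)"
proof (rule log_germE[OF assms(1)])
  fix r :: nat and f \<theta>
  assume *: "\<And>j. j < r \<Longrightarrow> f j \<in> germs X p"
    "\<And>j l. j < r \<Longrightarrow> l < m \<Longrightarrow> \<theta> j l \<in> log_generator_germs X I D p"
    "agree X p (support D I) \<omega>
        (\<lambda>q v. \<Sum>j<r. f j q * (\<Prod>l<m. \<theta> j l q v))"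
  show ?thesis
  proof (rule log_germI[of r "\<lambda>j q. g q * f j q", OF germs_mult[OF assms(2) *(1) assms(3)] *(2)])
    show "agree X p (support D I) (\<lambda>q v. g q * \<omega> q v)
        (\<lambda>q v. \<Sum>j<r. (g q * f j q) * (\<Prod>l<m. \<theta> j l q v))"
      using *(3) by eventually_elim (simp add: sum_distrib_left mult.assoc)
  qed
qed

lemma log_germ_mult_generator:
  assumes "log_germ X I D m p \<omega>" "\<zeta> \<in> log_generator_germs X I D p"
  shows "log_germ X I D (Suc m) p (\<lambda>q v. \<zeta> q v * \<omega> q v)"
proof (rule log_germE[OF assms(1)])
  fix r :: nat and f \<theta>
  assume *: "\<And>j. j < r \<Longrightarrow> f j \<in> germs X p"
    "\<And>j l. j < r \<Longrightarrow> l < m \<Longrightarrow> \<theta> j l \<in> log_generator_germs X I D p"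
    "agree X p (support D I) \<omega>
        (\<lambda>q v. \<Sum>j<r. f j q * (\<Prod>l<m. \<theta> j l q v))"
  show ?thesis
  proof (rule log_germI[of r f _ _ _ "\<lambda>j l. if l = m then \<zeta> else \<theta> j l", OF *(1)])
    show "agree X p (support D I) (\<lambda>q v. \<zeta> q v * \<omega> q v)
        (\<lambda>q v. \<Sum>j<r. f j q * (\<Prod>l<Suc m. (if l = m then \<zeta> else \<theta> j l) q v))"
      using *(3) by eventually_elim (simp add: sum_distrib_left mult_ac)
  qed (use *(2) assms(2) in auto)
qed

lemma log_germ_mult_generator_power:
  assumes "log_germ X I D m p \<omega>" "\<zeta> \<in> log_generator_germs X I D p"
  shows "log_germ X I D (k + m) p (\<lambda>q v. \<zeta> q v ^ k * \<omega> q v)"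
proof (induction k)
  case (Suc k)
  from log_germ_mult_generator[OF this assms(2)] show ?case by (simp add: mult.assoc)
qed (use assms in simp)

lemma log_germ_uminus:
  assumes "log_germ X I D m p \<omega>" "p \<in> X"
  shows "log_germ X I D m p (\<lambda>q v. - \<omega> q v)"
  using log_germ_scale[OF assms(1) germs_const[OF assms(2), of "-1"] assms(2)] by simp

lemma log_germ_diff:
  assumes "log_germ X I D m p \<omega>" "log_germ X I D m p \<omega>'" "p \<in> X"
  shows "log_germ X I D m p (\<lambda>q v. \<omega> q v - \<omega>' q v)"
  using log_germ_add[OF assms(1) log_germ_uminus[OF assms(2,3)]] by simp

lemma log_germ_sum:
  assumes "\<And>i. i \<in> A \<Longrightarrow> log_germ X I D m p (\<omega> i)"
  shows "log_germ X I D m p (\<lambda>q v. \<Sum>i\<in>A. \<omega> i q v)"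
  using assms
  by (induction A rule: infinite_finite_induct) (auto intro: log_germ_add log_germ_zero)

lemma log_germ_mono:
  assumes "log_germ X I' D m p \<omega>" "I' \<subseteq> I"
  shows "log_germ X I D m p \<omega>"
proof (rule log_germE[OF assms(1)])
  fix r :: nat and f \<theta>
  assume *: "\<And>j. j < r \<Longrightarrow> f j \<in> germs X p"
    "\<And>j l. j < r \<Longrightarrow> l < m \<Longrightarrow> \<theta> j l \<in> log_generator_germs X I' D p"
    "agree X p (support D I') \<omega>
        (\<lambda>q v. \<Sum>j<r. f j q * (\<Prod>l<m. \<theta> j l q v))"
  show ?thesis
  proof (rule log_germI[OF *(1)])
    show "\<theta> j l \<in> log_generator_germs X I D p" if "j < r" "l < m" for j l
      using *(2)[OF that] log_generator_germs_mono[OF assms(2)] by blast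
    show "agree X p (support D I) \<omega>
        (\<lambda>q v. \<Sum>j<r. f j q * (\<Prod>l<m. \<theta> j l q v))"
      using *(3) by eventually_elim (use assms(2) in blast)
  qed
qed

lemma log_germ_eventually:
  assumes "log_germ X I D m p \<omega>" "p \<in> X"
  shows "\<forall>\<^sub>F q in nbhd X p. log_germ X I D m q \<omega>"
proof (rule log_germE[OF assms(1)])
  fix r :: nat and f \<theta>
  assume *: "\<And>j. j < r \<Longrightarrow> f j \<in> germs X p"
    "\<And>j l. j < r \<Longrightarrow> l < m \<Longrightarrow> \<theta> j l \<in> log_generator_germs X I D p"
    "agree X p (support D I) \<omega>
        (\<lambda>q v. \<Sum>j<r. f j q * (\<Prod>l<m. \<theta> j l q v))"
  have 1: "\<forall>\<^sub>F q in nbhd X p. \<forall>j\<in>{..<r}. f j \<in> germs X q"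
    by (intro eventually_ball_finite ballI germs_eventually *(1) assms(2)) simp_all
  have 2: "\<forall>\<^sub>F q in nbhd X p. \<forall>j\<in>{..<r}. \<forall>l\<in>{..<m}. \<theta> j l \<in> log_generator_germs X I D q"
    by (intro eventually_ball_finite ballI log_generator_germs_eventually *(2) assms(2)) simp_all
  show ?thesis
    using 1 2 eventually_eventually_nbhd[OF *(3) assms(2)]
  proof eventually_elim
    case (elim q)
    show ?case by (rule log_germI[OF _ _ elim(3)]) (use elim(1,2) in auto)
  qed
qed

definition normalized :: "'n::finite proj set \<Rightarrow> 'n proj set \<Rightarrow> 'n form \<Rightarrow> bool" where
  "normalized X U \<omega> \<longleftrightarrow> (\<forall>q v. q \<notin> U \<or> v \<notin> tangent_space X q \<longrightarrow> \<omega> q v = 0)"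

text \<open>A section yields germs by restriction of its coefficients and generators. Conversely,
  the finitely many coefficients and generators of a germ at \<open>p\<close> are replaced by
  sections over one common neighbourhood of \<open>p\<close>.\<close>

lemma log_forms_iff:
  fixes X :: "'n::finite proj set"
  assumes U: "open_in_variety X U"
  shows "\<omega> \<in> log_forms X I D m U \<longleftrightarrow>
    normalized X (U - (support D I)) \<omega> \<and> (\<forall>p\<in>U. log_germ X I D m p \<omega>)" (is "?L \<longleftrightarrow> ?R")
proof
  assume L: ?L
  have "log_germ X I D m p \<omega>" if p: "p \<in> U" for p
  proof -
    have "\<exists>V. open_in_variety X V \<and> p \<in> V \<and> V \<subseteq> U \<and>
        (\<exists>(r::nat) f \<theta>. (\<forall>j<r. f j \<in> regular X V) \<and>
           (\<forall>j<r. \<forall>l<m. \<theta> j l \<in> log_generators X I D V) \<and>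
           (\<forall>q\<in>V - (support D I). \<forall>v\<in>tangent_space X q.
              \<omega> q v = (\<Sum>j<r. f j q * (\<Prod>l<m. \<theta> j l q v))))"
      using L p unfolding log_forms_def mem_Collect_eq by (elim conjE) (rule bspec)
    then obtain V and r :: nat and f \<theta> where V: "open_in_variety X V" "p \<in> V" "V \<subseteq> U"
      "\<forall>j<r. f j \<in> regular X V" "\<forall>j<r. \<forall>l<m. \<theta> j l \<in> log_generators X I D V"
      "\<forall>q\<in>V - (support D I). \<forall>v\<in>tangent_space X q. \<omega> q v = (\<Sum>j<r. f j q * (\<Prod>l<m. \<theta> j l q v))"
      by (elim exE conjE)
    show ?thesis
    proof (rule log_germI)
      show "f j \<in> germs X p" if "j < r" for j using V that regular_germs by blast
      show "\<theta> j l \<in> log_generator_germs X I D p" if "j < r" "l < m" for j l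
        using V that log_generators_germs by blast
      show "agree X p (support D I) \<omega>
          (\<lambda>q v. \<Sum>j<r. f j q * (\<Prod>l<m. \<theta> j l q v))"
        by (rule eventually_nbhdI[OF V(1,2)]) (use V(6) in blast)
    qed
  qed
  moreover have "normalized X (U - (support D I)) \<omega>"
    using L unfolding log_forms_def normalized_def mem_Collect_eq by (rule conjunct1)
  ultimately show ?R by simp
next
  assume R: ?R
  have "\<exists>V. open_in_variety X V \<and> p \<in> V \<and> V \<subseteq> U \<and>
        (\<exists>(r::nat) f \<theta>. (\<forall>j<r. f j \<in> regular X V) \<and>
           (\<forall>j<r. \<forall>l<m. \<theta> j l \<in> log_generators X I D V) \<and>
           (\<forall>q\<in>V - (support D I). \<forall>v\<in>tangent_space X q.
              \<omega> q v = (\<Sum>j<r. f j q * (\<Prod>l<m. \<theta> j l q v))))" if p: "p \<in> U" for p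
  proof -
    have pX: "p \<in> X" using U p open_in_variety_subset by blast
    have "log_germ X I D m p \<omega>" using R p by blast
    then show ?thesis
    proof (rule log_germE)
      fix r :: nat and f \<theta>
      assume *: "\<And>j. j < r \<Longrightarrow> f j \<in> germs X p"
        "\<And>j l. j < r \<Longrightarrow> l < m \<Longrightarrow> \<theta> j l \<in> log_generator_germs X I D p"
        "agree X p (support D I) \<omega>
            (\<lambda>q v. \<Sum>j<r. f j q * (\<Prod>l<m. \<theta> j l q v))"
      have 1: "\<forall>\<^sub>F q in nbhd X p. \<forall>j\<in>{..<r}. f j \<in> germs X q"
        by (intro eventually_ball_finite ballI germs_eventually *(1) pX) simp_all
      \<comment> \<open>The generators over \<open>V\<close> that take the values of
        \<open>\<eta>\<close> on tangent vectors at points of \<open>V\<close>. The sets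
        \<open>W j l\<close> chosen below are neighbourhoods inside which such generators exist; the
        final \<open>V\<close> lies in all of them.\<close>
      define rep where "rep V \<eta> = {\<theta>' \<in> log_generators X I D V.
        \<forall>q\<in>V. \<forall>v\<in>tangent_space X q. \<theta>' q v = \<eta> q v}" for V and \<eta> :: "'n form"
      define Q where "Q \<eta> W \<longleftrightarrow> open_in_variety X W \<and> p \<in> W \<and>
        (\<forall>V. open_in_variety X V \<longrightarrow> V \<subseteq> W \<longrightarrow> rep V \<eta> \<noteq> {})" for \<eta> W
      define W where "W j l = (SOME W. Q (\<theta> j l) W)" for j l
      have QW: "Q (\<theta> j l) (W j l)" if "j < r" "l < m" for j l
      proof -
        have "\<exists>W. Q (\<theta> j l) W"
        proof (rule log_generator_germs_represented[OF *(2)[OF that] pX])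
          fix U assume U: "open_in_variety X U" "p \<in> U" "\<And>V. open_in_variety X V \<Longrightarrow> V \<subseteq> U \<Longrightarrow>
            \<exists>\<theta>'\<in>log_generators X I D V. \<forall>q\<in>V. \<forall>v\<in>tangent_space X q. \<theta>' q v = \<theta> j l q v"
          have "rep V (\<theta> j l) \<noteq> {}" if "open_in_variety X V" "V \<subseteq> U" for V
            using U(3)[OF that] by (auto simp: rep_def)
          with U(1,2) show ?thesis unfolding Q_def by blast
        qed
        then show ?thesis unfolding W_def by (rule someI_ex)
      qed
      then have W: "\<And>j l. j < r \<Longrightarrow> l < m \<Longrightarrow> open_in_variety X (W j l)"
        "\<And>j l. j < r \<Longrightarrow> l < m \<Longrightarrow> p \<in> W j l"
        by (simp_all add: Q_def)
      have 2: "\<forall>\<^sub>F q in nbhd X p. \<forall>j\<in>{..<r}. \<forall>l\<in>{..<m}. q \<in> W j l"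
        by (intro eventually_ball_finite ballI eventually_nbhd_in W(1,2)) simp_all
      have "\<forall>\<^sub>F q in nbhd X p. q \<in> U \<and> (\<forall>j\<in>{..<r}. f j \<in> germs X q) \<and>
          (\<forall>j\<in>{..<r}. \<forall>l\<in>{..<m}. q \<in> W j l) \<and> (q \<notin> (support D I) \<longrightarrow>
            (\<forall>v\<in>tangent_space X q. \<omega> q v = (\<Sum>j<r. f j q * (\<Prod>l<m. \<theta> j l q v))))"
        by (intro eventually_conj eventually_nbhd_in[OF U p] 1 2 *(3))
      then obtain V where V: "open_in_variety X V" "p \<in> V" "\<And>q. q \<in> V \<Longrightarrow> q \<in> U \<and>
          (\<forall>j\<in>{..<r}. f j \<in> germs X q) \<and>
          (\<forall>j\<in>{..<r}. \<forall>l\<in>{..<m}. q \<in> W j l) \<and> (q \<notin> (support D I) \<longrightarrow>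
            (\<forall>v\<in>tangent_space X q. \<omega> q v = (\<Sum>j<r. f j q * (\<Prod>l<m. \<theta> j l q v))))"
        by (rule eventually_nbhdE[OF _ pX]) blast
      define \<theta>' where "\<theta>' j l = (SOME \<theta>'. \<theta>' \<in> rep V (\<theta> j l))" for j l
      have "\<theta>' j l \<in> rep V (\<theta> j l)" if "j < r" "l < m" for j l
      proof -
        have "V \<subseteq> W j l" using V(3) that by blast
        then have "rep V (\<theta> j l) \<noteq> {}" using QW[OF that] V(1) by (simp add: Q_def)
        then show ?thesis unfolding \<theta>'_def by (simp add: some_in_eq)
      qed
      then have \<theta>': "\<And>j l. j < r \<Longrightarrow> l < m \<Longrightarrow> \<theta>' j l \<in> log_generators X I D V"
        "\<And>j l q v. j < r \<Longrightarrow> l < m \<Longrightarrow> q \<in> V \<Longrightarrow> v \<in> tangent_space X q \<Longrightarrow> \<theta>' j l q v = \<theta> j l q v"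
        by (simp_all add: rep_def)
      have "\<omega> q v = (\<Sum>j<r. restr V (f j) q * (\<Prod>l<m. \<theta>' j l q v))"
        if q: "q \<in> V" "q \<notin> (support D I)" "v \<in> tangent_space X q" for q v
      proof -
        have "\<omega> q v = (\<Sum>j<r. f j q * (\<Prod>l<m. \<theta> j l q v))" using V(3)[OF q(1)] q by blast
        also have "\<dots> = (\<Sum>j<r. restr V (f j) q * (\<Prod>l<m. \<theta>' j l q v))"
          using q \<theta>'(2) by (intro sum.cong arg_cong2[where f = times] prod.cong) (auto simp: restr_def)
        finally show ?thesis .
      qed
      moreover have "restr V (f j) \<in> regular X V" if "j < r" for j
        using V(3) that by (intro restr_regular V(1)) auto
      ultimately show ?thesis using V \<theta>'(1)
        by (intro exI[of _ V] conjI exI[of _ r] exI[of _ "\<lambda>j. restr V (f j)"] exI[of _ \<theta>']) auto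
    qed
  qed
  then show ?L using R unfolding log_forms_def normalized_def mem_Collect_eq by (intro conjI ballI) simp_all
qed

section \<open>Normal forms at a normal crossing\<close>

text \<open>Induction on the set of variables. With all variables but \<open>T j\<close> fixed, the
  sum is a polynomial in one variable that vanishes identically. Its coefficient at the exponent of
  \<open>j\<close> in \<open>M\<close> is a combination of monomials in the remaining variables that
  vanishes for all values, so the induction hypothesis applies.\<close>

lemma multiset_monomials_independent:
  fixes a :: "'j multiset \<Rightarrow> complex"
  assumes "finite A" "finite \<M>" "\<And>M. M \<in> \<M> \<Longrightarrow> set_mset M \<subseteq> A"
    and "\<And>T :: 'j \<Rightarrow> complex. (\<Sum>M\<in>\<M>. a M * (\<Prod>j\<in>#M. T j)) = 0"
    and "M \<in> \<M>"
  shows "a M = 0"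
  using assms
proof (induction A arbitrary: \<M> a M rule: finite_induct)
  case empty
  then have "\<M> = {{#}}" by auto
  with empty show ?case by simp
next
  case (insert j A)
  define d where "d = count M j"
  define \<N> where "\<N> = {N \<in> \<M>. count N j = d}"
  define rest where "rest N = filter_mset (\<lambda>i. i \<noteq> j) N" for N
  have split: "N = rest N + replicate_mset (count N j) j" for N
    by (rule multiset_eqI) (simp add: rest_def)
  \<comment> \<open>On \<open>\<N>\<close> the exponent of \<open>j\<close> is always
    \<open>d\<close>, so removing the copies of \<open>j\<close> loses no information.\<close>
  have inj: "inj_on rest \<N>"
  proof (rule inj_onI)
    fix N N' assume *: "N \<in> \<N>" "N' \<in> \<N>" "rest N = rest N'"
    then have "N = rest N' + replicate_mset d j" "N' = rest N' + replicate_mset d j"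
      using split[of N] split[of N'] by (simp_all add: \<N>_def)
    then show "N = N'" by simp
  qed
  have prod: "(\<Prod>i\<in>#N. (T(j := t)) i) = (\<Prod>i\<in>#rest N. T i) * t ^ count N j" for N T and t :: complex
  proof -
    have "(\<Prod>i\<in>#N. (T(j := t)) i) = (\<Prod>i\<in>#rest N + replicate_mset (count N j) j. (T(j := t)) i)"
      by (subst split[of N]) (rule refl)
    also have "\<dots> = (\<Prod>i\<in>#rest N. (T(j := t)) i) * t ^ count N j" by simp
    also have "image_mset (T(j := t)) (rest N) = image_mset T (rest N)"
      by (rule image_mset_cong) (simp add: rest_def)
    finally show ?thesis .
  qed
  have "(\<Sum>N\<in>rest ` \<N>. a (N + replicate_mset d j) * (\<Prod>i\<in>#N. T i)) = 0" for T
  proof -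
    \<comment> \<open>\<open>b i\<close> is the coefficient of \<open>t ^ i\<close> after
      \<open>t\<close> is substituted for \<open>T j\<close>. The bound \<open>n\<close> on the
      degree is at least \<open>d\<close>, so that \<open>b d\<close> is among the
      coefficients.\<close>
    define b where "b i = (\<Sum>N | N \<in> \<M> \<and> count N j = i. a N * (\<Prod>i\<in>#rest N. T i))" for i
    define n where "n = Max (insert d ((\<lambda>N. count N j) ` \<M>))"
    have n: "count N j \<le> n" if "N \<in> \<M>" for N
      unfolding n_def using that insert.prems(1) by (intro Max_ge) auto
    have dn: "d \<le> n" unfolding n_def using insert.prems(1) by (intro Max_ge) auto
    have "(\<Sum>i\<le>n. b i * t ^ i) = 0" for t
    proof -
      have "(\<Sum>i\<le>n. b i * t ^ i) =
          (\<Sum>i\<le>n. \<Sum>N | N \<in> \<M> \<and> count N j = i. a N * (\<Prod>i\<in>#rest N. T i) * t ^ count N j)"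
        unfolding b_def sum_distrib_right by (intro sum.cong) auto
      also have "\<dots> = (\<Sum>N\<in>\<M>. a N * (\<Prod>i\<in>#rest N. T i) * t ^ count N j)"
        using n insert.prems(1) by (intro sum.group) auto
      also have "\<dots> = (\<Sum>N\<in>\<M>. a N * (\<Prod>i\<in>#N. (T(j := t)) i))"
        unfolding prod by (simp add: mult.assoc)
      also have "\<dots> = 0" by (rule insert.prems(3))
      finally show ?thesis .
    qed
    then have "b d = 0" using dn by (rule zero_polynom_imp_zero_coeffs)
    have rd: "rest N + replicate_mset d j = N" if "N \<in> \<N>" for N
      using split[of N] that by (simp add: \<N>_def)
    have "(\<Sum>N\<in>rest ` \<N>. a (N + replicate_mset d j) * (\<Prod>i\<in>#N. T i)) =
        (\<Sum>N\<in>\<N>. a N * (\<Prod>i\<in>#rest N. T i))"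
      by (subst sum.reindex[OF inj]) (auto intro!: sum.cong simp: rd)
    also have "\<dots> = b d" unfolding b_def \<N>_def ..
    finally show ?thesis using \<open>b d = 0\<close> by simp
  qed
  moreover have "M \<in> \<N>" using insert.prems(4) by (simp add: \<N>_def d_def)
  moreover have "set_mset N \<subseteq> A" if "N \<in> rest ` \<N>" for N
    using that insert.prems(2) by (force simp: \<N>_def rest_def)
  moreover have "finite (rest ` \<N>)" using insert.prems(1) by (simp add: \<N>_def)
  ultimately have "a (rest M + replicate_mset d j) = 0"
    using insert.IH[of "rest ` \<N>" "\<lambda>N. a (N + replicate_mset d j)" "rest M"] by blast
  then show ?case using split[of M] by (simp add: d_def)
qed

lemma spanned_weaken:
  assumes "spanned X p E K \<theta> \<omega>" "E \<subseteq> E'"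
  shows "spanned X p E' K \<theta> \<omega>"
proof (rule spannedE[OF assms(1)])
  fix b assume b: "\<And>j. j \<in> K \<Longrightarrow> b j \<in> germs X p"
    "agree X p E \<omega> (\<lambda>q v. \<Sum>j\<in>K. b j q * \<theta> j q v)"
  show ?thesis
  proof (rule spannedI[OF b(1)])
    show "agree X p E' \<omega> (\<lambda>q v. \<Sum>j\<in>K. b j q * \<theta> j q v)"
      using b(2) by eventually_elim (use assms(2) in blast)
  qed
qed

lemma spanned_mult:
  assumes "spanned X p E K \<theta> \<omega>" "spanned X p E K' \<theta>' \<omega>'" "p \<in> X"
    and "\<And>j j'. j \<in> K \<Longrightarrow> j' \<in> K' \<Longrightarrow> spanned X p E L \<xi> (\<lambda>q v. \<theta> j q v * \<theta>' j' q v)"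
  shows "spanned X p E L \<xi> (\<lambda>q v. \<omega> q v * \<omega>' q v)"
proof (rule spannedE[OF assms(1)], rule spannedE[OF assms(2)])
  fix b b' assume b: "\<And>j. j \<in> K \<Longrightarrow> b j \<in> germs X p"
    "agree X p E \<omega> (\<lambda>q v. \<Sum>j\<in>K. b j q * \<theta> j q v)"
    and b': "\<And>j. j \<in> K' \<Longrightarrow> b' j \<in> germs X p"
    "agree X p E \<omega>' (\<lambda>q v. \<Sum>j\<in>K'. b' j q * \<theta>' j q v)"
  have "spanned X p E L \<xi> (\<lambda>q v. \<Sum>j\<in>K. \<Sum>j'\<in>K'. b j q * (b' j' q * (\<theta> j q v * \<theta>' j' q v)))"
    by (intro spanned_sum spanned_scale b(1) b'(1) assms(3,4))
  then show ?thesis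
  proof (rule spanned_cong)
    show "agree X p E (\<lambda>q v. \<omega> q v * \<omega>' q v)
        (\<lambda>q v. \<Sum>j\<in>K. \<Sum>j'\<in>K'. b j q * (b' j' q * (\<theta> j q v * \<theta>' j' q v)))"
      using b(2) b'(2) by eventually_elim (simp add: sum_product mult_ac)
  qed
qed

text \<open>Each equation divides the other: \<sigma> = \<sigma>' u and \<sigma>' = \<sigma> w. Off
  \<open>Y\<close> both are nonzero, so u w = 1 there, and Leibniz' rule for \<sigma>' u gives the
  formula. The second division provides the inverse of \<open>u\<close> as a germ that is regular on
  \<open>Y\<close> as well.\<close>

lemma dlog_change_equation:
  assumes eq: "equation_germ X Y p \<sigma>" "equation_germ X Y p \<sigma>'" and Y: "closedin zariski Y"
  obtains u w where "u \<in> germs X p" "w \<in> germs X p" "\<forall>\<^sub>F q in nbhd X p. \<sigma> q = \<sigma>' q * u q"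
    "agree X p Y (\<lambda>q v. v \<sigma> / \<sigma> q) (\<lambda>q v. v \<sigma>' / \<sigma>' q + w q * v u)"
proof -
  have p: "p \<in> X" using eq(1) by (rule equation_germ_variety)
  note g = equation_germ_germs[OF eq(1)] equation_germ_germs[OF eq(2)]
  note z = equation_germ_zero_iff[OF eq(1) Y] equation_germ_zero_iff[OF eq(2) Y]
  have "\<forall>\<^sub>F q in nbhd X p. q \<in> Y \<longrightarrow> \<sigma> q = 0" using z(1) by eventually_elim blast
  then obtain u where u: "u \<in> germs X p" "\<forall>\<^sub>F q in nbhd X p. \<sigma> q = \<sigma>' q * u q"
    by (rule equation_germ_divides[OF eq(2) g(1)])
  have "\<forall>\<^sub>F q in nbhd X p. q \<in> Y \<longrightarrow> \<sigma>' q = 0" using z(2) by eventually_elim blast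
  then obtain w where w: "w \<in> germs X p" "\<forall>\<^sub>F q in nbhd X p. \<sigma>' q = \<sigma> q * w q"
    by (rule equation_germ_divides[OF eq(1) g(2)])
  have "agree X p Y (\<lambda>q v. v \<sigma> / \<sigma> q)
      (\<lambda>q v. v \<sigma>' / \<sigma>' q + w q * v u)"
    using z eventually_eventually_nbhd[OF u(2) p] u(2) w(2) germs_eventually[OF u(1) p]
      germs_eventually[OF g(1) p] germs_eventually[OF g(2) p] eventually_nbhd_variety[OF p]
  proof eventually_elim
    case (elim q)
    show ?case
    proof (intro impI ballI)
      fix v assume q: "q \<notin> Y" and v: "v \<in> tangent_space X q"
      have "v \<sigma> = v (\<lambda>q. \<sigma>' q * u q)" by (rule tangent_cong[OF v elim(7,9,3)])
      also have "\<dots> = \<sigma>' q * v u + u q * v \<sigma>'" by (rule tangent_mult[OF v elim(8,6)])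
      finally have d: "v \<sigma> = \<sigma>' q * v u + u q * v \<sigma>'" .
      have nz: "\<sigma> q \<noteq> 0" "\<sigma>' q \<noteq> 0" using elim(1,2) q by blast+
      have "\<sigma>' q * (u q * w q) = \<sigma>' q * 1"
        using elim(4,5) by (metis mult.assoc mult.right_neutral)
      then have "u q * w q = 1" using nz(2) by (subst (asm) mult_cancel_left) simp
      then have w: "w q = inverse (u q)" "u q \<noteq> 0" by (auto simp: inverse_unique)
      have "v \<sigma> / \<sigma> q = (\<sigma>' q * v u) / (\<sigma>' q * u q) + (u q * v \<sigma>') / (\<sigma>' q * u q)"
        unfolding d elim(4) by (rule add_divide_distrib)
      also have "\<dots> = v \<sigma>' / \<sigma>' q + w q * v u"
        using nz(2) w(2) unfolding w(1) by (simp add: field_simps)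
      finally show "v \<sigma> / \<sigma> q = v \<sigma>' / \<sigma>' q + w q * v u" .
    qed
  qed
  then show thesis using that u w by blast
qed

section \<open>Consequences of irreducibility and normal crossings\<close>

locale snc_pair =
  fixes X :: "'n::finite proj set" and I :: "'i set" and D :: "'i \<Rightarrow> 'n proj set" and c :: 'i
  assumes variety: "projective_variety X" and smooth_variety: "smooth X"
    and component: "c \<in> I" and snc: "snc_divisor X I D"
begin

lemma finite_components: "finite I"
  using snc by (simp add: snc_divisor_def)

lemma closed_component: "i \<in> I \<Longrightarrow> closedin zariski (D i)"
  using snc by (simp add: snc_divisor_def prime_divisor_def projective_variety_def)

lemma variety_nonempty: "X \<noteq> {}"
  using variety by (simp add: projective_variety_def irreducible_in_def)

lemma variety_irreducible:
  assumes "closedin zariski A" "closedin zariski B" "X \<subseteq> A \<union> B"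
  shows "X \<subseteq> A \<or> X \<subseteq> B"
  using variety assms by (simp add: projective_variety_def irreducible_in_def)

lemma snc_coordinates_exist:
  assumes "p \<in> X"
  shows "\<exists>n z \<tau>. enat n = krull_dim X \<and> generate_maximal_ideal X p n z \<and>
    inj_on \<tau> {i \<in> I. p \<in> D i} \<and>
    (\<forall>i\<in>I. p \<in> D i \<longrightarrow> \<tau> i < n \<and> equation_germ X (D i) p (z (\<tau> i)))"
proof -
  have "\<forall>p\<in>X. \<exists>n z \<tau>. enat n = krull_dim X \<and> generate_maximal_ideal X p n z \<and>
    inj_on \<tau> {i \<in> I. p \<in> D i} \<and>
    (\<forall>i\<in>I. p \<in> D i \<longrightarrow> \<tau> i < n \<and> equation_germ X (D i) p (z (\<tau> i)))"
    using snc unfolding snc_divisor_def equation_germ_def by (elim conjE)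
  then show ?thesis using assms by (rule bspec)
qed

text \<open>A component has dimension one less than the variety. This contradicts equality only if
  \<open>krull_dim X\<close> is finite, as \<infinity> + 1 = \<infinity> in \<open>enat\<close>; the
  number of local coordinates at any point shows finiteness.\<close>

lemma not_subset_component:
  assumes "i \<in> I"
  shows "\<not> X \<subseteq> D i"
proof
  assume "X \<subseteq> D i"
  moreover have Y: "D i \<subseteq> X" "krull_dim (D i) + 1 = krull_dim X"
    using snc assms by (auto simp: snc_divisor_def prime_divisor_def)
  ultimately have "krull_dim X + 1 = krull_dim X" by auto
  moreover obtain p where "p \<in> X" using variety_nonempty by blast
  then obtain n where "enat n = krull_dim X" using snc_coordinates_exist by meson
  then have "krull_dim X = enat n" by simp
  ultimately show False by (simp add: one_enat_def)
qed

lemma not_subset_divisor: "\<not> X \<subseteq> (support D I)"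
proof -
  have "\<not> X \<subseteq> (support D J)" if "J \<subseteq> I" "finite J" for J
    using that(2,1)
  proof (induction J rule: finite_induct)
    case empty
    then show ?case using variety_nonempty by auto
  next
    case (insert j J)
    have cl: "closedin zariski (D j)" "closedin zariski (support D J)"
      using insert by (auto intro!: closedin_Union closed_component)
    have "\<not> X \<subseteq> D j" "\<not> X \<subseteq> (support D J)"
      using insert not_subset_component by auto
    then show ?case
      using variety_irreducible[OF cl] by auto
  qed
  then show ?thesis using finite_components by blast
qed

text \<open>The set \<open>W\<close> where \<open>f\<close> is nonzero is open, and the variety is
  the union of \<open>X - W\<close> and the divisor. Both are closed and the divisor is a proper
  subset, so irreducibility forces \<open>W\<close> to be empty. This carries identities of
  coefficients from the complement of the divisor onto the divisor.\<close>

lemma germ_zero_dense: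
  assumes f: "f \<in> germs X p" and p: "p \<in> X"
    and zero: "\<forall>\<^sub>F q in nbhd X p. q \<notin> (support D I) \<longrightarrow> f q = 0"
  shows "\<forall>\<^sub>F q in nbhd X p. f q = 0"
proof -
  have "\<forall>\<^sub>F q in nbhd X p. f \<in> germs X q \<and> (q \<notin> (support D I) \<longrightarrow> f q = 0)"
    using germs_eventually[OF f p] zero by eventually_elim blast
  then obtain V where V: "open_in_variety X V" "p \<in> V"
    "\<And>q. q \<in> V \<Longrightarrow> f \<in> germs X q \<and> (q \<notin> (support D I) \<longrightarrow> f q = 0)"
    by (rule eventually_nbhdE[OF _ p]) blast
  define W where "W = {q \<in> V. f q \<noteq> 0}"
  have VX: "V \<subseteq> X" using open_in_variety_subset[OF V(1)] .
  have "\<exists>T. open_in_variety X T \<and> q \<in> T \<and> T \<subseteq> W" if "q \<in> W" for q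
  proof -
    have q: "q \<in> V" "f q \<noteq> 0" "q \<in> X" using that VX by (auto simp: W_def)
    have "\<forall>\<^sub>F r in nbhd X q. r \<in> W"
      using germs_eventually_nonzero[OF conjunct1[OF V(3)[OF q(1)]] q(3,2)]
        eventually_nbhd_in[OF V(1) q(1)]
      by eventually_elim (simp add: W_def)
    then show ?thesis by (rule eventually_nbhdE[OF _ q(3)]) blast
  qed
  then have "open_in_variety X W" by (subst openin_subopen) blast
  then have "closedin (subtopology zariski X) (topspace (subtopology zariski X) - W)"
    by (intro closedin_diff closedin_topspace)
  then have "closedin (subtopology zariski X) (X - W)" by (simp add: topspace_zariski)
  then have "closedin zariski (X - W)"
    by (rule closedin_trans_full) (use variety in \<open>simp add: projective_variety_def\<close>)
  moreover have "closedin zariski (support D I)"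
    using finite_components by (auto intro!: closedin_Union closed_component)
  moreover have "X \<subseteq> (X - W) \<union> (support D I)" using V(3) by (auto simp: W_def)
  ultimately have "X \<subseteq> X - W"
    using variety_irreducible not_subset_divisor by blast
  then have "W = {}" using VX by (auto simp: W_def)
  then show ?thesis
    by (intro eventually_nbhdI[OF V(1,2)]) (auto simp: W_def)
qed

lemma equation_exists:
  assumes p: "p \<in> X"
  shows "\<exists>\<sigma>. equation_germ X (D c) p \<sigma>"
proof (cases "p \<in> D c")
  case True
  then show ?thesis using snc_coordinates_exist[OF p] component by meson
next
  case False
  have "open_in_variety X (X - D c)"
    using openin_variety_Diff[OF open_in_variety_self closed_component[OF component]] .
  then have "equation_germ X (D c) p (\<lambda>q. 1)"
    by (rule equation_germ_unit) (use False p in blast)+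
  then show ?thesis by blast
qed

end

section \<open>Logarithmic coframes and their monomials\<close>

definition log_coframe :: "(nat \<Rightarrow> 'n::finite proj \<Rightarrow> complex) \<Rightarrow> nat set \<Rightarrow> nat \<Rightarrow> 'n form" where
  "log_coframe z S j q v = v (z j) / (if j \<in> S then z j q else 1)"

text \<open>Multisets of indices encode the monomials of a symmetric power: \<open>size\<close> is
  the degree and \<open>count\<close> the exponent.\<close>

definition form_monomial :: "(nat \<Rightarrow> 'n::finite form) \<Rightarrow> nat multiset \<Rightarrow> 'n form" where
  "form_monomial e M q v = (\<Prod>j\<in>#M. e j q v)"

locale snc_coordinates = snc_pair X I D c
  for X :: "'n::finite proj set" and I :: "'i set" and D :: "'i \<Rightarrow> 'n proj set" and c :: 'i +
  fixes p :: "'n proj" and n :: nat and z :: "nat \<Rightarrow> 'n proj \<Rightarrow> complex" and \<tau> :: "'i \<Rightarrow> nat"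
  assumes point: "p \<in> X" and dimension: "krull_dim X = enat n"
    and coordinates: "generate_maximal_ideal X p n z"
    and inj_index: "inj_on \<tau> {i \<in> I. p \<in> D i}"
    and index: "\<And>i. i \<in> I \<Longrightarrow> p \<in> D i \<Longrightarrow> \<tau> i < n"
    and coordinate_equation: "\<And>i. i \<in> I \<Longrightarrow> p \<in> D i \<Longrightarrow> equation_germ X (D i) p (z (\<tau> i))"
begin

text \<open>The basis dz_j / z_j for the coordinates that define components in \<open>J\<close>
  through \<open>p\<close>, and dz_j for the others. It is used for \<open>J = I\<close> and for
  \<open>J = I - {c}\<close>; in the second case the coordinate of \<open>D c\<close> contributes
  its plain differential.\<close>

definition coframe :: "'i set \<Rightarrow> nat \<Rightarrow> 'n form" where
  "coframe J = log_coframe z (\<tau> ` {i \<in> J. p \<in> D i})"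

lemma coordinate_germs: "j < n \<Longrightarrow> z j \<in> germs X p"
  using coordinates by (auto simp: generate_maximal_ideal_def)

lemma coframe_generator:
  assumes "J \<subseteq> I" "j < n"
  shows "coframe J j \<in> log_generator_germs X J D p"
proof (cases "j \<in> \<tau> ` {i \<in> J. p \<in> D i}")
  case True
  then obtain i where i: "i \<in> J" "p \<in> D i" "j = \<tau> i" by blast
  have "coframe J j = (\<lambda>q v. v (z j) / z j q)"
    using True by (intro ext) (simp add: coframe_def log_coframe_def)
  moreover have "equation_germ X (D i) p (z j)" using coordinate_equation assms i by blast
  ultimately show ?thesis using log_generator_germs_dlog i(1) by simp
next
  case False
  then have "coframe J j = (\<lambda>q v. v (z j))"
    by (intro ext) (simp add: coframe_def log_coframe_def)
  then show ?thesis using log_generator_germs_differential[OF coordinate_germs[OF assms(2)]] by simp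
qed

lemma log_germ_monomial:
  assumes "J \<subseteq> I" "set_mset M \<subseteq> {..<n}"
  shows "log_germ X J D (size M) p (form_monomial (coframe J) M)"
  using assms(2)
proof (induction M)
  case empty
  have "form_monomial (coframe J) {#} = (\<lambda>q v. 1)" by (intro ext) (simp add: form_monomial_def)
  then show ?case using log_germ_function[OF germs_const[OF point]] by simp
next
  case (add j M)
  then have "log_germ X J D (Suc (size M)) p (\<lambda>q v. coframe J j q v * form_monomial (coframe J) M q v)"
    using coframe_generator assms(1) by (intro log_germ_mult_generator) auto
  moreover have "form_monomial (coframe J) (add_mset j M) =
      (\<lambda>q v. coframe J j q v * form_monomial (coframe J) M q v)"
    by (intro ext) (simp add: form_monomial_def)
  ultimately show ?case by simp
qed

lemma eventually_coordinate_nonzero: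
  assumes "J \<subseteq> I"
  shows "\<forall>\<^sub>F q in nbhd X p. q \<notin> (support D J) \<longrightarrow> (\<forall>j\<in>\<tau> ` {i \<in> J. p \<in> D i}. z j q \<noteq> 0)"
proof -
  have "finite J" using finite_components assms finite_subset by blast
  then have "\<forall>\<^sub>F q in nbhd X p. \<forall>i\<in>{i \<in> J. p \<in> D i}. z (\<tau> i) q = 0 \<longleftrightarrow> q \<in> D i"
    using assms
    by (intro eventually_ball_finite ballI equation_germ_zero_iff coordinate_equation closed_component) auto
  then show ?thesis by eventually_elim auto
qed

text \<open>The dz_j span all differentials, and off the divisor dz_j is the regular multiple by z_j
  of the coframe entry dz_j / z_j.\<close>

lemma differential_spanned:
  assumes "J \<subseteq> I" "f \<in> germs X p"
  shows "spanned X p (support D J) {..<n} (coframe J) (\<lambda>q v. v f)"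
proof -
  have "spanned X p {} {..<n} (\<lambda>j r v. v (z j)) (\<lambda>q v. v f)"
    using eventually_nbhd_self[OF coordinate_differentials_spanned[OF point coordinates] point] assms(2)
    by (rule bspec)
  then have "spanned X p (support D J) {..<n} (\<lambda>j r v. v (z j)) (\<lambda>q v. v f)"
    by (rule spanned_weaken) simp
  then show ?thesis
  proof (rule spanned_trans[OF _ _ point])
    fix j assume "j \<in> {..<n}"
    then have j: "j < n" by simp
    let ?S = "\<tau> ` {i \<in> J. p \<in> D i}"
    let ?d = "\<lambda>q. if j \<in> ?S then z j q else 1"
    have "?d \<in> germs X p"
      using coordinate_germs[OF j] germs_const[OF point] by (cases "j \<in> ?S") simp_all
    then have "spanned X p (support D J) {..<n} (coframe J) (\<lambda>q v. ?d q * coframe J j q v)"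
      using j by (intro spanned_scale spanned_generator point) auto
    then show "spanned X p (support D J) {..<n} (coframe J) (\<lambda>r v. v (z j))"
    proof (rule spanned_cong)
      show "agree X p (support D J) (\<lambda>q v. v (z j)) (\<lambda>q v. ?d q * coframe J j q v)"
        using eventually_coordinate_nonzero[OF assms(1)]
        by eventually_elim (auto simp: coframe_def log_coframe_def)
    qed
  qed
qed

text \<open>For a component through \<open>p\<close> the equation may be exchanged for the
  coordinate \<open>z (\<tau> i)\<close>, at the cost of a multiple of a regular differential. For a
  component that misses \<open>p\<close> the equation is a unit, so d\<sigma>/\<sigma> is itself a
  regular multiple of d\<sigma>.\<close>

lemma generator_spanned:
  assumes J: "J \<subseteq> I" and \<theta>: "\<theta> \<in> log_generator_germs X J D p"
  shows "spanned X p (support D J) {..<n} (coframe J) \<theta>"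
proof -
  from \<theta> consider (d) f where "\<theta> = (\<lambda>q v. v f)" "f \<in> germs X p"
    | (l) \<sigma> i where "\<theta> = (\<lambda>q v. v \<sigma> / \<sigma> q)" "i \<in> J" "equation_germ X (D i) p \<sigma>"
    unfolding log_generator_germs_def by blast
  then show ?thesis
  proof cases
    case d
    then show ?thesis using differential_spanned J by simp
  next
    case l
    have i: "i \<in> I" using l J by blast
    note g = equation_germ_germs[OF l(3)]
    show ?thesis
    proof (cases "p \<in> D i")
      case False
      then have "\<sigma> p \<noteq> 0"
        using eventually_nbhd_self[OF equation_germ_zero_iff[OF l(3) closed_component[OF i]] point] by blast
      then have "spanned X p (support D J) {..<n} (coframe J) (\<lambda>q v. inverse (\<sigma> q) * v \<sigma>)"
        by (intro spanned_scale differential_spanned germs_inverse J g point)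
      then show ?thesis unfolding l(1) by (simp add: divide_inverse mult.commute)
    next
      case True
      obtain u w where uw: "u \<in> germs X p" "w \<in> germs X p"
        "\<forall>\<^sub>F q in nbhd X p. q \<notin> D i \<longrightarrow>
          (\<forall>v\<in>tangent_space X q. v \<sigma> / \<sigma> q = v (z (\<tau> i)) / z (\<tau> i) q + w q * v u)"
        by (rule dlog_change_equation[OF l(3) coordinate_equation[OF i True] closed_component[OF i]])
      have "spanned X p (support D J) {..<n} (coframe J) (\<lambda>q v. coframe J (\<tau> i) q v + w q * v u)"
        using index[OF i True]
        by (intro spanned_add spanned_generator spanned_scale differential_spanned J uw point) auto
      then show ?thesis
      proof (rule spanned_cong)
        have "\<tau> i \<in> \<tau> ` {i \<in> J. p \<in> D i}" using l True by blast
        then have "coframe J (\<tau> i) q v = v (z (\<tau> i)) / z (\<tau> i) q" for q v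
          by (simp add: coframe_def log_coframe_def)
        with uw(3) show "agree X p (support D J) \<theta>
            (\<lambda>q v. coframe J (\<tau> i) q v + w q * v u)"
          unfolding l(1) by (elim eventually_mono) (use l(2) in simp)
      qed
    qed
  qed
qed

lemma product_spanned:
  assumes J: "J \<subseteq> I" and \<theta>: "\<And>l. l < m \<Longrightarrow> \<theta> l \<in> log_generator_germs X J D p"
  shows "spanned X p (support D J) (multisets_of_size {..<n} m) (form_monomial (coframe J))
    (\<lambda>q v. \<Prod>l<m. \<theta> l q v)"
  using \<theta>
proof (induction m)
  case 0
  have "form_monomial (coframe J) {#} = (\<lambda>q v. 1)" by (intro ext) (simp add: form_monomial_def)
  moreover have "spanned X p (support D J) (multisets_of_size {..<n} 0) (form_monomial (coframe J))
      (form_monomial (coframe J) {#})"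
    by (intro spanned_generator point) simp_all
  ultimately show ?case by simp
next
  case (Suc m)
  have "spanned X p (support D J) (multisets_of_size {..<n} (Suc m)) (form_monomial (coframe J))
    (\<lambda>q v. (\<Prod>l<m. \<theta> l q v) * \<theta> m q v)"
  proof (rule spanned_mult[OF Suc.IH generator_spanned[OF J] point])
    fix M j assume Mj: "M \<in> multisets_of_size {..<n} m" "j \<in> {..<n}"
    have "form_monomial (coframe J) (add_mset j M) =
        (\<lambda>q v. form_monomial (coframe J) M q v * coframe J j q v)"
      by (intro ext) (simp add: form_monomial_def)
    moreover have "add_mset j M \<in> multisets_of_size {..<n} (Suc m)"
      using Mj by (auto simp: multisets_of_size_def)
    then have "spanned X p (support D J) (multisets_of_size {..<n} (Suc m)) (form_monomial (coframe J))
        (form_monomial (coframe J) (add_mset j M))"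
      by (intro spanned_generator point) auto
    ultimately show "spanned X p (support D J) (multisets_of_size {..<n} (Suc m))
        (form_monomial (coframe J)) (\<lambda>q v. form_monomial (coframe J) M q v * coframe J j q v)" by simp
  qed (use Suc.prems in simp_all)
  then show ?case by simp
qed

text \<open>Together with uniqueness of the coefficients this reduces statements on forms of degree
  \<open>m\<close> to statements on finitely many regular functions.\<close>

lemma log_germ_spanned:
  assumes J: "J \<subseteq> I" and "log_germ X J D m p \<omega>"
  shows "spanned X p (support D J) (multisets_of_size {..<n} m) (form_monomial (coframe J)) \<omega>"
  using assms(2)
proof (rule log_germE)
  fix r :: nat and f \<theta>
  assume *: "\<And>j. j < r \<Longrightarrow> f j \<in> germs X p"
    "\<And>j l. j < r \<Longrightarrow> l < m \<Longrightarrow> \<theta> j l \<in> log_generator_germs X J D p"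
    "agree X p (support D J) \<omega>
        (\<lambda>q v. \<Sum>j<r. f j q * (\<Prod>l<m. \<theta> j l q v))"
  have "spanned X p (support D J) (multisets_of_size {..<n} m) (form_monomial (coframe J))
      (\<lambda>q v. \<Sum>j<r. f j q * (\<Prod>l<m. \<theta> j l q v))"
    by (intro spanned_sum spanned_scale product_spanned J point *(1,2)) simp_all
  then show ?thesis using *(3) by (rule spanned_cong)
qed

lemma log_germ_combination:
  assumes "J \<subseteq> I" "\<And>M. M \<in> \<M> \<Longrightarrow> a M \<in> germs X p" "\<M> \<subseteq> multisets_of_size {..<n} m"
  shows "log_germ X J D m p (\<lambda>q v. \<Sum>M\<in>\<M>. a M q * form_monomial (coframe J) M q v)"
proof (intro log_germ_sum log_germ_scale assms(2) point)
  fix M assume "M \<in> \<M>"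
  then have "set_mset M \<subseteq> {..<n}" "size M = m"
    using assms(3) by (auto simp: multisets_of_size_def)
  then show "log_germ X J D m p (form_monomial (coframe J) M)"
    using log_germ_monomial[OF assms(1)] by blast
qed

text \<open>Stated for complex numbers at each point \<open>q\<close>, so that it applies to the
  values of any coefficient functions. Tangent vectors at \<open>q\<close> can be found on which the
  coframe takes arbitrary values \<open>T j\<close>; the combination then becomes a polynomial
  function of \<open>T\<close> that vanishes everywhere, and its coefficients are 0.\<close>

lemma coefficients_unique:
  shows "\<forall>\<^sub>F q in nbhd X p. q \<notin> (support D I) \<longrightarrow> (\<forall>a.
    (\<forall>v\<in>tangent_space X q. (\<Sum>M\<in>multisets_of_size {..<n} m. a M * form_monomial (coframe I) M q v) = 0) \<longrightarrow>
    (\<forall>M\<in>multisets_of_size {..<n} m. a M = 0))"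
  using coordinate_differentials_spanned[OF point coordinates]
    eventually_coordinate_nonzero[OF order_refl] eventually_nbhd_variety[OF point]
proof eventually_elim
  case (elim q)
  show ?case
  proof (intro impI allI ballI)
    fix a M assume q: "q \<notin> (support D I)" and M: "M \<in> multisets_of_size {..<n} m"
      and a: "\<forall>v\<in>tangent_space X q. (\<Sum>M\<in>multisets_of_size {..<n} m. a M * form_monomial (coframe I) M q v) = 0"
    let ?S = "\<tau> ` {i \<in> I. p \<in> D i}"
    have nz: "z j q \<noteq> 0" if "j \<in> ?S" for j using elim(2) q that by blast
    show "a M = 0"
    proof (rule multiset_monomials_independent[OF finite_lessThan[of n] finite_multisets_of_size _ _ M])
      fix T :: "nat \<Rightarrow> complex"
      \<comment> \<open>For a coordinate with a pole, \<open>v (z j)\<close> is chosen with the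
        factor \<open>z j q\<close> that cancels the denominator of the coframe entry.\<close>
      have "\<exists>v\<in>tangent_space X q. \<forall>j<n. v (z j) = T j * (if j \<in> ?S then z j q else 1)"
        by (rule tangent_vector_exists[OF smooth_variety elim(3) dimension]) (use elim(1) in blast)
      then obtain v where v: "v \<in> tangent_space X q"
        "\<And>j. j < n \<Longrightarrow> v (z j) = T j * (if j \<in> ?S then z j q else 1)" by blast
      have e: "coframe I j q v = T j" if "j < n" for j
        using v(2)[OF that] nz by (auto simp: coframe_def log_coframe_def)
      have "(\<Prod>j\<in>#N. T j) = form_monomial (coframe I) N q v" if "N \<in> multisets_of_size {..<n} m" for N
      proof -
        have "image_mset T N = image_mset (\<lambda>j. coframe I j q v) N"
          using that e by (intro image_mset_cong) (auto simp: multisets_of_size_def)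
        then show ?thesis by (simp add: form_monomial_def)
      qed
      then have "(\<Sum>N\<in>multisets_of_size {..<n} m. a N * (\<Prod>j\<in>#N. T j)) =
          (\<Sum>N\<in>multisets_of_size {..<n} m. a N * form_monomial (coframe I) N q v)"
        by (intro sum.cong) simp_all
      also have "\<dots> = 0" using a v(1) by blast
      finally show "(\<Sum>N\<in>multisets_of_size {..<n} m. a N * (\<Prod>j\<in>#N. T j)) = 0" .
    qed (simp_all add: multisets_of_size_def)
  qed
qed

end

section \<open>Products of logarithmic forms\<close>

lemma log_germ_mult:
  assumes "log_germ X I D a p \<omega>" "log_germ X I D b p \<omega>'" "p \<in> X"
  shows "log_germ X I D (a + b) p (\<lambda>q v. \<omega> q v * \<omega>' q v)"
  using assms(2)
proof (rule log_germE)
  fix r :: nat and f \<theta>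
  assume *: "\<And>j. j < r \<Longrightarrow> f j \<in> germs X p"
    "\<And>j l. j < r \<Longrightarrow> l < b \<Longrightarrow> \<theta> j l \<in> log_generator_germs X I D p"
    "agree X p (support D I) \<omega>'
        (\<lambda>q v. \<Sum>j<r. f j q * (\<Prod>l<b. \<theta> j l q v))"
  have prod: "log_germ X I D (a + b') p (\<lambda>q v. \<omega> q v * (\<Prod>l<b'. \<theta> j l q v))" if "j < r" "b' \<le> b" for j b'
    using that(2)
  proof (induction b')
    case (Suc b')
    then have "log_germ X I D (Suc (a + b')) p (\<lambda>q v. \<theta> j b' q v * (\<omega> q v * (\<Prod>l<b'. \<theta> j l q v)))"
      by (intro log_germ_mult_generator *(2) that(1)) simp_all
    then show ?case by (simp add: mult_ac)
  qed (use assms(1) in simp)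
  have "log_germ X I D (a + b) p (\<lambda>q v. \<Sum>j<r. f j q * (\<omega> q v * (\<Prod>l<b. \<theta> j l q v)))"
    by (intro log_germ_sum log_germ_scale prod *(1) assms(3)) simp_all
  then show ?thesis
  proof (rule log_germ_cong)
    show "agree X p (support D I) (\<lambda>q v. \<omega> q v * \<omega>' q v)
        (\<lambda>q v. \<Sum>j<r. f j q * (\<omega> q v * (\<Prod>l<b. \<theta> j l q v)))"
      using *(3) by eventually_elim (simp add: sum_distrib_left mult_ac)
  qed
qed

lemma log_germ_power:
  assumes "log_germ X I D 1 p \<omega>" "p \<in> X"
  shows "log_germ X I D k p (\<lambda>q v. \<omega> q v ^ k)"
proof (induction k)
  case 0
  then show ?case using log_germ_function[OF germs_const[OF assms(2)], of I D 1] by simp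
next
  case (Suc k)
  from log_germ_mult[OF assms(1) this assms(2)] show ?case by simp
qed

lemma log_germ_differential:
  assumes "f \<in> germs X p" "p \<in> X"
  shows "log_germ X I D 1 p (\<lambda>q v. v f)"
  using log_germ_mult_generator[OF log_germ_function[OF germs_const[OF assms(2), of 1]]
      log_generator_germs_differential[OF assms(1)]] by simp

context snc_coordinates
begin

section \<open>The coframes with and without the pole along \<open>D c\<close>\<close>

lemma coframe_compare:
  assumes p: "p \<in> D c"
  shows "\<forall>\<^sub>F q in nbhd X p. q \<notin> (support D I) \<longrightarrow> z (\<tau> c) q \<noteq> 0 \<and>
    (\<forall>v j. coframe (I - {c}) j q v = (if j = \<tau> c then z (\<tau> c) q else 1) * coframe I j q v)"
  using eventually_coordinate_nonzero[OF order_refl]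
proof eventually_elim
  case (elim q)
  let ?S = "\<tau> ` {i \<in> I. p \<in> D i}"
  have c: "\<tau> c \<in> ?S" using p component by blast
  \<comment> \<open>Injectivity of \<open>\<tau>\<close> prevents another component through
    \<open>p\<close> from using the coordinate of \<open>D c\<close>. So leaving out
    \<open>c\<close> changes exactly one entry of the coframe.\<close>
  have S': "\<tau> ` {i \<in> I - {c}. p \<in> D i} = ?S - {\<tau> c}"
    using inj_index p component by (auto simp: inj_on_def)
  show ?case
  proof (intro impI conjI allI)
    assume "q \<notin> (support D I)"
    then show nz: "z (\<tau> c) q \<noteq> 0" using elim c by blast
    show "coframe (I - {c}) j q v = (if j = \<tau> c then z (\<tau> c) q else 1) * coframe I j q v" for v j
      unfolding coframe_def log_coframe_def S' using c nz by simp
  qed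
qed

lemma coframe_component:
  assumes "p \<in> D c"
  shows "coframe (I - {c}) (\<tau> c) q v = v (z (\<tau> c))"
proof -
  have "\<tau> c \<notin> \<tau> ` {i \<in> I - {c}. p \<in> D i}"
    using inj_index assms component by (auto simp: inj_on_def)
  then show ?thesis by (simp add: coframe_def log_coframe_def)
qed

lemma form_monomial_compare:
  assumes "\<And>j. e' j q v = (if j = j0 then s else 1) * e j q v"
  shows "form_monomial e' M q v = s ^ count M j0 * form_monomial e M q v"
  using assms by (induction M) (simp_all add: form_monomial_def)

text \<open>Corresponding monomials of the two coframes differ by powers of
  \<open>z (\<tau> c) q\<close>. These are nonzero off the divisor, so uniqueness carries
  over.\<close>

lemma coefficients_unique_component:
  assumes p: "p \<in> D c"
  shows "\<forall>\<^sub>F q in nbhd X p. q \<notin> (support D I) \<longrightarrow> (\<forall>a.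
    (\<forall>v\<in>tangent_space X q. (\<Sum>M\<in>multisets_of_size {..<n} m. a M * form_monomial (coframe (I - {c})) M q v) = 0) \<longrightarrow>
    (\<forall>M\<in>multisets_of_size {..<n} m. a M = 0))"
  using coefficients_unique[of m] coframe_compare[OF p]
proof eventually_elim
  case (elim q)
  show ?case
  proof (intro impI allI)
    fix a assume q: "q \<notin> (support D I)"
      and a: "\<forall>v\<in>tangent_space X q. (\<Sum>M\<in>multisets_of_size {..<n} m. a M * form_monomial (coframe (I - {c})) M q v) = 0"
    let ?s = "z (\<tau> c) q"
    have s: "?s \<noteq> 0" and e: "\<And>v j. coframe (I - {c}) j q v = (if j = \<tau> c then ?s else 1) * coframe I j q v"
      using elim(2) q by blast+
    have compare: "form_monomial (coframe (I - {c})) M q v =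
        ?s ^ count M (\<tau> c) * form_monomial (coframe I) M q v" for M v
      by (rule form_monomial_compare) (rule e)
    have "\<forall>v\<in>tangent_space X q. (\<Sum>M\<in>multisets_of_size {..<n} m.
        (a M * ?s ^ count M (\<tau> c)) * form_monomial (coframe I) M q v) = 0"
      using a unfolding compare mult.assoc .
    then have "\<forall>M\<in>multisets_of_size {..<n} m. a M * ?s ^ count M (\<tau> c) = 0"
      using elim(1)[rule_format, OF q, where a = "\<lambda>M. a M * ?s ^ count M (\<tau> c)"] by blast
    then show "\<forall>M\<in>multisets_of_size {..<n} m. a M = 0" using s by simp
  qed
qed

lemma multiset_minus_power:
  assumes "M \<in> multisets_of_size {..<n} m" "k \<le> count M j"
  shows "M - replicate_mset k j \<in> multisets_of_size {..<n} (m - k)"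
    "form_monomial e M q v = e j q v ^ k * form_monomial e (M - replicate_mset k j) q v"
proof -
  have M: "M = M - replicate_mset k j + replicate_mset k j"
    using assms(2) by (simp add: count_le_replicate_mset_subset_eq)
  have "size M = size (M - replicate_mset k j) + k" by (subst M) simp
  then show "M - replicate_mset k j \<in> multisets_of_size {..<n} (m - k)"
    using assms(1) by (auto simp: multisets_of_size_def dest: in_diffD)
  have "form_monomial e (N + replicate_mset k j) q v = e j q v ^ k * form_monomial e N q v" for N
    by (simp add: form_monomial_def)
  from this[of "M - replicate_mset k j"] show "form_monomial e M q v = e j q v ^ k * form_monomial e (M - replicate_mset k j) q v"
    unfolding M[symmetric] .
qed

text \<open>Let \<sigma> be the coordinate of \<open>D c\<close>, let f_M be the coefficients of
  \<omega> in the coframe for \<open>I\<close> and g_M those of \<eta> = \<sigma>^k \<omega> in the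
  coframe for \<open>I - {c}\<close>. Uniqueness gives \<sigma>^k f_M = \<sigma>^i g_M, where i is
  the exponent of the entry of \<open>D c\<close> in M. For i \<ge> k the monomial contains
  (d\<sigma>)^k, and the cofactors make up \<epsilon>. For i < k the relation shows that g_M is
  divisible by \<sigma>, which lowers the pole order of the remaining part by one.\<close>

lemma leading_coefficient_exists:
  assumes p: "p \<in> D c" and k: "1 \<le> k" "k \<le> m"
    and \<omega>: "log_germ X I D m p \<omega>" and \<eta>: "log_germ X (I - {c}) D m p \<eta>"
    and eq: "agree X p (support D I) \<eta> (\<lambda>q v. z (\<tau> c) q ^ k * \<omega> q v)"
  obtains \<epsilon> \<zeta> where "log_germ X (I - {c}) D (m - k) p \<epsilon>" "log_germ X (I - {c}) D m p \<zeta>"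
    "agree X p (support D I) \<zeta>
        (\<lambda>q v. z (\<tau> c) q ^ (k - 1) * (\<omega> q v - (v (z (\<tau> c)) / z (\<tau> c) q) ^ k * \<epsilon> q v))"
proof -
  let ?\<M> = "multisets_of_size {..<n} m" and ?j = "\<tau> c" and ?I' = "I - {c}"
  let ?s = "z ?j" and ?e = "coframe I" and ?e' = "coframe ?I'"
  have fin: "finite ?\<M>" by auto
  have zg: "?s \<in> germs X p" using coordinate_germs index[OF component p] by blast
  obtain f where f: "\<And>M. M \<in> ?\<M> \<Longrightarrow> f M \<in> germs X p"
    "agree X p (support D I) \<omega>
        (\<lambda>q v. \<Sum>M\<in>?\<M>. f M q * form_monomial ?e M q v)"
    using spannedE[OF log_germ_spanned[OF order_refl \<omega>]] by blast
  obtain g where g: "\<And>M. M \<in> ?\<M> \<Longrightarrow> g M \<in> germs X p"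
    "agree X p (support D ?I') \<eta>
        (\<lambda>q v. \<Sum>M\<in>?\<M>. g M q * form_monomial ?e' M q v)"
    using spannedE[OF log_germ_spanned[OF Diff_subset \<eta>]] by blast
  define H where "H = {M \<in> ?\<M>. k \<le> count M ?j}"
  define L where "L = {M \<in> ?\<M>. \<not> k \<le> count M ?j}"
  have split: "sum h ?\<M> = sum h H + sum h L" for h :: "_ \<Rightarrow> complex"
    unfolding H_def L_def using fin by (rule sum.Int_Diff[of _ _ "{M. k \<le> count M ?j}", unfolded Int_def set_diff_eq mem_Collect_eq])
  \<comment> \<open>The coefficients are those of \<eta>, so that \<epsilon> has no pole along
    \<open>D c\<close>; the \<open>k\<close> removed copies of the index of \<open>D c\<close>
    account for the factor (d\<sigma>)^k.\<close>
  define \<epsilon> where "\<epsilon> = (\<lambda>q v. \<Sum>M\<in>H. g M q * form_monomial ?e' (M - replicate_mset k ?j) q v)"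
  \<comment> \<open>The part of \<eta> with exponent below \<open>k\<close>, divided by \<sigma>.
    The subtraction of natural numbers is exact, as \<open>count M ?j < k\<close> for
    \<open>M\<close> in \<open>L\<close>.\<close>
  define \<zeta> where "\<zeta> = (\<lambda>q v. \<Sum>M\<in>L. (?s q ^ (k - 1 - count M ?j) * f M q) * form_monomial ?e' M q v)"
  have "log_germ X ?I' D (m - k) p \<epsilon>"
    unfolding \<epsilon>_def
  proof (intro log_germ_sum log_germ_scale point)
    fix M assume "M \<in> H"
    then have "M \<in> ?\<M>" "k \<le> count M ?j" by (auto simp: H_def)
    then have "M - replicate_mset k ?j \<in> multisets_of_size {..<n} (m - k)"
      by (rule multiset_minus_power)
    then show "log_germ X ?I' D (m - k) p (form_monomial ?e' (M - replicate_mset k ?j))"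
      using log_germ_monomial[OF Diff_subset, of "M - replicate_mset k ?j" "{c}"]
      by (simp add: multisets_of_size_def)
    show "g M \<in> germs X p" using g(1) \<open>M \<in> ?\<M>\<close> .
  qed
  moreover have "log_germ X ?I' D m p \<zeta>"
    unfolding \<zeta>_def
    by (rule log_germ_combination) (auto simp: L_def intro!: germs_mult germs_power zg point f(1))
  moreover have "agree X p (support D I) \<zeta>
      (\<lambda>q v. ?s q ^ (k - 1) * (\<omega> q v - (v ?s / ?s q) ^ k * \<epsilon> q v))"
    using f(2) g(2) eq coefficients_unique[of m] coframe_compare[OF p]
  proof eventually_elim
    case (elim q)
    show ?case
    proof (intro impI ballI)
      fix v assume q: "q \<notin> (support D I)" and v: "v \<in> tangent_space X q"
      have s: "?s q \<noteq> 0"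
        and e: "\<And>v j. ?e' j q v = (if j = ?j then ?s q else 1) * ?e j q v"
        using elim(5) q by blast+
      have compare: "form_monomial ?e' M q v = ?s q ^ count M ?j * form_monomial ?e M q v" for M v
        by (rule form_monomial_compare) (rule e)
      have q': "q \<notin> (support D ?I')" using q by blast
      have "\<forall>v\<in>tangent_space X q. (\<Sum>M\<in>?\<M>.
          (?s q ^ k * f M q - ?s q ^ count M ?j * g M q) * form_monomial ?e M q v) = 0"
      proof
        fix v assume v: "v \<in> tangent_space X q"
        have "(\<Sum>M\<in>?\<M>. (?s q ^ k * f M q - ?s q ^ count M ?j * g M q) * form_monomial ?e M q v) =
          ?s q ^ k * (\<Sum>M\<in>?\<M>. f M q * form_monomial ?e M q v) - (\<Sum>M\<in>?\<M>. g M q * form_monomial ?e' M q v)"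
          unfolding compare sum_distrib_left sum_subtractf[symmetric]
          by (intro sum.cong refl) (simp add: algebra_simps)
        also have "\<dots> = ?s q ^ k * \<omega> q v - \<eta> q v" using elim(1,2) q q' v by simp
        also have "\<dots> = 0" using elim(3) q v by simp
        finally show "(\<Sum>M\<in>?\<M>. (?s q ^ k * f M q - ?s q ^ count M ?j * g M q) * form_monomial ?e M q v) = 0" .
      qed
      then have "\<forall>M\<in>?\<M>. ?s q ^ k * f M q - ?s q ^ count M ?j * g M q = 0"
        using elim(4)[rule_format, OF q, where a = "\<lambda>M. ?s q ^ k * f M q - ?s q ^ count M ?j * g M q"] by blast
      then have fg: "?s q ^ k * f M q = ?s q ^ count M ?j * g M q" if "M \<in> ?\<M>" for M
        using that by simp
      have low: "?s q * (?s q ^ (k - 1 - count M ?j) * f M q) = g M q" if "M \<in> L" for M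
      proof -
        have M: "M \<in> ?\<M>" "count M ?j < k" using that by (auto simp: L_def)
        have "?s q ^ count M ?j * (?s q * (?s q ^ (k - 1 - count M ?j) * f M q)) =
            ?s q ^ (count M ?j + Suc (k - 1 - count M ?j)) * f M q"
          by (simp add: power_add mult_ac)
        also have "count M ?j + Suc (k - 1 - count M ?j) = k" using M by simp
        finally show ?thesis using fg[OF M(1)] s by simp
      qed
      have "?s q * \<zeta> q v = (\<Sum>M\<in>L. g M q * form_monomial ?e' M q v)"
        unfolding \<zeta>_def sum_distrib_left
        by (intro sum.cong refl) (simp add: low[symmetric] mult.assoc)
      also have "\<dots> = \<eta> q v - (\<Sum>M\<in>H. g M q * form_monomial ?e' M q v)"
        using elim(2) q' v split[of "\<lambda>M. g M q * form_monomial ?e' M q v"] by simp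
      also have "(\<Sum>M\<in>H. g M q * form_monomial ?e' M q v) = v ?s ^ k * \<epsilon> q v"
        unfolding \<epsilon>_def sum_distrib_left
      proof (intro sum.cong refl)
        fix M assume "M \<in> H"
        then have "M \<in> ?\<M>" "k \<le> count M ?j" by (auto simp: H_def)
        note * = multiset_minus_power(2)[OF this, of ?e' q v, unfolded coframe_component[OF p]]
        show "g M q * form_monomial ?e' M q v =
            v ?s ^ k * (g M q * form_monomial ?e' (M - replicate_mset k ?j) q v)"
          unfolding * by (rule mult.left_commute)
      qed
      also have "\<eta> q v = ?s q ^ k * \<omega> q v" using elim(3) q v by blast
      also have "?s q ^ k * \<omega> q v - v ?s ^ k * \<epsilon> q v =
          ?s q * (?s q ^ (k - 1) * (\<omega> q v - (v ?s / ?s q) ^ k * \<epsilon> q v))"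
      proof -
        have 1: "?s q * ?s q ^ (k - 1) = ?s q ^ k"
          using k(1) by (cases k) simp_all
        have 2: "?s q ^ k * (v ?s / ?s q) ^ k = v ?s ^ k" using s by (simp add: power_divide)
        have "?s q * (?s q ^ (k - 1) * (\<omega> q v - (v ?s / ?s q) ^ k * \<epsilon> q v)) =
            ?s q * ?s q ^ (k - 1) * \<omega> q v - ?s q * ?s q ^ (k - 1) * (v ?s / ?s q) ^ k * \<epsilon> q v"
          by (simp only: right_diff_distrib mult.assoc)
        then show ?thesis unfolding 1 2 by (rule sym)
      qed
      finally show "\<zeta> q v = ?s q ^ (k - 1) * (\<omega> q v - (v ?s / ?s q) ^ k * \<epsilon> q v)"
        using s by simp
    qed
  qed
  ultimately show thesis using that by blast
qed

text \<open>Uniqueness in degree \<open>m\<close>, applied to \<sigma> \<zeta> = (d\<sigma>)^k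
  \<epsilon>, makes each coefficient of \<epsilon> equal to \<sigma> times a coefficient of \<zeta>.
  This is known off the divisor, and density extends it to \<open>D c\<close>, where divisibility by
  \<sigma> has content.\<close>

lemma leading_coefficient_divisible:
  assumes p: "p \<in> D c" and k: "k \<le> m"
    and \<epsilon>: "log_germ X (I - {c}) D (m - k) p \<epsilon>" and \<zeta>: "log_germ X (I - {c}) D m p \<zeta>"
    and eq: "agree X p (support D I) (\<lambda>q v. z (\<tau> c) q * \<zeta> q v)
        (\<lambda>q v. v (z (\<tau> c)) ^ k * \<epsilon> q v)"
  obtains e where "log_germ X (I - {c}) D (m - k) p e"
    "agree X p (support D (I - {c})) \<epsilon> (\<lambda>q v. z (\<tau> c) q * e q v)"
proof -
  let ?\<M> = "multisets_of_size {..<n} m" and ?\<N> = "multisets_of_size {..<n} (m - k)"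
  let ?j = "\<tau> c" and ?I' = "I - {c}"
  let ?s = "z ?j" and ?e = "coframe ?I'" and ?R = "replicate_mset k (\<tau> c)"
  have fin: "finite ?\<M>" "finite ?\<N>" by auto
  have j: "?j < n" using index[OF component p] .
  have zg: "?s \<in> germs X p" using coordinate_germs j by blast
  obtain a where a: "\<And>N. N \<in> ?\<N> \<Longrightarrow> a N \<in> germs X p"
    "agree X p (support D ?I') \<epsilon>
        (\<lambda>q v. \<Sum>N\<in>?\<N>. a N q * form_monomial ?e N q v)"
    using spannedE[OF log_germ_spanned[OF Diff_subset \<epsilon>]] by blast
  obtain b where b: "\<And>M. M \<in> ?\<M> \<Longrightarrow> b M \<in> germs X p"
    "agree X p (support D ?I') \<zeta>
        (\<lambda>q v. \<Sum>M\<in>?\<M>. b M q * form_monomial ?e M q v)"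
    using spannedE[OF log_germ_spanned[OF Diff_subset \<zeta>]] by blast
  have shift: "N + ?R \<in> ?\<M>" if "N \<in> ?\<N>" for N
    using that j k by (auto simp: multisets_of_size_def)
  have "\<forall>\<^sub>F q in nbhd X p. q \<notin> (support D I) \<longrightarrow> (\<forall>N\<in>?\<N>. a N q - ?s q * b (N + ?R) q = 0)"
    using a(2) b(2) eq coefficients_unique_component[OF p, of m]
  proof eventually_elim
    case (elim q)
    show ?case
    proof (intro impI ballI)
      fix N assume q: "q \<notin> (support D I)" and N: "N \<in> ?\<N>"
      have q': "q \<notin> (support D ?I')" using q by blast
      \<comment> \<open>The coefficient of the monomial \<open>M\<close> in (d\<sigma>)^k \<epsilon>
        - \<sigma> \<zeta>. A monomial with fewer than \<open>k\<close> factors d\<sigma> does not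
        occur in the first term.\<close>
      define h where "h M = (if k \<le> count M ?j then a (M - ?R) q else 0) - ?s q * b M q" for M
      have "\<forall>v\<in>tangent_space X q. (\<Sum>M\<in>?\<M>. h M * form_monomial ?e M q v) = 0"
      proof
        fix v assume v: "v \<in> tangent_space X q"
        have "(\<Sum>M\<in>?\<M>. (if k \<le> count M ?j then a (M - ?R) q else 0) * form_monomial ?e M q v) =
            (\<Sum>M\<in>{M \<in> ?\<M>. k \<le> count M ?j}. a (M - ?R) q * form_monomial ?e M q v)"
          using fin by (intro sum.mono_neutral_cong_right) auto
        also have "\<dots> = (\<Sum>N\<in>?\<N>. v ?s ^ k * (a N q * form_monomial ?e N q v))"
        proof (rule sum.reindex_bij_witness[of _ "\<lambda>N. N + ?R" "\<lambda>M. M - ?R"])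
          fix M assume "M \<in> {M \<in> ?\<M>. k \<le> count M ?j}"
          then have M: "M \<in> ?\<M>" "k \<le> count M ?j" by auto
          show "M - ?R + ?R = M" using M(2) by (simp add: count_le_replicate_mset_subset_eq)
          show "M - ?R \<in> ?\<N>" using multiset_minus_power(1)[OF M] .
          show "v ?s ^ k * (a (M - ?R) q * form_monomial ?e (M - ?R) q v) =
              a (M - ?R) q * form_monomial ?e M q v"
            using multiset_minus_power(2)[OF M, of ?e q v] by (simp add: coframe_component[OF p])
        next
          fix N assume "N \<in> ?\<N>"
          then show "N + ?R \<in> {M \<in> ?\<M>. k \<le> count M ?j}" using shift by simp
        qed simp
        also have "\<dots> = v ?s ^ k * \<epsilon> q v" using elim(1) q' v by (simp add: sum_distrib_left)
        also have "\<dots> = ?s q * \<zeta> q v" using elim(3) q v by simp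
        also have "\<dots> = (\<Sum>M\<in>?\<M>. ?s q * b M q * form_monomial ?e M q v)"
          using elim(2) q' v by (simp add: sum_distrib_left mult.assoc)
        finally show "(\<Sum>M\<in>?\<M>. h M * form_monomial ?e M q v) = 0"
          unfolding h_def left_diff_distrib sum_subtractf by simp
      qed
      then have "\<forall>M\<in>?\<M>. h M = 0" using elim(4)[rule_format, OF q, where a = h] by blast
      then have "h (N + ?R) = 0" using shift[OF N] by blast
      then show "a N q - ?s q * b (N + ?R) q = 0" by (simp add: h_def)
    qed
  qed
  then have "\<forall>\<^sub>F q in nbhd X p. a N q - ?s q * b (N + ?R) q = 0" if "N \<in> ?\<N>" for N
    using that
    by (intro germ_zero_dense germs_diff germs_mult a(1) b(1) zg shift point)
       (auto elim: eventually_mono)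
  then have ab: "\<forall>\<^sub>F q in nbhd X p. \<forall>N\<in>?\<N>. a N q - ?s q * b (N + ?R) q = 0"
    using fin by (intro eventually_ball_finite) auto
  define e where "e = (\<lambda>q v. \<Sum>N\<in>?\<N>. b (N + ?R) q * form_monomial ?e N q v)"
  have "log_germ X ?I' D (m - k) p e"
    unfolding e_def by (rule log_germ_combination) (auto intro: b(1) shift)
  moreover have "agree X p (support D ?I') \<epsilon> (\<lambda>q v. ?s q * e q v)"
    using ab a(2) by eventually_elim (simp add: e_def sum_distrib_left mult.assoc)
  ultimately show thesis using that by blast
qed

end

section \<open>Pole order and residues\<close>

context snc_pair
begin

text \<open>One equation of \<open>D c\<close> is enough for germs, whereas
  \<open>pole_forms\<close> quantifies over all of them. The gap is bridged by
  \<open>pole_germE\<close>: another equation is a regular multiple of the first, and the power of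
  the factor is absorbed in \<eta>.\<close>

definition pole_germ :: "nat \<Rightarrow> nat \<Rightarrow> 'n proj \<Rightarrow> 'n form \<Rightarrow> bool" where
  "pole_germ m k p \<omega> \<longleftrightarrow> log_germ X I D m p \<omega> \<and>
    (\<exists>\<sigma> \<eta>. equation_germ X (D c) p \<sigma> \<and> log_germ X (I - {c}) D m p \<eta> \<and>
      (agree X p (support D I) \<eta> (\<lambda>q v. \<sigma> q ^ k * \<omega> q v)))"

lemma pole_germI:
  assumes "log_germ X I D m p \<omega>" "equation_germ X (D c) p \<sigma>" "log_germ X (I - {c}) D m p \<eta>"
    and "agree X p (support D I) \<eta> (\<lambda>q v. \<sigma> q ^ k * \<omega> q v)"
  shows "pole_germ m k p \<omega>"
  using assms unfolding pole_germ_def by blast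

lemma pole_germ_log_germ: "pole_germ m k p \<omega> \<Longrightarrow> log_germ X I D m p \<omega>"
  by (simp add: pole_germ_def)

lemma pole_germE:
  assumes "pole_germ m k p \<omega>" "equation_germ X (D c) p \<sigma>"
  obtains \<eta> where "log_germ X (I - {c}) D m p \<eta>"
    "agree X p (support D I) \<eta> (\<lambda>q v. \<sigma> q ^ k * \<omega> q v)"
proof -
  have p: "p \<in> X" using equation_germ_variety assms(2) .
  obtain \<sigma>' \<eta> where *: "equation_germ X (D c) p \<sigma>'" "log_germ X (I - {c}) D m p \<eta>"
    "agree X p (support D I) \<eta> (\<lambda>q v. \<sigma>' q ^ k * \<omega> q v)"
    using assms(1) unfolding pole_germ_def by (elim conjE exE)
  obtain u w where u: "u \<in> germs X p" "\<forall>\<^sub>F q in nbhd X p. \<sigma> q = \<sigma>' q * u q"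
    by (rule dlog_change_equation[OF assms(2) *(1) closed_component[OF component]])
  have "log_germ X (I - {c}) D m p (\<lambda>q v. u q ^ k * \<eta> q v)"
    by (intro log_germ_scale germs_power *(2) u(1) p)
  moreover have "agree X p (support D I) (\<lambda>q v. u q ^ k * \<eta> q v)
      (\<lambda>q v. \<sigma> q ^ k * \<omega> q v)"
    using *(3) u(2) by eventually_elim (simp add: power_mult_distrib mult_ac)
  ultimately show thesis using that by blast
qed

lemma pole_germ_cong:
  assumes "pole_germ m k p \<omega>"
    and eq: "agree X p (support D I) \<omega>' \<omega>"
  shows "pole_germ m k p \<omega>'"
proof -
  obtain \<sigma> \<eta> where *: "equation_germ X (D c) p \<sigma>" "log_germ X (I - {c}) D m p \<eta>"
    "agree X p (support D I) \<eta> (\<lambda>q v. \<sigma> q ^ k * \<omega> q v)"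
    using assms(1) unfolding pole_germ_def by (elim conjE exE)
  have "agree X p (support D I) \<eta> (\<lambda>q v. \<sigma> q ^ k * \<omega>' q v)"
    using *(3) eq by eventually_elim simp
  then show ?thesis
    by (rule pole_germI[OF log_germ_cong[OF pole_germ_log_germ[OF assms(1)] eq] *(1,2)])
qed

lemma pole_germ_add:
  assumes "pole_germ m k p \<omega>" "pole_germ m k p \<omega>'"
  shows "pole_germ m k p (\<lambda>q v. \<omega> q v + \<omega>' q v)"
proof -
  obtain \<sigma> \<eta> where *: "equation_germ X (D c) p \<sigma>" "log_germ X (I - {c}) D m p \<eta>"
    "agree X p (support D I) \<eta> (\<lambda>q v. \<sigma> q ^ k * \<omega> q v)"
    using assms(1) unfolding pole_germ_def by (elim conjE exE)
  obtain \<eta>' where \<eta>': "log_germ X (I - {c}) D m p \<eta>'"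
    "agree X p (support D I) \<eta>' (\<lambda>q v. \<sigma> q ^ k * \<omega>' q v)"
    by (rule pole_germE[OF assms(2) *(1)])
  show ?thesis
  proof (rule pole_germI[OF _ *(1) log_germ_add[OF *(2) \<eta>'(1)]])
    show "log_germ X I D m p (\<lambda>q v. \<omega> q v + \<omega>' q v)"
      by (intro log_germ_add pole_germ_log_germ[OF assms(1)] pole_germ_log_germ[OF assms(2)])
    show "agree X p (support D I) (\<lambda>q v. \<eta> q v + \<eta>' q v)
        (\<lambda>q v. \<sigma> q ^ k * (\<omega> q v + \<omega>' q v))"
      using *(3) \<eta>'(2) by eventually_elim (simp add: distrib_left)
  qed
qed

lemma pole_germ_scale:
  assumes "pole_germ m k p \<omega>" "g \<in> germs X p" "p \<in> X"
  shows "pole_germ m k p (\<lambda>q v. g q * \<omega> q v)"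
proof -
  obtain \<sigma> \<eta> where *: "equation_germ X (D c) p \<sigma>" "log_germ X (I - {c}) D m p \<eta>"
    "agree X p (support D I) \<eta> (\<lambda>q v. \<sigma> q ^ k * \<omega> q v)"
    using assms(1) unfolding pole_germ_def by (elim conjE exE)
  show ?thesis
  proof (rule pole_germI[OF log_germ_scale[OF pole_germ_log_germ[OF assms(1)] assms(2,3)] *(1)
        log_germ_scale[OF *(2) assms(2,3)]])
    show "agree X p (support D I) (\<lambda>q v. g q * \<eta> q v)
        (\<lambda>q v. \<sigma> q ^ k * (g q * \<omega> q v))"
      using *(3) by eventually_elim (simp add: mult_ac)
  qed
qed

lemma pole_germ_eventually:
  assumes "pole_germ m k p \<omega>" "p \<in> X"
  shows "\<forall>\<^sub>F q in nbhd X p. pole_germ m k q \<omega>"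
proof -
  obtain \<sigma> \<eta> where *: "equation_germ X (D c) p \<sigma>" "log_germ X (I - {c}) D m p \<eta>"
    "agree X p (support D I) \<eta> (\<lambda>q v. \<sigma> q ^ k * \<omega> q v)"
    using assms(1) unfolding pole_germ_def by (elim conjE exE)
  show ?thesis
    using equation_germ_eventually[OF *(1)] log_germ_eventually[OF *(2) assms(2)]
      eventually_eventually_nbhd[OF *(3) assms(2)]
      log_germ_eventually[OF pole_germ_log_germ[OF assms(1)] assms(2)]
    by eventually_elim (rule pole_germI)
qed

lemma pole_germ_zero:
  assumes "p \<in> X"
  shows "pole_germ m k p (\<lambda>q v. 0)"
proof -
  obtain \<sigma> where "equation_germ X (D c) p \<sigma>" using equation_exists[OF assms] by blast
  then show ?thesis by (rule pole_germI[OF log_germ_zero _ log_germ_zero]) simp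
qed

lemma eventually_equation_nonzero:
  assumes "equation_germ X (D c) p \<sigma>"
  shows "\<forall>\<^sub>F q in nbhd X p. q \<notin> (support D I) \<longrightarrow> \<sigma> q \<noteq> 0"
  using equation_germ_zero_iff[OF assms closed_component[OF component]]
  by eventually_elim (use component in blast)

lemma equation_nonzero:
  assumes "equation_germ X (D c) p \<sigma>" "p \<notin> D c"
  shows "\<sigma> p \<noteq> 0"
  using eventually_nbhd_self[OF equation_germ_zero_iff[OF assms(1) closed_component[OF component]]
      equation_germ_variety[OF assms(1)]] assms(2) by blast

lemma log_germ_dlog_power:
  assumes "equation_germ X (D c) p \<sigma>" "log_germ X (I - {c}) D (m - k) p \<epsilon>" "k \<le> m"
  shows "log_germ X I D m p (\<lambda>q v. (v \<sigma> / \<sigma> q) ^ k * \<epsilon> q v)"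
  using log_germ_mult_generator_power[OF log_germ_mono[OF assms(2) Diff_subset]
      log_generator_germs_dlog[where D = D, OF component assms(1)], of k] assms(3) by simp

lemma log_germ_differential_power:
  assumes "f \<in> germs X p" "log_germ X J D (m - k) p \<epsilon>" "k \<le> m"
  shows "log_germ X J D m p (\<lambda>q v. v f ^ k * \<epsilon> q v)"
  using log_germ_mult_generator_power[OF assms(2) log_generator_germs_differential[OF assms(1)], of k]
    assms(3) by simp

text \<open>Multiplication by \<sigma>^k leaves (d\<sigma>)^k \<epsilon>, which has no pole along
  \<open>D c\<close>. Every \<epsilon> is therefore the leading coefficient of some form, whence
  surjectivity of the residue.\<close>

lemma pole_germ_dlog_power:
  assumes \<sigma>: "equation_germ X (D c) p \<sigma>" and \<epsilon>: "log_germ X (I - {c}) D (m - k) p \<epsilon>" and "k \<le> m"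
  shows "pole_germ m k p (\<lambda>q v. (v \<sigma> / \<sigma> q) ^ k * \<epsilon> q v)"
proof (rule pole_germI[OF log_germ_dlog_power[OF assms] \<sigma>
      log_germ_differential_power[OF equation_germ_germs[OF \<sigma>] \<epsilon> assms(3)]])
  show "agree X p (support D I) (\<lambda>q v. v \<sigma> ^ k * \<epsilon> q v)
      (\<lambda>q v. \<sigma> q ^ k * ((v \<sigma> / \<sigma> q) ^ k * \<epsilon> q v))"
    using eventually_equation_nonzero[OF \<sigma>] by eventually_elim (simp add: power_divide)
qed

text \<open>Put A = d\<sigma>/\<sigma> and B = d\<sigma>'/\<sigma>'. Then A^k - B^k is A - B times
  the sum of the products B^(k-1-i) A^i, and A - B = w du has no pole. Each product has k - 1
  factors, so multiplication by \<sigma>'^(k-1) clears all poles along \<open>D c\<close>.\<close>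

lemma dlog_power_change:
  assumes \<sigma>: "equation_germ X (D c) p \<sigma>" and \<sigma>': "equation_germ X (D c) p \<sigma>'"
    and \<epsilon>: "log_germ X (I - {c}) D (m - k) p \<epsilon>" and k: "1 \<le> k" "k \<le> m"
  shows "pole_germ m (k - 1) p (\<lambda>q v. (v \<sigma> / \<sigma> q) ^ k * \<epsilon> q v - (v \<sigma>' / \<sigma>' q) ^ k * \<epsilon> q v)"
proof -
  have p: "p \<in> X" using \<sigma> by (rule equation_germ_variety)
  obtain u w where uw: "u \<in> germs X p" "w \<in> germs X p"
    "agree X p (D c) (\<lambda>q v. v \<sigma> / \<sigma> q)
        (\<lambda>q v. v \<sigma>' / \<sigma>' q + w q * v u)"
    by (rule dlog_change_equation[OF \<sigma> \<sigma>' closed_component[OF component]])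
  note s = equation_germ_germs[OF \<sigma>']
  \<comment> \<open>This is \<sigma>' A, written in a way that shows it to be free of poles also on
    \<open>D c\<close>.\<close>
  define P where "P = (\<lambda>q v. v \<sigma>' + \<sigma>' q * (w q * v u))"
  have P: "log_germ X (I - {c}) D 1 p P"
    unfolding P_def by (intro log_germ_add log_germ_scale log_germ_differential s uw p)
  have 1: "log_germ X (I - {c}) D 1 p (\<lambda>q v. w q * v u)"
    by (intro log_germ_scale log_germ_differential uw p)
  have "log_germ X (I - {c}) D (1 + ((k - Suc i) + (i + (m - k)))) p
      (\<lambda>q v. (w q * v u) * (v \<sigma>' ^ (k - Suc i) * (P q v ^ i * \<epsilon> q v)))" if "i < k" for i
    by (intro log_germ_mult 1 log_germ_power log_germ_differential s P \<epsilon> p)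
  moreover have "1 + ((k - Suc i) + (i + (m - k))) = m" if "i < k" for i
    using k that by simp
  ultimately have \<eta>: "log_germ X (I - {c}) D m p
      (\<lambda>q v. \<Sum>i<k. (w q * v u) * (v \<sigma>' ^ (k - Suc i) * (P q v ^ i * \<epsilon> q v)))"
    by (intro log_germ_sum) simp
  show ?thesis
  proof (rule pole_germI[OF _ \<sigma>' \<eta>])
    show "log_germ X I D m p (\<lambda>q v. (v \<sigma> / \<sigma> q) ^ k * \<epsilon> q v - (v \<sigma>' / \<sigma>' q) ^ k * \<epsilon> q v)"
      by (intro log_germ_diff log_germ_dlog_power \<sigma> \<sigma>' \<epsilon> k p)
    show "agree X p (support D I) (\<lambda>q v. \<Sum>i<k. (w q * v u) * (v \<sigma>' ^ (k - Suc i) * (P q v ^ i * \<epsilon> q v)))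
        (\<lambda>q v. \<sigma>' q ^ (k - 1) * ((v \<sigma> / \<sigma> q) ^ k * \<epsilon> q v - (v \<sigma>' / \<sigma>' q) ^ k * \<epsilon> q v))"
      using uw(3) eventually_equation_nonzero[OF \<sigma>']
    proof eventually_elim
      case (elim q)
      show ?case
      proof (intro impI ballI)
        fix v assume q: "q \<notin> (support D I)" and v: "v \<in> tangent_space X q"
        have "q \<notin> D c" using q component by blast
        then have A: "v \<sigma> / \<sigma> q = v \<sigma>' / \<sigma>' q + w q * v u" using elim(1) v by blast
        have nz: "\<sigma>' q \<noteq> 0" using elim(2) q by blast
        let ?A = "v \<sigma> / \<sigma> q" and ?B = "v \<sigma>' / \<sigma>' q" and ?s = "\<sigma>' q"
        have PA: "P q v = ?s * ?A" unfolding A P_def using nz by (simp add: distrib_left)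
        have QB: "v \<sigma>' = ?s * ?B" using nz by simp
        have summand: "(w q * v u) * (v \<sigma>' ^ (k - Suc i) * (P q v ^ i * \<epsilon> q v)) =
            ?s ^ (k - 1) * \<epsilon> q v * ((w q * v u) * (?B ^ (k - Suc i) * ?A ^ i))" if "i < k" for i
        proof -
          have "k - 1 = (k - Suc i) + i" using that by simp
          then have "?s ^ (k - 1) = ?s ^ (k - Suc i) * ?s ^ i" by (simp only: power_add)
          then show ?thesis unfolding PA by (subst (1) QB) (simp only: power_mult_distrib mult_ac)
        qed
        have "(\<Sum>i<k. (w q * v u) * (v \<sigma>' ^ (k - Suc i) * (P q v ^ i * \<epsilon> q v))) =
            (\<Sum>i<k. ?s ^ (k - 1) * \<epsilon> q v * ((w q * v u) * (?B ^ (k - Suc i) * ?A ^ i)))"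
          by (intro sum.cong refl summand) simp
        also have "\<dots> = ?s ^ (k - 1) * \<epsilon> q v * ((w q * v u) * (\<Sum>i<k. ?B ^ (k - Suc i) * ?A ^ i))"
          by (simp only: sum_distrib_left)
        also have "\<dots> = ?s ^ (k - 1) * \<epsilon> q v * (?A ^ k - ?B ^ k)"
        proof -
          have "w q * v u = ?A - ?B" unfolding A by simp
          then show ?thesis by (simp only: power_diff_sumr2)
        qed
        finally show "(\<Sum>i<k. (w q * v u) * (v \<sigma>' ^ (k - Suc i) * (P q v ^ i * \<epsilon> q v))) =
            ?s ^ (k - 1) * (?A ^ k * \<epsilon> q v - ?B ^ k * \<epsilon> q v)"
          by (simp only: left_diff_distrib right_diff_distrib mult_ac)
      qed
    qed
  qed
qed

text \<open>The middle condition normalises \<epsilon> near \<open>p\<close> as in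
  \<open>log_forms\<close>. Elements of the quotient stalks are cosets of actual functions, so
  \<epsilon> has to be fixed as a function and not only where its values have a meaning.\<close>

definition residue_germ :: "nat \<Rightarrow> nat \<Rightarrow> 'n proj \<Rightarrow> 'n form \<Rightarrow> 'n form \<Rightarrow> bool" where
  "residue_germ m k p \<omega> \<epsilon> \<longleftrightarrow> log_germ X (I - {c}) D (m - k) p \<epsilon> \<and>
    (\<forall>\<^sub>F q in nbhd X p. \<forall>v. q \<in> (support D (I - {c})) \<or> v \<notin> tangent_space X q \<longrightarrow> \<epsilon> q v = 0) \<and>
    (\<exists>\<sigma>. equation_germ X (D c) p \<sigma> \<and>
      pole_germ m (k - 1) p (\<lambda>q v. \<omega> q v - (v \<sigma> / \<sigma> q) ^ k * \<epsilon> q v))"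

text \<open>A change of equation costs only a form of pole order at most \<open>k - 1\<close>.
  Leading coefficients of two forms can thus be taken with respect to the same equation, on which
  additivity rests.\<close>

lemma residue_germ_equation:
  assumes "residue_germ m k p \<omega> \<epsilon>" "equation_germ X (D c) p \<sigma>" "1 \<le> k" "k \<le> m"
  shows "pole_germ m (k - 1) p (\<lambda>q v. \<omega> q v - (v \<sigma> / \<sigma> q) ^ k * \<epsilon> q v)"
proof -
  obtain \<sigma>' where \<sigma>': "log_germ X (I - {c}) D (m - k) p \<epsilon>" "equation_germ X (D c) p \<sigma>'"
    "pole_germ m (k - 1) p (\<lambda>q v. \<omega> q v - (v \<sigma>' / \<sigma>' q) ^ k * \<epsilon> q v)"
    using assms(1) unfolding residue_germ_def by blast
  from pole_germ_add[OF \<sigma>'(3) dlog_power_change[OF \<sigma>'(2) assms(2) \<sigma>'(1) assms(3,4)]]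
  show ?thesis by simp
qed

lemma residue_germ_add:
  assumes "residue_germ m k p \<omega> \<epsilon>" "residue_germ m k p \<omega>' \<epsilon>'" "1 \<le> k" "k \<le> m"
  shows "residue_germ m k p (\<lambda>q v. \<omega> q v + \<omega>' q v) (\<lambda>q v. \<epsilon> q v + \<epsilon>' q v)"
proof -
  obtain \<sigma> where \<sigma>: "equation_germ X (D c) p \<sigma>"
    "pole_germ m (k - 1) p (\<lambda>q v. \<omega> q v - (v \<sigma> / \<sigma> q) ^ k * \<epsilon> q v)"
    using assms(1) unfolding residue_germ_def by blast
  have "pole_germ m (k - 1) p (\<lambda>q v. \<omega> q v + \<omega>' q v - (v \<sigma> / \<sigma> q) ^ k * (\<epsilon> q v + \<epsilon>' q v))"
    using pole_germ_add[OF \<sigma>(2) residue_germ_equation[OF assms(2) \<sigma>(1) assms(3,4)]]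
    by (simp add: algebra_simps)
  moreover have "\<forall>\<^sub>F q in nbhd X p. \<forall>v. q \<in> (support D (I - {c})) \<or> v \<notin> tangent_space X q \<longrightarrow>
      \<epsilon> q v + \<epsilon>' q v = 0"
    using assms(1)[unfolded residue_germ_def, THEN conjunct2, THEN conjunct1]
      assms(2)[unfolded residue_germ_def, THEN conjunct2, THEN conjunct1]
    by eventually_elim simp
  moreover have "log_germ X (I - {c}) D (m - k) p (\<lambda>q v. \<epsilon> q v + \<epsilon>' q v)"
    using assms(1,2) unfolding residue_germ_def by (intro log_germ_add) blast+
  ultimately show ?thesis using \<sigma>(1) unfolding residue_germ_def by blast
qed

lemma residue_germ_scale:
  assumes "residue_germ m k p \<omega> \<epsilon>" "g \<in> germs X p" "p \<in> X"
  shows "residue_germ m k p (\<lambda>q v. g q * \<omega> q v) (\<lambda>q v. g q * \<epsilon> q v)"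
proof -
  obtain \<sigma> where \<sigma>: "equation_germ X (D c) p \<sigma>"
    "pole_germ m (k - 1) p (\<lambda>q v. \<omega> q v - (v \<sigma> / \<sigma> q) ^ k * \<epsilon> q v)"
    using assms(1) unfolding residue_germ_def by blast
  have "pole_germ m (k - 1) p (\<lambda>q v. g q * \<omega> q v - (v \<sigma> / \<sigma> q) ^ k * (g q * \<epsilon> q v))"
    using pole_germ_scale[OF \<sigma>(2) assms(2,3)] by (simp add: algebra_simps)
  moreover have "\<forall>\<^sub>F q in nbhd X p. \<forall>v. q \<in> (support D (I - {c})) \<or> v \<notin> tangent_space X q \<longrightarrow>
      g q * \<epsilon> q v = 0"
    using assms(1)[unfolded residue_germ_def, THEN conjunct2, THEN conjunct1]
    by eventually_elim simp
  moreover have "log_germ X (I - {c}) D (m - k) p (\<lambda>q v. g q * \<epsilon> q v)"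
    using assms unfolding residue_germ_def by (intro log_germ_scale) blast+
  ultimately show ?thesis using \<sigma>(1) unfolding residue_germ_def by blast
qed

lemma residue_germ_diff:
  assumes "residue_germ m k p \<omega> \<epsilon>" "residue_germ m k p \<omega>' \<epsilon>'" "1 \<le> k" "k \<le> m" "p \<in> X"
  shows "residue_germ m k p (\<lambda>q v. \<omega> q v - \<omega>' q v) (\<lambda>q v. \<epsilon> q v - \<epsilon>' q v)"
  using residue_germ_add[OF assms(1) residue_germ_scale[OF assms(2) germs_const[OF assms(5), of "-1"] assms(5)]
      assms(3,4)] by simp

lemma residue_germ_cong:
  assumes "residue_germ m k p \<omega> \<epsilon>" "p \<in> X"
    and \<omega>: "agree X p (support D I) \<omega>' \<omega>"
    and \<epsilon>: "\<forall>\<^sub>F q in nbhd X p. \<epsilon>' q = \<epsilon> q"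
  shows "residue_germ m k p \<omega>' \<epsilon>'"
proof -
  obtain \<sigma> where \<sigma>: "equation_germ X (D c) p \<sigma>"
    "pole_germ m (k - 1) p (\<lambda>q v. \<omega> q v - (v \<sigma> / \<sigma> q) ^ k * \<epsilon> q v)"
    using assms(1) unfolding residue_germ_def by blast
  have "agree X p (support D I) (\<lambda>q v. \<omega>' q v - (v \<sigma> / \<sigma> q) ^ k * \<epsilon>' q v)
      (\<lambda>q v. \<omega> q v - (v \<sigma> / \<sigma> q) ^ k * \<epsilon> q v)"
    using \<omega> \<epsilon> by eventually_elim simp
  then have "pole_germ m (k - 1) p (\<lambda>q v. \<omega>' q v - (v \<sigma> / \<sigma> q) ^ k * \<epsilon>' q v)"
    by (rule pole_germ_cong[OF \<sigma>(2)])
  moreover have "\<forall>\<^sub>F q in nbhd X p. \<forall>v. q \<in> (support D (I - {c})) \<or> v \<notin> tangent_space X q \<longrightarrow> \<epsilon>' q v = 0"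
    using assms(1)[unfolded residue_germ_def, THEN conjunct2, THEN conjunct1] \<epsilon>
    by eventually_elim simp
  moreover have "log_germ X (I - {c}) D (m - k) p \<epsilon>'"
  proof (rule log_germ_cong)
    show "log_germ X (I - {c}) D (m - k) p \<epsilon>" using assms(1) unfolding residue_germ_def by blast
    show "agree X p (support D (I - {c})) \<epsilon>' \<epsilon>"
      using \<epsilon> by eventually_elim simp
  qed
  ultimately show ?thesis using \<sigma>(1) unfolding residue_germ_def by blast
qed

lemma residue_germ_eventually:
  assumes "residue_germ m k p \<omega> \<epsilon>" "p \<in> X"
  shows "\<forall>\<^sub>F q in nbhd X p. residue_germ m k q \<omega> \<epsilon>"
proof -
  obtain \<sigma> where \<sigma>: "log_germ X (I - {c}) D (m - k) p \<epsilon>" "equation_germ X (D c) p \<sigma>"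
    "pole_germ m (k - 1) p (\<lambda>q v. \<omega> q v - (v \<sigma> / \<sigma> q) ^ k * \<epsilon> q v)"
    "\<forall>\<^sub>F q in nbhd X p. \<forall>v. q \<in> (support D (I - {c})) \<or> v \<notin> tangent_space X q \<longrightarrow> \<epsilon> q v = 0"
    using assms(1) unfolding residue_germ_def by blast
  show ?thesis
    using log_germ_eventually[OF \<sigma>(1) assms(2)] equation_germ_eventually[OF \<sigma>(2)]
      pole_germ_eventually[OF \<sigma>(3) assms(2)] eventually_eventually_nbhd[OF \<sigma>(4) assms(2)]
    by eventually_elim (unfold residue_germ_def, blast)
qed

text \<open>Sections of the sheaves of forms have to vanish on the components and off the tangent spaces.\<close>

definition cut :: "'i set \<Rightarrow> 'n form \<Rightarrow> 'n form" where
  "cut J \<omega> q v = (if q \<in> (support D J) \<or> v \<notin> tangent_space X q then 0 else \<omega> q v)"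

lemma log_germ_cut:
  assumes "log_germ X J D m p \<omega>"
  shows "log_germ X J D m p (cut J \<omega>)"
  by (rule log_germ_cong[OF assms]) (simp add: cut_def)

lemma snc_coordinates_at:
  assumes "p \<in> X"
  obtains n z \<tau> where "snc_coordinates X I D c p n z \<tau>"
proof -
  obtain n z \<tau> where "enat n = krull_dim X" "generate_maximal_ideal X p n z"
    "inj_on \<tau> {i \<in> I. p \<in> D i}"
    "\<forall>i\<in>I. p \<in> D i \<longrightarrow> \<tau> i < n \<and> equation_germ X (D i) p (z (\<tau> i))"
    using snc_coordinates_exist[OF assms] by (elim exE conjE)
  then have "snc_coordinates X I D c p n z \<tau>"
    by unfold_locales (use assms in auto)
  then show thesis by (rule that)
qed

text \<open>Off \<open>D c\<close> the equation is a unit, all pole orders coincide and 0 is a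
  leading coefficient. At a point of \<open>D c\<close> it is read off in coordinates, with the
  coordinate of \<open>D c\<close> as equation; \<open>cut\<close> supplies the normalisation
  without affecting the identity off the divisor.\<close>

lemma residue_germ_exists:
  assumes p: "p \<in> X" and k: "1 \<le> k" "k \<le> m" and \<omega>: "pole_germ m k p \<omega>"
  shows "\<exists>\<epsilon>. residue_germ m k p \<omega> \<epsilon>"
proof (cases "p \<in> D c")
  case False
  obtain \<sigma> where \<sigma>: "equation_germ X (D c) p \<sigma>" using equation_exists[OF p] by blast
  obtain \<eta> where \<eta>: "log_germ X (I - {c}) D m p \<eta>"
    "agree X p (support D I) \<eta> (\<lambda>q v. \<sigma> q ^ k * \<omega> q v)"
    by (rule pole_germE[OF \<omega> \<sigma>])
  have "pole_germ m (k - 1) p \<omega>"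
  proof (rule pole_germI[OF pole_germ_log_germ[OF \<omega>] \<sigma>])
    show "log_germ X (I - {c}) D m p (\<lambda>q v. inverse (\<sigma> q) * \<eta> q v)"
      by (intro log_germ_scale \<eta>(1) germs_inverse equation_germ_germs[OF \<sigma>] equation_nonzero[OF \<sigma> False] p)
    show "agree X p (support D I) (\<lambda>q v. inverse (\<sigma> q) * \<eta> q v)
        (\<lambda>q v. \<sigma> q ^ (k - 1) * \<omega> q v)"
      using \<eta>(2) eventually_equation_nonzero[OF \<sigma>]
    proof eventually_elim
      case (elim q)
      have "\<sigma> q ^ k = \<sigma> q * \<sigma> q ^ (k - 1)" using k(1) by (cases k) simp_all
      with elim show ?case by simp
    qed
  qed
  then have "residue_germ m k p \<omega> (\<lambda>q v. 0)"
    using \<sigma> log_germ_zero unfolding residue_germ_def by auto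
  then show ?thesis by blast
next
  case True
  obtain n z \<tau> where "snc_coordinates X I D c p n z \<tau>" using snc_coordinates_at[OF p] .
  then interpret snc_coordinates X I D c p n z \<tau> .
  let ?s = "z (\<tau> c)"
  have \<sigma>: "equation_germ X (D c) p ?s" using coordinate_equation[OF component True] .
  obtain \<eta> where \<eta>: "log_germ X (I - {c}) D m p \<eta>"
    "agree X p (support D I) \<eta> (\<lambda>q v. ?s q ^ k * \<omega> q v)"
    by (rule pole_germE[OF \<omega> \<sigma>])
  obtain \<epsilon> \<zeta> where \<epsilon>: "log_germ X (I - {c}) D (m - k) p \<epsilon>" "log_germ X (I - {c}) D m p \<zeta>"
    "agree X p (support D I) \<zeta>
        (\<lambda>q v. ?s q ^ (k - 1) * (\<omega> q v - (v ?s / ?s q) ^ k * \<epsilon> q v))"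
    by (rule leading_coefficient_exists[OF True k pole_germ_log_germ[OF \<omega>] \<eta>])
  let ?\<epsilon> = "cut (I - {c}) \<epsilon>"
  have l: "log_germ X (I - {c}) D (m - k) p ?\<epsilon>" using \<epsilon>(1) by (rule log_germ_cut)
  have "pole_germ m (k - 1) p (\<lambda>q v. \<omega> q v - (v ?s / ?s q) ^ k * ?\<epsilon> q v)"
  proof (rule pole_germI[OF _ \<sigma> \<epsilon>(2)])
    show "log_germ X I D m p (\<lambda>q v. \<omega> q v - (v ?s / ?s q) ^ k * ?\<epsilon> q v)"
      by (intro log_germ_diff log_germ_dlog_power \<sigma> l k p pole_germ_log_germ[OF \<omega>])
    show "agree X p (support D I) \<zeta>
        (\<lambda>q v. ?s q ^ (k - 1) * (\<omega> q v - (v ?s / ?s q) ^ k * ?\<epsilon> q v))"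
      using \<epsilon>(3) by eventually_elim (simp add: cut_def)
  qed
  then have "residue_germ m k p \<omega> ?\<epsilon>"
    using \<sigma> l unfolding residue_germ_def by (auto simp: cut_def)
  then show ?thesis by blast
qed

text \<open>If (d\<sigma>/\<sigma>)^k \<epsilon> has pole order at most \<open>k - 1\<close>, then
  (d\<sigma>)^k \<epsilon> is \<sigma> times a form without pole along \<open>D c\<close>, and
  comparison of coefficients makes \<epsilon> divisible by \<sigma>. Conversely, a factor \<sigma>
  in \<epsilon> cancels one pole. The right-hand side is shaped to match the stalk of the ideal
  times the sheaf.\<close>

lemma residue_germ_zero_iff:
  assumes p: "p \<in> X" and k: "1 \<le> k" "k \<le> m"
  shows "residue_germ m k p (\<lambda>q v. 0) \<epsilon> \<longleftrightarrow>
    (\<exists>\<sigma> e. equation_germ X (D c) p \<sigma> \<and> log_germ X (I - {c}) D (m - k) p e \<and>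
      (\<forall>\<^sub>F q in nbhd X p. \<forall>v. (q \<in> (support D (I - {c})) \<or> v \<notin> tangent_space X q \<longrightarrow> e q v = 0) \<and>
        \<epsilon> q v = \<sigma> q * e q v))" (is "?L \<longleftrightarrow> ?R")
proof
  assume L: ?L
  then have \<epsilon>: "log_germ X (I - {c}) D (m - k) p \<epsilon>"
    "\<forall>\<^sub>F q in nbhd X p. \<forall>v. q \<in> (support D (I - {c})) \<or> v \<notin> tangent_space X q \<longrightarrow> \<epsilon> q v = 0"
    unfolding residue_germ_def by blast+
  have "\<exists>\<sigma> e. equation_germ X (D c) p \<sigma> \<and> log_germ X (I - {c}) D (m - k) p e \<and>
      (agree X p (support D (I - {c})) \<epsilon> (\<lambda>q v. \<sigma> q * e q v))"
  proof (cases "p \<in> D c")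
    case False
    obtain \<sigma> where \<sigma>: "equation_germ X (D c) p \<sigma>" using equation_exists[OF p] by blast
    note s = equation_germ_germs[OF \<sigma>] p equation_nonzero[OF \<sigma> False]
    have "log_germ X (I - {c}) D (m - k) p (\<lambda>q v. inverse (\<sigma> q) * \<epsilon> q v)"
      by (intro log_germ_scale \<epsilon>(1) germs_inverse s)
    moreover have "agree X p (support D (I - {c})) \<epsilon>
        (\<lambda>q v. \<sigma> q * (inverse (\<sigma> q) * \<epsilon> q v))"
      using germs_eventually_nonzero[OF s] by eventually_elim simp
    ultimately show ?thesis using \<sigma> by blast
  next
    case True
    obtain n z \<tau> where "snc_coordinates X I D c p n z \<tau>" using snc_coordinates_at[OF p] .
    then interpret snc_coordinates X I D c p n z \<tau> .
    let ?s = "z (\<tau> c)"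
    have \<sigma>: "equation_germ X (D c) p ?s" using coordinate_equation[OF component True] .
    obtain \<eta> where \<eta>: "log_germ X (I - {c}) D m p \<eta>"
      "agree X p (support D I) \<eta>
          (\<lambda>q v. ?s q ^ (k - 1) * (0 - (v ?s / ?s q) ^ k * \<epsilon> q v))"
      by (rule pole_germE[OF residue_germ_equation[OF L \<sigma> k] \<sigma>])
    have "agree X p (support D I) (\<lambda>q v. ?s q * - \<eta> q v)
        (\<lambda>q v. v ?s ^ k * \<epsilon> q v)"
      using \<eta>(2) eventually_equation_nonzero[OF \<sigma>]
    proof eventually_elim
      case (elim q)
      show ?case
      proof (intro impI ballI)
        fix v assume q: "q \<notin> (support D I)" and v: "v \<in> tangent_space X q"
        have s: "?s q \<noteq> 0" using elim(2) q by blast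
        have 1: "?s q * ?s q ^ (k - 1) = ?s q ^ k" using k(1) by (cases k) simp_all
        have 2: "?s q ^ k * (v ?s / ?s q) ^ k = v ?s ^ k" using s by (simp add: power_divide)
        have "?s q * - \<eta> q v = ?s q * ?s q ^ (k - 1) * (v ?s / ?s q) ^ k * \<epsilon> q v"
          using elim(1) q v by simp
        then show "?s q * - \<eta> q v = v ?s ^ k * \<epsilon> q v" unfolding 1 2 .
      qed
    qed
    then obtain e where "log_germ X (I - {c}) D (m - k) p e"
      "agree X p (support D (I - {c})) \<epsilon> (\<lambda>q v. ?s q * e q v)"
      by (rule leading_coefficient_divisible[OF True k(2) \<epsilon>(1) log_germ_uminus[OF \<eta>(1) p]])
    then show ?thesis using \<sigma> by blast
  qed
  then obtain \<sigma> e where e: "equation_germ X (D c) p \<sigma>" "log_germ X (I - {c}) D (m - k) p e"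
    "agree X p (support D (I - {c})) \<epsilon> (\<lambda>q v. \<sigma> q * e q v)"
    by blast
  have "\<forall>\<^sub>F q in nbhd X p. \<forall>v. (q \<in> (support D (I - {c})) \<or> v \<notin> tangent_space X q \<longrightarrow>
      cut (I - {c}) e q v = 0) \<and> \<epsilon> q v = \<sigma> q * cut (I - {c}) e q v"
    using e(3) \<epsilon>(2) by eventually_elim (simp add: cut_def)
  with e(1) log_germ_cut[OF e(2)] show ?R by blast
next
  assume ?R
  then obtain \<sigma> e where e: "equation_germ X (D c) p \<sigma>" "log_germ X (I - {c}) D (m - k) p e"
    "\<forall>\<^sub>F q in nbhd X p. \<forall>v. (q \<in> (support D (I - {c})) \<or> v \<notin> tangent_space X q \<longrightarrow> e q v = 0) \<and>
        \<epsilon> q v = \<sigma> q * e q v" by blast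
  note s = equation_germ_germs[OF e(1)]
  have \<epsilon>: "log_germ X (I - {c}) D (m - k) p \<epsilon>"
  proof (rule log_germ_cong[OF log_germ_scale[OF e(2) s p]])
    show "agree X p (support D (I - {c})) \<epsilon> (\<lambda>q v. \<sigma> q * e q v)"
      using e(3) by eventually_elim simp
  qed
  have "pole_germ m (k - 1) p (\<lambda>q v. 0 - (v \<sigma> / \<sigma> q) ^ k * \<epsilon> q v)"
  proof (rule pole_germI[OF _ e(1)])
    show "log_germ X I D m p (\<lambda>q v. 0 - (v \<sigma> / \<sigma> q) ^ k * \<epsilon> q v)"
      by (intro log_germ_diff log_germ_zero log_germ_dlog_power e(1) \<epsilon> k p)
    show "log_germ X (I - {c}) D m p (\<lambda>q v. - (v \<sigma> ^ k * e q v))"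
      by (intro log_germ_uminus log_germ_differential_power s e(2) k p)
    show "agree X p (support D I) (\<lambda>q v. - (v \<sigma> ^ k * e q v))
        (\<lambda>q v. \<sigma> q ^ (k - 1) * (0 - (v \<sigma> / \<sigma> q) ^ k * \<epsilon> q v))"
      using e(3) eventually_equation_nonzero[OF e(1)]
    proof eventually_elim
      case (elim q)
      show ?case
      proof (intro impI ballI)
        fix v assume q: "q \<notin> (support D I)"
        have 1: "\<sigma> q ^ (k - 1) * \<sigma> q = \<sigma> q ^ k" using k(1) by (cases k) simp_all
        have 2: "\<sigma> q ^ k * (v \<sigma> / \<sigma> q) ^ k = v \<sigma> ^ k" using elim(2) q by (simp add: power_divide)
        have "\<sigma> q ^ (k - 1) * (0 - (v \<sigma> / \<sigma> q) ^ k * \<epsilon> q v) =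
            - (\<sigma> q ^ (k - 1) * \<sigma> q * (v \<sigma> / \<sigma> q) ^ k * e q v)"
          using elim(1) by simp
        then show "- (v \<sigma> ^ k * e q v) = \<sigma> q ^ (k - 1) * (0 - (v \<sigma> / \<sigma> q) ^ k * \<epsilon> q v)"
          unfolding 1 2 by (rule sym)
      qed
    qed
  qed
  moreover have "\<forall>\<^sub>F q in nbhd X p. \<forall>v. q \<in> (support D (I - {c})) \<or> v \<notin> tangent_space X q \<longrightarrow> \<epsilon> q v = 0"
    using e(3) by eventually_elim simp
  ultimately show ?L using e(1) \<epsilon> unfolding residue_germ_def by blast
qed

end

section \<open>The exact sequence\<close>

lemma restr_eventually:
  assumes "open_in_variety X V" "p \<in> V"
  shows "\<forall>\<^sub>F q in nbhd X p. restr V f q = f q"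
  by (rule eventually_nbhdI[OF assms]) (simp add: restr_def)

lemma restr_log_forms:
  assumes V: "open_in_variety X V" and "\<And>p. p \<in> V \<Longrightarrow> log_germ X J D m p \<omega>"
    and "\<And>q v. q \<in> V \<Longrightarrow> q \<in> (support D J) \<or> v \<notin> tangent_space X q \<Longrightarrow> \<omega> q v = 0"
  shows "restr V \<omega> \<in> log_forms X J D m V"
  unfolding log_forms_iff[OF V]
proof (intro conjI ballI)
  show "normalized X (V - (support D J)) (restr V \<omega>)"
    using assms(3) by (auto simp: normalized_def restr_def)
  fix p assume p: "p \<in> V"
  show "log_germ X J D m p (restr V \<omega>)"
  proof (rule log_germ_cong[OF assms(2)[OF p]])
    show "agree X p (support D J) (\<lambda>q v. restr V \<omega> q v) \<omega>"
      using restr_eventually[OF V p, of \<omega>] by eventually_elim simp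
  qed
qed

lemma log_forms_germ:
  assumes "\<omega> \<in> log_forms X J D m U" "open_in_variety X U" "p \<in> U"
  shows "log_germ X J D m p \<omega>"
  using assms(1,3) unfolding log_forms_iff[OF assms(2)] by simp

lemma log_forms_normalized:
  assumes "\<omega> \<in> log_forms X J D m U" "q \<notin> U \<or> q \<in> (support D J) \<or> v \<notin> tangent_space X q"
  shows "\<omega> q v = 0"
proof -
  have "\<forall>q v. q \<notin> U - (support D J) \<or> v \<notin> tangent_space X q \<longrightarrow> \<omega> q v = 0"
    using assms(1) unfolding log_forms_def mem_Collect_eq by (rule conjunct1)
  then show ?thesis using assms(2) by blast
qed

context snc_pair
begin

lemma pole_forms_germ:
  assumes U: "open_in_variety X U" "p \<in> U" and \<omega>: "\<omega> \<in> pole_forms X I D c m k U"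
  shows "pole_germ m k p \<omega>"
proof -
  have p: "p \<in> X" using U open_in_variety_subset by blast
  obtain \<sigma> where \<sigma>: "equation_germ X (D c) p \<sigma>" using equation_exists[OF p] by blast
  obtain V where V: "open_in_variety X V" "p \<in> V"
    "\<And>W. open_in_variety X W \<Longrightarrow> W \<subseteq> V \<Longrightarrow> local_equation X (D c) W (restr W \<sigma>)"
    using equation_germE[OF \<sigma>] by metis
  let ?W = "V \<inter> U"
  have W: "open_in_variety X ?W" "p \<in> ?W" using V U by (auto intro: openin_Int)
  then have "local_equation X (D c) ?W (restr ?W \<sigma>)" using V(3) by blast
  then obtain \<eta> where \<eta>: "\<eta> \<in> log_forms X (I - {c}) D m ?W"
    "\<forall>q\<in>?W - (support D I). \<forall>v. \<eta> q v = restr ?W \<sigma> q ^ k * \<omega> q v"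
    using \<omega> unfolding pole_forms_def by blast
  show ?thesis
  proof (rule pole_germI[OF _ \<sigma> log_forms_germ[OF \<eta>(1) W]])
    have "\<omega> \<in> log_forms X I D m U" using \<omega> by (simp add: pole_forms_def)
    then show "log_germ X I D m p \<omega>" using U by (rule log_forms_germ)
    show "agree X p (support D I) \<eta> (\<lambda>q v. \<sigma> q ^ k * \<omega> q v)"
      by (rule eventually_nbhdI[OF W]) (use \<eta>(2) in \<open>simp add: restr_def\<close>)
  qed
qed

text \<open>\<open>pole_forms\<close> tests all equations \<sigma>' on all smaller open sets. Each
  \<sigma>' vanishes on \<open>D c\<close>, hence equals \<sigma> g on its domain, and g^k \<eta>
  serves for \<sigma>'. So one neighbourhood, on which \<sigma> and \<eta> are good, works for every
  test.\<close>

lemma pole_germ_forms: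
  assumes U: "open_in_variety X U" "p \<in> U" and \<omega>: "pole_germ m k p \<omega>"
  obtains V where "open_in_variety X V" "p \<in> V" "V \<subseteq> U"
    "restr V (cut I \<omega>) \<in> pole_forms X I D c m k V"
proof -
  have p: "p \<in> X" using U open_in_variety_subset by blast
  obtain \<sigma> \<eta> where *: "equation_germ X (D c) p \<sigma>" "log_germ X (I - {c}) D m p \<eta>"
    "agree X p (support D I) \<eta> (\<lambda>q v. \<sigma> q ^ k * \<omega> q v)"
    using \<omega> unfolding pole_germ_def by (elim conjE exE)
  obtain V0 where V0: "open_in_variety X V0" "p \<in> V0"
    "\<And>W. open_in_variety X W \<Longrightarrow> W \<subseteq> V0 \<Longrightarrow> local_equation X (D c) W (restr W \<sigma>)"
    using equation_germE[OF *(1)] by metis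
  have "\<forall>\<^sub>F q in nbhd X p. (q \<in> U \<and> q \<in> V0 \<and> log_germ X I D m q \<omega>) \<and> log_germ X (I - {c}) D m q \<eta> \<and>
      (q \<notin> (support D I) \<longrightarrow> (\<forall>v\<in>tangent_space X q. \<eta> q v = \<sigma> q ^ k * \<omega> q v))"
    by (intro eventually_conj eventually_nbhd_in U V0(1,2) log_germ_eventually *(2,3)
        pole_germ_log_germ[OF \<omega>] p)
  then obtain V where V: "open_in_variety X V" "p \<in> V"
    "\<And>q. q \<in> V \<Longrightarrow> (q \<in> U \<and> q \<in> V0 \<and> log_germ X I D m q \<omega>) \<and> log_germ X (I - {c}) D m q \<eta> \<and>
      (q \<notin> (support D I) \<longrightarrow> (\<forall>v\<in>tangent_space X q. \<eta> q v = \<sigma> q ^ k * \<omega> q v))"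
    by (rule eventually_nbhdE[OF _ p]) blast
  have eqV: "local_equation X (D c) V (restr V \<sigma>)" using V0(3) V by blast
  have "restr V (cut I \<omega>) \<in> pole_forms X I D c m k V"
    unfolding pole_forms_def
  proof (intro CollectI conjI allI impI)
    show "restr V (cut I \<omega>) \<in> log_forms X I D m V"
      using V(3) by (intro restr_log_forms[OF V(1)] log_germ_cut) (auto simp: cut_def)
    fix W \<sigma>' assume W: "W \<subseteq> V" "local_equation X (D c) W \<sigma>'"
    have oW: "open_in_variety X W" "\<sigma>' \<in> regular X W" using W(2) by (auto simp: local_equation_def)
    have "restr W (\<lambda>q. 1) \<in> regular X W"
      using oW(1) open_in_variety_subset by (intro restr_regular) (auto intro: germs_const)
    moreover have "\<forall>q\<in>W. \<sigma>' q = \<sigma>' q * restr W (\<lambda>q. 1) q" by (simp add: restr_def)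
    ultimately have "\<forall>q\<in>W \<inter> D c. \<sigma>' q = 0"
      using W(2) oW unfolding local_equation_def by blast
    then obtain g where g: "g \<in> regular X W" "\<forall>q\<in>W. \<sigma>' q = restr V \<sigma> q * g q"
      using eqV oW W(1) unfolding local_equation_def by blast
    have gW: "g \<in> germs X q" if "q \<in> W" for q using regular_germs[OF g(1) oW(1) that] .
    have "restr W (cut (I - {c}) (\<lambda>q v. g q ^ k * \<eta> q v)) \<in> log_forms X (I - {c}) D m W"
    proof (rule restr_log_forms[OF oW(1)])
      fix q assume q: "q \<in> W"
      then have "q \<in> X" using oW(1) open_in_variety_subset by blast
      then show "log_germ X (I - {c}) D m q (cut (I - {c}) (\<lambda>q v. g q ^ k * \<eta> q v))"
        using q W(1) V(3) by (intro log_germ_cut log_germ_scale germs_power gW) auto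
    qed (simp add: cut_def)
    moreover have "restr W (cut (I - {c}) (\<lambda>q v. g q ^ k * \<eta> q v)) q v = \<sigma>' q ^ k * restr V (cut I \<omega>) q v"
      if q: "q \<in> W - (support D I)" for q v
    proof (cases "v \<in> tangent_space X q")
      case True
      have qV: "q \<in> V" "q \<in> W" using q W(1) by auto
      then have "\<eta> q v = \<sigma> q ^ k * \<omega> q v" using V(3)[OF qV(1)] q True by blast
      moreover have "\<sigma>' q = \<sigma> q * g q" using g(2) qV by (simp add: restr_def)
      ultimately show ?thesis using q qV True by (simp add: restr_def cut_def power_mult_distrib mult_ac)
    next
      case False
      then show ?thesis using q W(1) by (auto simp: restr_def cut_def)
    qed
    ultimately show "\<exists>\<eta>\<in>log_forms X (I - {c}) D m W.
        \<forall>q\<in>W - (support D I). \<forall>v. \<eta> q v = \<sigma>' q ^ k * restr V (cut I \<omega>) q v" by blast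
  qed
  then show thesis using that V by blast
qed

lemma restr_cut_pole_forms:
  assumes "\<omega> \<in> pole_forms X I D c m k U"
  shows "restr V (cut I \<omega>) = restr V \<omega>"
proof -
  have "\<omega> \<in> log_forms X I D m U" using assms(1) by (simp add: pole_forms_def)
  then have "cut I \<omega> q v = \<omega> q v" for q v
    using log_forms_normalized[of \<omega> X I D m U q v] by (simp add: cut_def)
  then have "cut I \<omega> = \<omega>" by (intro ext)
  then show ?thesis by simp
qed

text \<open>An extra factor \<sigma> creates no pole. This is what makes the identity a map from the
  first sheaf to the second.\<close>

lemma pole_forms_mono:
  assumes "\<omega> \<in> pole_forms X I D c m k U"
  shows "\<omega> \<in> pole_forms X I D c m (Suc k) U"
  unfolding pole_forms_def
proof (intro CollectI conjI allI impI)
  show "\<omega> \<in> log_forms X I D m U" using assms by (simp add: pole_forms_def)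
  fix V \<sigma> assume V: "V \<subseteq> U" "local_equation X (D c) V \<sigma>"
  then obtain \<eta> where \<eta>: "\<eta> \<in> log_forms X (I - {c}) D m V"
    "\<forall>q\<in>V - (support D I). \<forall>v. \<eta> q v = \<sigma> q ^ k * \<omega> q v"
    using assms unfolding pole_forms_def by blast
  have oV: "open_in_variety X V" using V(2) by (simp add: local_equation_def)
  have "restr V (\<lambda>q v. \<sigma> q * \<eta> q v) \<in> log_forms X (I - {c}) D m V"
  proof (rule restr_log_forms[OF oV])
    fix q assume q: "q \<in> V"
    then have "q \<in> X" using oV open_in_variety_subset by blast
    then show "log_germ X (I - {c}) D m q (\<lambda>q v. \<sigma> q * \<eta> q v)"
      by (intro log_germ_scale log_forms_germ[OF \<eta>(1) oV q]
          equation_germ_germs[OF local_equation_germ[OF V(2) q]])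
  next
    fix q v assume "q \<in> (support D (I - {c})) \<or> v \<notin> tangent_space X q"
    then have "\<eta> q v = 0" by (intro log_forms_normalized[OF \<eta>(1)]) blast
    then show "\<sigma> q * \<eta> q v = 0" by simp
  qed
  moreover have "\<forall>q\<in>V - (support D I). \<forall>v. restr V (\<lambda>q v. \<sigma> q * \<eta> q v) q v = \<sigma> q ^ Suc k * \<omega> q v"
    using \<eta>(2) by (simp add: restr_def mult.assoc)
  ultimately show "\<exists>\<eta>\<in>log_forms X (I - {c}) D m V.
      \<forall>q\<in>V - (support D I). \<forall>v. \<eta> q v = \<sigma> q ^ Suc k * \<omega> q v" by blast
qed

section \<open>The residue map into the restricted sheaf\<close>

abbreviation (input) ideal_stalk :: "nat \<Rightarrow> 'n proj \<Rightarrow> 'n form set" where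
  "ideal_stalk m \<equiv> ideal_times_stalk X (D c) (log_forms X (I - {c}) D m)"

text \<open>The ideal of \<open>D c\<close> is principal near \<open>p\<close>: a function that
  vanishes on \<open>D c\<close> is \<sigma> times a germ, so a sum of products collapses to
  \<sigma> e with a single form \<open>e\<close>. The identity is required for all \<open>v\<close>,
  since the elements of the stalk are compared as functions.\<close>

lemma ideal_stalk_iff:
  assumes p: "p \<in> X"
  shows "\<epsilon> \<in> ideal_stalk m p \<longleftrightarrow>
    (\<exists>\<sigma> e. equation_germ X (D c) p \<sigma> \<and> log_germ X (I - {c}) D m p e \<and>
      (\<forall>\<^sub>F q in nbhd X p. \<forall>v. (q \<in> (support D (I - {c})) \<or> v \<notin> tangent_space X q \<longrightarrow> e q v = 0) \<and>
        \<epsilon> q v = \<sigma> q * e q v))" (is "?L \<longleftrightarrow> ?R")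
proof
  assume ?L
  then obtain V and r :: nat and f e where V: "open_in_variety X V" "p \<in> V"
    "\<forall>j<r. f j \<in> regular X V \<and> (\<forall>x\<in>V \<inter> D c. f j x = 0) \<and> e j \<in> log_forms X (I - {c}) D m V"
    "restr V \<epsilon> = (\<Sum>j<r. scale_form (f j) (e j))"
    unfolding ideal_times_stalk_def mem_Collect_eq by (elim exE conjE)
  obtain \<sigma> where \<sigma>: "equation_germ X (D c) p \<sigma>" using equation_exists[OF p] by blast
  have "\<exists>g. g \<in> germs X p \<and> (\<forall>\<^sub>F q in nbhd X p. f j q = \<sigma> q * g q)" if j: "j < r" for j
  proof -
    have 1: "f j \<in> germs X p" using V(3) j by (intro regular_germs[OF _ V(1,2)]) blast
    have 2: "\<forall>\<^sub>F q in nbhd X p. q \<in> D c \<longrightarrow> f j q = 0"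
      by (rule eventually_nbhdI[OF V(1,2)]) (use V(3) j in blast)
    show ?thesis by (rule equation_germ_divides[OF \<sigma> 1 2]) blast
  qed
  then have "\<forall>j\<in>{..<r}. \<exists>g. g \<in> germs X p \<and> (\<forall>\<^sub>F q in nbhd X p. f j q = \<sigma> q * g q)" by simp
  from bchoice[OF this] obtain g where g: "\<And>j. j < r \<Longrightarrow> g j \<in> germs X p"
    "\<And>j. j < r \<Longrightarrow> \<forall>\<^sub>F q in nbhd X p. f j q = \<sigma> q * g j q" by auto
  define h where "h = (\<lambda>q v. \<Sum>j<r. g j q * e j q v)"
  have "log_germ X (I - {c}) D m p h"
    unfolding h_def using V by (intro log_germ_sum log_germ_scale g(1) p log_forms_germ[of _ X _ D m V]) auto
  moreover have "\<forall>\<^sub>F q in nbhd X p. \<forall>j\<in>{..<r}. f j q = \<sigma> q * g j q"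
    using g(2) by (intro eventually_ball_finite) auto
  then have "\<forall>\<^sub>F q in nbhd X p. \<forall>v. (q \<in> (support D (I - {c})) \<or> v \<notin> tangent_space X q \<longrightarrow> h q v = 0) \<and>
        \<epsilon> q v = \<sigma> q * h q v"
    using eventually_nbhd_in[OF V(1,2)]
  proof eventually_elim
    case (elim q)
    show ?case
    proof (intro allI conjI impI)
      fix v
      have "\<epsilon> q v = restr V \<epsilon> q v" using elim(2) by (simp add: restr_def)
      also have "\<dots> = (\<Sum>j<r. f j q * e j q v)"
        unfolding V(4) by (simp add: sum_fun_apply scale_form_def)
      also have "\<dots> = \<sigma> q * h q v"
        unfolding h_def sum_distrib_left using elim(1) by (intro sum.cong) auto
      finally show "\<epsilon> q v = \<sigma> q * h q v" .
      assume n: "q \<in> (support D (I - {c})) \<or> v \<notin> tangent_space X q"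
      have "e j q v = 0" if "j < r" for j
        using log_forms_normalized[of "e j" X "I - {c}" D m V q v] V(3) that n by blast
      then show "h q v = 0" unfolding h_def by (intro sum.neutral) simp
    qed
  qed
  ultimately show ?R using \<sigma> by blast
next
  assume ?R
  then obtain \<sigma> e where e: "equation_germ X (D c) p \<sigma>" "log_germ X (I - {c}) D m p e"
    "\<forall>\<^sub>F q in nbhd X p. \<forall>v. (q \<in> (support D (I - {c})) \<or> v \<notin> tangent_space X q \<longrightarrow> e q v = 0) \<and>
        \<epsilon> q v = \<sigma> q * e q v" by blast
  obtain V0 where V0: "open_in_variety X V0" "p \<in> V0"
    "\<And>W. open_in_variety X W \<Longrightarrow> W \<subseteq> V0 \<Longrightarrow> local_equation X (D c) W (restr W \<sigma>)"
    using equation_germE[OF e(1)] by metis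
  have "\<forall>\<^sub>F q in nbhd X p. q \<in> V0 \<and> log_germ X (I - {c}) D m q e \<and>
      (\<forall>v. (q \<in> (support D (I - {c})) \<or> v \<notin> tangent_space X q \<longrightarrow> e q v = 0) \<and> \<epsilon> q v = \<sigma> q * e q v)"
    by (intro eventually_conj eventually_nbhd_in V0(1,2) log_germ_eventually e(2,3) p)
  then obtain V where V: "open_in_variety X V" "p \<in> V"
    "\<And>q. q \<in> V \<Longrightarrow> q \<in> V0 \<and> log_germ X (I - {c}) D m q e \<and>
      (\<forall>v. (q \<in> (support D (I - {c})) \<or> v \<notin> tangent_space X q \<longrightarrow> e q v = 0) \<and> \<epsilon> q v = \<sigma> q * e q v)"
    by (rule eventually_nbhdE[OF _ p]) blast
  have \<sigma>: "local_equation X (D c) V (restr V \<sigma>)" using V0(3) V by blast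
  have zero: "restr V \<sigma> q = 0" if "q \<in> V \<inter> D c" for q
  proof -
    have "equation_germ X (D c) q (restr V \<sigma>)" using local_equation_germ[OF \<sigma>] that by blast
    then have "restr V \<sigma> q = 0 \<longleftrightarrow> q \<in> D c"
      by (intro eventually_nbhd_self[OF equation_germ_zero_iff[OF _ closed_component[OF component]]]
          equation_germ_variety)
    then show ?thesis using that by blast
  qed
  have "restr V e \<in> log_forms X (I - {c}) D m V"
    using V(3) by (intro restr_log_forms[OF V(1)]) blast+
  moreover have "restr V \<sigma> \<in> regular X V" using \<sigma> by (simp add: local_equation_def)
  moreover have "restr V \<epsilon> = (\<Sum>j<(1::nat). scale_form (restr V \<sigma>) (restr V e))"
    using V(3) by (auto simp: fun_eq_iff restr_def scale_form_def)
  ultimately show ?L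
    unfolding ideal_times_stalk_def using V(1,2) zero
    by (intro CollectI exI[of _ V] conjI exI[of _ "1::nat"] exI[of _ "\<lambda>_. restr V \<sigma>"]
        exI[of _ "\<lambda>_. restr V e"]) auto
qed

lemma residue_germ_zero_ideal:
  assumes "p \<in> X" "1 \<le> k" "k \<le> m"
  shows "residue_germ m k p (\<lambda>q v. 0) \<epsilon> \<longleftrightarrow> \<epsilon> \<in> ideal_stalk (m - k) p"
  unfolding residue_germ_zero_iff[OF assms] ideal_stalk_iff[OF assms(1)] ..

text \<open>Two leading coefficients of the same form differ by a leading coefficient of the form 0,
  and the latter make up the ideal stalk.\<close>

lemma residue_germ_coset:
  assumes "p \<in> X" "1 \<le> k" "k \<le> m" "residue_germ m k p \<omega> e"
  shows "{\<epsilon>. residue_germ m k p \<omega> \<epsilon>} = e +o ideal_stalk (m - k) p"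
proof (intro set_eqI iffI)
  fix \<epsilon> assume "\<epsilon> \<in> {\<epsilon>. residue_germ m k p \<omega> \<epsilon>}"
  then have "residue_germ m k p (\<lambda>q v. 0) (\<lambda>q v. \<epsilon> q v - e q v)"
    using residue_germ_diff[OF _ assms(4,2,3,1), of \<omega> \<epsilon>] by simp
  then have "(\<lambda>q v. \<epsilon> q v - e q v) \<in> ideal_stalk (m - k) p"
    using residue_germ_zero_ideal assms by blast
  moreover have "\<epsilon> = e + (\<lambda>q v. \<epsilon> q v - e q v)" by (simp add: fun_eq_iff)
  ultimately show "\<epsilon> \<in> e +o ideal_stalk (m - k) p" unfolding elt_set_plus_def by blast
next
  fix \<epsilon> assume "\<epsilon> \<in> e +o ideal_stalk (m - k) p"
  then obtain b where b: "b \<in> ideal_stalk (m - k) p" "\<epsilon> = e + b" unfolding elt_set_plus_def by blast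
  then have "residue_germ m k p (\<lambda>q v. 0) b" using residue_germ_zero_ideal assms by blast
  from residue_germ_add[OF assms(4) this assms(2,3)]
  show "\<epsilon> \<in> {\<epsilon>. residue_germ m k p \<omega> \<epsilon>}" using b(2) by (simp add: plus_fun_def)
qed

text \<open>An element of the quotient stalk is a coset, and the coset wanted here is the set of all
  leading coefficients. The definition thus involves no choice of an equation, of coordinates or of
  \<epsilon>.\<close>

definition residue :: "nat \<Rightarrow> nat \<Rightarrow> 'n proj set \<Rightarrow> 'n form \<Rightarrow> 'n proj \<Rightarrow> 'n form set" where
  "residue m k U \<omega> q = (if q \<in> U then {\<epsilon>. residue_germ m k q \<omega> \<epsilon>} else {})"

text \<open>A leading coefficient found at \<open>p\<close> is one at all nearby points. So a single
  form near \<open>p\<close> induces the whole family of cosets there, as a section of the sheaf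
  quotient must be.\<close>

lemma residue_section:
  assumes U: "open_in_variety X U" and k: "1 \<le> k" "k \<le> m" and \<omega>: "\<omega> \<in> pole_forms X I D c m k U"
  shows "residue m k U \<omega> \<in> sections (restrict_sheaf X (D c) (log_forms X (I - {c}) D (m - k))) U"
proof -
  have "\<exists>V. open_in_variety X V \<and> p \<in> V \<and> V \<subseteq> U \<and>
      (\<exists>e\<in>log_forms X (I - {c}) D (m - k) V. \<forall>q\<in>V. residue m k U \<omega> q = e +o ideal_stalk (m - k) q)"
    if p: "p \<in> U" for p
  proof -
    have pX: "p \<in> X" using U p open_in_variety_subset by blast
    obtain \<epsilon> where \<epsilon>: "residue_germ m k p \<omega> \<epsilon>"
      using residue_germ_exists[OF pX k pole_forms_germ[OF U p \<omega>]] by blast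
    have n: "\<forall>\<^sub>F q in nbhd X p. \<forall>v. q \<in> (support D (I - {c})) \<or> v \<notin> tangent_space X q \<longrightarrow> \<epsilon> q v = 0"
      using \<epsilon> unfolding residue_germ_def by blast
    have "\<forall>\<^sub>F q in nbhd X p. q \<in> U \<and> residue_germ m k q \<omega> \<epsilon> \<and>
        (\<forall>v. q \<in> (support D (I - {c})) \<or> v \<notin> tangent_space X q \<longrightarrow> \<epsilon> q v = 0)"
      by (intro eventually_conj eventually_nbhd_in U p residue_germ_eventually \<epsilon> pX n)
    then obtain V where V: "open_in_variety X V" "p \<in> V" "\<And>q. q \<in> V \<Longrightarrow> q \<in> U \<and> residue_germ m k q \<omega> \<epsilon> \<and>
        (\<forall>v. q \<in> (support D (I - {c})) \<or> v \<notin> tangent_space X q \<longrightarrow> \<epsilon> q v = 0)"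
      by (rule eventually_nbhdE[OF _ pX]) blast
    have "restr V \<epsilon> \<in> log_forms X (I - {c}) D (m - k) V"
      using V(3) by (intro restr_log_forms[OF V(1)]) (auto simp: residue_germ_def)
    moreover have "residue m k U \<omega> q = restr V \<epsilon> +o ideal_stalk (m - k) q" if q: "q \<in> V" for q
    proof -
      have qX: "q \<in> X" using V(1) q open_in_variety_subset by blast
      have r: "residue_germ m k q \<omega> \<epsilon>" using V(3)[OF q] by blast
      have "residue_germ m k q \<omega> (restr V \<epsilon>)"
        by (rule residue_germ_cong[OF r qX _ restr_eventually[OF V(1) q]]) simp
      from residue_germ_coset[OF qX k this] show ?thesis using V(3)[OF q] by (simp add: residue_def)
    qed
    ultimately show ?thesis using V by blast
  qed
  then show ?thesis by (simp add: restrict_sheaf_def residue_def)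
qed

lemma residue_restr:
  assumes "open_in_variety X V" "V \<subseteq> U"
  shows "residue m k V (restr V \<omega>) q = (if q \<in> V then residue m k U \<omega> q else {})"
proof (cases "q \<in> V")
  case True
  have qX: "q \<in> X" using assms(1) True open_in_variety_subset by blast
  have ev: "\<forall>\<^sub>F r in nbhd X q. restr V \<omega> r = \<omega> r" using restr_eventually[OF assms(1) True] .
  have "residue_germ m k q (restr V \<omega>) \<epsilon> \<longleftrightarrow> residue_germ m k q \<omega> \<epsilon>" for \<epsilon>
  proof
    assume "residue_germ m k q (restr V \<omega>) \<epsilon>"
    then show "residue_germ m k q \<omega> \<epsilon>"
      by (rule residue_germ_cong[OF _ qX]) (use ev in \<open>auto elim: eventually_mono\<close>)
  next
    assume "residue_germ m k q \<omega> \<epsilon>"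
    then show "residue_germ m k q (restr V \<omega>) \<epsilon>"
      by (rule residue_germ_cong[OF _ qX]) (use ev in \<open>auto elim: eventually_mono\<close>)
  qed
  then show ?thesis using True assms(2) by (auto simp: residue_def)
qed (simp add: residue_def)

lemma residue_cosetE:
  assumes U: "open_in_variety X U" and k: "1 \<le> k" "k \<le> m" and \<omega>: "\<omega> \<in> pole_forms X I D c m k U"
    and q: "q \<in> U"
  obtains e where "residue_germ m k q \<omega> e" "residue m k U \<omega> q = e +o ideal_stalk (m - k) q"
proof -
  have qX: "q \<in> X" using U q open_in_variety_subset by blast
  obtain e where e: "residue_germ m k q \<omega> e"
    using residue_germ_exists[OF qX k pole_forms_germ[OF U q \<omega>]] by blast
  from residue_germ_coset[OF qX k e] show thesis using that e q by (simp add: residue_def)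
qed

lemma ideal_stalk_zero:
  assumes "p \<in> X" "1 \<le> k" "k \<le> m"
  shows "0 \<in> ideal_stalk (m - k) p" "residue_germ m k p (\<lambda>q v. 0) (\<lambda>q v. 0)"
proof -
  obtain \<sigma> where "equation_germ X (D c) p \<sigma>" using equation_exists[OF assms(1)] by blast
  then show *: "residue_germ m k p (\<lambda>q v. 0) (\<lambda>q v. 0)"
    using pole_germ_zero[OF assms(1)] log_germ_zero unfolding residue_germ_def by auto
  then show "0 \<in> ideal_stalk (m - k) p"
    using residue_germ_zero_ideal[OF assms] by (simp add: zero_fun_def)
qed

text \<open>A leading coefficient of the sum is split by subtracting some leading coefficient
  \<open>e\<close> of \<omega>, which exists; the difference is one of \<omega>'. Outside
  \<open>U\<close> both sides are empty.\<close>

lemma residue_add: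
  assumes U: "open_in_variety X U" and k: "1 \<le> k" "k \<le> m"
    and \<omega>: "\<omega> \<in> pole_forms X I D c m k U" and \<omega>': "\<omega>' \<in> pole_forms X I D c m k U"
  shows "residue m k U (\<omega> + \<omega>') q = residue m k U \<omega> q + residue m k U \<omega>' q"
proof (cases "q \<in> U")
  case True
  then have qX: "q \<in> X" using U open_in_variety_subset by blast
  obtain e where e: "residue_germ m k q \<omega> e"
    by (rule residue_cosetE[OF U k \<omega> True])
  have "residue_germ m k q (\<omega> + \<omega>') \<epsilon> \<longleftrightarrow>
      \<epsilon> \<in> {\<epsilon>. residue_germ m k q \<omega> \<epsilon>} + {\<epsilon>. residue_germ m k q \<omega>' \<epsilon>}" for \<epsilon>
  proof
    assume "residue_germ m k q (\<omega> + \<omega>') \<epsilon>"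
    then have "residue_germ m k q \<omega>' (\<lambda>r v. \<epsilon> r v - e r v)"
      using residue_germ_diff[OF _ e k qX, of "\<omega> + \<omega>'" \<epsilon>] by simp
    then have "e + (\<lambda>r v. \<epsilon> r v - e r v) \<in> {\<epsilon>. residue_germ m k q \<omega> \<epsilon>} + {\<epsilon>. residue_germ m k q \<omega>' \<epsilon>}"
      using e by (intro set_plus_intro) simp_all
    moreover have "e + (\<lambda>r v. \<epsilon> r v - e r v) = \<epsilon>" by (simp add: fun_eq_iff)
    ultimately show "\<epsilon> \<in> {\<epsilon>. residue_germ m k q \<omega> \<epsilon>} + {\<epsilon>. residue_germ m k q \<omega>' \<epsilon>}" by simp
  next
    assume "\<epsilon> \<in> {\<epsilon>. residue_germ m k q \<omega> \<epsilon>} + {\<epsilon>. residue_germ m k q \<omega>' \<epsilon>}"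
    then obtain a b where "\<epsilon> = a + b" "residue_germ m k q \<omega> a" "residue_germ m k q \<omega>' b"
      by (auto elim: set_plus_elim)
    with residue_germ_add[OF this(2,3) k] show "residue_germ m k q (\<omega> + \<omega>') \<epsilon>"
      by (simp add: plus_fun_def)
  qed
  then show ?thesis using True by (auto simp: residue_def)
next
  case False
  then show ?thesis by (auto simp: residue_def elim: set_plus_elim)
qed

text \<open>Where \<open>f\<close> is not a unit, the image of a coset under multiplication by
  \<open>f\<close> may be too small to be a coset; adding the ideal stalk completes it. Outside
  \<open>U\<close> the sum is still empty, as one summand is.\<close>

lemma residue_scale:
  assumes U: "open_in_variety X U" and k: "1 \<le> k" "k \<le> m"
    and \<omega>: "\<omega> \<in> pole_forms X I D c m k U" and f: "f \<in> regular X U"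
  shows "residue m k U (scale_form f \<omega>) q = scale_form f ` residue m k U \<omega> q + ideal_stalk (m - k) q"
proof (cases "q \<in> U")
  case True
  then have qX: "q \<in> X" using U open_in_variety_subset by blast
  have fg: "f \<in> germs X q" using regular_germs[OF f U True] .
  obtain e where e: "residue_germ m k q \<omega> e"
    by (rule residue_cosetE[OF U k \<omega> True])
  have scale: "residue_germ m k q (scale_form f \<omega>) (scale_form f a)" if "residue_germ m k q \<omega> a" for a
    using residue_germ_scale[OF that fg qX] by (simp add: scale_form_def)
  have "residue_germ m k q (scale_form f \<omega>) \<epsilon> \<longleftrightarrow>
      \<epsilon> \<in> scale_form f ` {\<epsilon>. residue_germ m k q \<omega> \<epsilon>} + ideal_stalk (m - k) q" for \<epsilon>
  proof
    assume "residue_germ m k q (scale_form f \<omega>) \<epsilon>"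
    then have "residue_germ m k q (\<lambda>r v. 0) (\<lambda>r v. \<epsilon> r v - scale_form f e r v)"
      using residue_germ_diff[OF _ scale[OF e] k qX, of "scale_form f \<omega>" \<epsilon>] by simp
    then have "(\<lambda>r v. \<epsilon> r v - scale_form f e r v) \<in> ideal_stalk (m - k) q"
      using residue_germ_zero_ideal[OF qX k] by blast
    then have "scale_form f e + (\<lambda>r v. \<epsilon> r v - scale_form f e r v) \<in>
        scale_form f ` {\<epsilon>. residue_germ m k q \<omega> \<epsilon>} + ideal_stalk (m - k) q"
      using e by (intro set_plus_intro) simp_all
    moreover have "scale_form f e + (\<lambda>r v. \<epsilon> r v - scale_form f e r v) = \<epsilon>"
      by (simp add: fun_eq_iff)
    ultimately show "\<epsilon> \<in> scale_form f ` {\<epsilon>. residue_germ m k q \<omega> \<epsilon>} + ideal_stalk (m - k) q" by simp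
  next
    assume "\<epsilon> \<in> scale_form f ` {\<epsilon>. residue_germ m k q \<omega> \<epsilon>} + ideal_stalk (m - k) q"
    then obtain a b where ab: "\<epsilon> = scale_form f a + b" "residue_germ m k q \<omega> a" "b \<in> ideal_stalk (m - k) q"
      by (auto elim: set_plus_elim)
    then have "residue_germ m k q (\<lambda>r v. 0) b" using residue_germ_zero_ideal[OF qX k] by blast
    from residue_germ_add[OF scale[OF ab(2)] this k] ab(1)
    show "residue_germ m k q (scale_form f \<omega>) \<epsilon>" by (simp add: plus_fun_def)
  qed
  then show ?thesis using True by (auto simp: residue_def)
next
  case False
  then show ?thesis by (auto simp: residue_def elim: set_plus_elim)
qed

text \<open>A coset is the ideal stalk itself iff it contains 0, and 0 is a leading coefficient iff
  the pole order is at most \<open>k - 1\<close>.\<close>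

lemma residue_zero_iff:
  assumes U: "open_in_variety X U" and k: "1 \<le> k" "k \<le> m" and \<omega>: "\<omega> \<in> pole_forms X I D c m k U"
  shows "residue m k U \<omega> = (\<lambda>q. if q \<in> U then ideal_stalk (m - k) q else {}) \<longleftrightarrow>
    (\<forall>p\<in>U. pole_germ m (k - 1) p \<omega>)"
proof -
  have "{\<epsilon>. residue_germ m k p \<omega> \<epsilon>} = ideal_stalk (m - k) p \<longleftrightarrow> pole_germ m (k - 1) p \<omega>"
    if p: "p \<in> U" for p
  proof -
    have pX: "p \<in> X" using U p open_in_variety_subset by blast
    obtain \<sigma> where \<sigma>: "equation_germ X (D c) p \<sigma>" using equation_exists[OF pX] by blast
    have iff: "residue_germ m k p \<omega> 0 \<longleftrightarrow> pole_germ m (k - 1) p \<omega>"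
    proof
      assume "residue_germ m k p \<omega> 0"
      from residue_germ_equation[OF this \<sigma> k] show "pole_germ m (k - 1) p \<omega>" by simp
    next
      assume "pole_germ m (k - 1) p \<omega>"
      then have "pole_germ m (k - 1) p (\<lambda>q v. \<omega> q v - (v \<sigma> / \<sigma> q) ^ k * (0 :: 'n form) q v)" by simp
      moreover have "log_germ X (I - {c}) D (m - k) p (0 :: 'n form)"
        using log_germ_zero by (simp add: zero_fun_def)
      ultimately show "residue_germ m k p \<omega> 0"
        using \<sigma> unfolding residue_germ_def by auto
    qed
    show ?thesis
    proof
      assume "{\<epsilon>. residue_germ m k p \<omega> \<epsilon>} = ideal_stalk (m - k) p"
      then show "pole_germ m (k - 1) p \<omega>" using ideal_stalk_zero(1)[OF pX k] iff by blast
    next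
      assume "pole_germ m (k - 1) p \<omega>"
      then have "residue_germ m k p \<omega> 0" using iff by blast
      from residue_germ_coset[OF pX k this] show "{\<epsilon>. residue_germ m k p \<omega> \<epsilon>} = ideal_stalk (m - k) p"
        by simp
    qed
  qed
  then show ?thesis by (auto simp: residue_def fun_eq_iff)
qed

section \<open>Exactness\<close>

lemma pole_filtration_exact:
  assumes k: "1 \<le> k" "k \<le> m"
  shows "short_exact X (form_sheaf (pole_forms X I D c m (k - 1))) (form_sheaf (pole_forms X I D c m k))
    (restrict_sheaf X (D c) (log_forms X (I - {c}) D (m - k))) (\<lambda>U \<omega>. \<omega>) (residue m k)"
    (is "short_exact X ?F ?G ?H _ _")
  unfolding short_exact_def
proof (intro conjI allI impI)
  show "sheaf_hom X ?F ?G (\<lambda>U \<omega>. \<omega>)"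
    using pole_forms_mono[of _ m "k - 1"] k(1) by (simp add: sheaf_hom_def form_sheaf_def)
  show "sheaf_hom X ?G ?H (residue m k)"
    unfolding sheaf_hom_def
  proof (intro allI impI conjI ballI)
    fix U assume U: "open_in_variety X U"
    fix \<omega> assume "\<omega> \<in> sections ?G U"
    then have \<omega>: "\<omega> \<in> pole_forms X I D c m k U" by (simp add: form_sheaf_def)
    show "residue m k U \<omega> \<in> sections ?H U" using residue_section[OF U k \<omega>] .
    show "residue m k U (plus_section ?G \<omega> \<omega>') = plus_section ?H (residue m k U \<omega>) (residue m k U \<omega>')"
      if "\<omega>' \<in> sections ?G U" for \<omega>'
      using residue_add[OF U k \<omega>, of \<omega>'] that by (simp add: form_sheaf_def restrict_sheaf_def fun_eq_iff)
    show "residue m k U (scale_section ?G f \<omega>) = scale_section ?H f (residue m k U \<omega>)"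
      if "f \<in> regular X U" for f
      using residue_scale[OF U k \<omega> that] by (simp add: form_sheaf_def restrict_sheaf_def fun_eq_iff)
    show "residue m k V (restriction ?G V \<omega>) = restriction ?H V (residue m k U \<omega>)"
      if "open_in_variety X V" "V \<subseteq> U" for V
      using residue_restr[OF that] by (simp add: form_sheaf_def restrict_sheaf_def fun_eq_iff)
  qed
  fix U assume U: "open_in_variety X U"
  show "inj_on (\<lambda>\<omega>. \<omega>) (sections ?F U)" by simp
  show "\<forall>s\<in>sections ?G U. residue m k U s = zero_section ?H U \<longleftrightarrow> in_image_sheaf X ?F ?G (\<lambda>U \<omega>. \<omega>) U s"
  proof
    fix \<omega> assume "\<omega> \<in> sections ?G U"
    then have \<omega>: "\<omega> \<in> pole_forms X I D c m k U" by (simp add: form_sheaf_def)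
    \<comment> \<open>Lying in the image sheaf is a condition on restrictions to small open sets. It
      translates into the condition on germs that expresses vanishing of the residue.\<close>
    have "(\<forall>p\<in>U. pole_germ m (k - 1) p \<omega>) \<longleftrightarrow> (\<forall>p\<in>U. \<exists>V. open_in_variety X V \<and> p \<in> V \<and> V \<subseteq> U \<and>
        restr V \<omega> \<in> pole_forms X I D c m (k - 1) V)"
    proof (intro ball_cong refl iffI)
      fix p assume p: "p \<in> U" and pole: "pole_germ m (k - 1) p \<omega>"
      obtain V where "open_in_variety X V" "p \<in> V" "V \<subseteq> U"
        "restr V (cut I \<omega>) \<in> pole_forms X I D c m (k - 1) V"
        by (rule pole_germ_forms[OF U p pole])
      then show "\<exists>V. open_in_variety X V \<and> p \<in> V \<and> V \<subseteq> U \<and> restr V \<omega> \<in> pole_forms X I D c m (k - 1) V"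
        unfolding restr_cut_pole_forms[OF \<omega>] by blast
    next
      fix p assume "\<exists>V. open_in_variety X V \<and> p \<in> V \<and> V \<subseteq> U \<and> restr V \<omega> \<in> pole_forms X I D c m (k - 1) V"
      then obtain V where V: "open_in_variety X V" "p \<in> V" "restr V \<omega> \<in> pole_forms X I D c m (k - 1) V"
        by blast
      show "pole_germ m (k - 1) p \<omega>"
      proof (rule pole_germ_cong[OF pole_forms_germ[OF V]])
        show "agree X p (support D I) \<omega> (\<lambda>q v. restr V \<omega> q v)"
          using restr_eventually[OF V(1,2), of \<omega>] by eventually_elim simp
      qed
    qed
    then show "residue m k U \<omega> = zero_section ?H U \<longleftrightarrow> in_image_sheaf X ?F ?G (\<lambda>U \<omega>. \<omega>) U \<omega>"
      using residue_zero_iff[OF U k \<omega>] by (simp add: in_image_sheaf_def form_sheaf_def restrict_sheaf_def)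
  qed
  show "\<forall>s\<in>sections ?H U. in_image_sheaf X ?G ?H (residue m k) U s"
    unfolding in_image_sheaf_def
  proof (intro ballI)
    fix s p assume s: "s \<in> sections ?H U" and p: "p \<in> U"
    have pX: "p \<in> X" using U p open_in_variety_subset by blast
    have "\<forall>p\<in>U. \<exists>V. open_in_variety X V \<and> p \<in> V \<and> V \<subseteq> U \<and>
        (\<exists>e\<in>log_forms X (I - {c}) D (m - k) V. \<forall>q\<in>V. s q = e +o ideal_stalk (m - k) q)"
      using s by (simp add: restrict_sheaf_def)
    from bspec[OF this p] obtain V where V: "open_in_variety X V" "p \<in> V" "V \<subseteq> U"
      and ex: "\<exists>e\<in>log_forms X (I - {c}) D (m - k) V. \<forall>q\<in>V. s q = e +o ideal_stalk (m - k) q"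
      by (elim exE conjE)
    from ex obtain e where e: "e \<in> log_forms X (I - {c}) D (m - k) V"
      "\<forall>q\<in>V. s q = e +o ideal_stalk (m - k) q"
      by (rule bexE)
    obtain \<sigma> where \<sigma>: "equation_germ X (D c) p \<sigma>" using equation_exists[OF pX] by blast
    \<comment> \<open>A local preimage, with \<open>e\<close> as leading coefficient. It becomes a
      section only after \<open>cut\<close> and a restriction, which \<open>pole_germ_forms\<close>
      provides.\<close>
    define \<omega> where "\<omega> = (\<lambda>q v. (v \<sigma> / \<sigma> q) ^ k * e q v)"
    have ev: "\<forall>\<^sub>F q in nbhd X p. q \<in> V \<and> equation_germ X (D c) q \<sigma>"
      by (intro eventually_conj eventually_nbhd_in V equation_germ_eventually \<sigma>)
    obtain W where W: "open_in_variety X W" "p \<in> W" "\<And>q. q \<in> W \<Longrightarrow> q \<in> V \<and> equation_germ X (D c) q \<sigma>"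
      using ev by (rule eventually_nbhdE[OF _ pX]) blast
    have "pole_germ m k p \<omega>"
      unfolding \<omega>_def by (intro pole_germ_dlog_power \<sigma> log_forms_germ[OF e(1) V(1,2)] k)
    then obtain N where N: "open_in_variety X N" "p \<in> N" "N \<subseteq> W"
      "restr N (cut I \<omega>) \<in> pole_forms X I D c m k N"
      by (rule pole_germ_forms[OF W(1,2)])
    have "residue m k N (restr N (cut I \<omega>)) q = s q" if q: "q \<in> N" for q
    proof -
      have qX: "q \<in> X" using N(1) q open_in_variety_subset by blast
      have qV: "q \<in> V" "equation_germ X (D c) q \<sigma>" using W(3) N(3) q by blast+
      \<comment> \<open>The remainder is identically 0. So the same \<open>e\<close> and the same
        \<sigma> exhibit a leading coefficient at every \<open>q\<close> in \<open>N\<close>, and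
        the residue agrees with \<open>s\<close> there.\<close>
      have "pole_germ m (k - 1) q (\<lambda>r v. \<omega> r v - (v \<sigma> / \<sigma> r) ^ k * e r v)"
        using pole_germ_zero[OF qX] by (simp add: \<omega>_def)
      moreover have "\<forall>\<^sub>F r in nbhd X q. \<forall>v. r \<in> (support D (I - {c})) \<or> v \<notin> tangent_space X r \<longrightarrow> e r v = 0"
        using log_forms_normalized[OF e(1)] by (intro always_eventually) blast
      ultimately have r: "residue_germ m k q \<omega> e"
        using qV(2) log_forms_germ[OF e(1) V(1) qV(1)] unfolding residue_germ_def by blast
      have "residue_germ m k q (restr N (cut I \<omega>)) e"
      proof (rule residue_germ_cong[OF r qX])
        show "agree X q (support D I) (\<lambda>r v. restr N (cut I \<omega>) r v) \<omega>"
          using restr_eventually[OF N(1) q, of "cut I \<omega>"] by eventually_elim (simp add: cut_def)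
      qed simp
      from residue_germ_coset[OF qX k this] show ?thesis using e(2) qV(1) q by (simp add: residue_def)
    qed
    then have "residue m k N (restr N (cut I \<omega>)) = restriction ?H N s"
      by (simp add: restrict_sheaf_def fun_eq_iff residue_def)
    moreover have "N \<subseteq> U" using N(3) W(3) V(3) by blast
    ultimately show "\<exists>V. open_in_variety X V \<and> p \<in> V \<and> V \<subseteq> U \<and>
        (\<exists>t\<in>sections ?G V. residue m k V t = restriction ?H V s)"
      using N(1,2,4) by (auto simp: form_sheaf_def)
  qed
qed

end

theorem proposition5:
  fixes X :: "'n::finite proj set" and D :: "nat \<Rightarrow> 'n proj set" and c m k :: nat
  assumes "projective_variety X" and "smooth X"
    and "1 \<le> c" and "snc_divisor X {1..c} D"
    and "1 \<le> m" and "1 \<le> k" and "k \<le> m"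
  shows "\<exists>\<rho>. short_exact X
    (form_sheaf (pole_forms X {1..c} D c m (k - 1)))
    (form_sheaf (pole_forms X {1..c} D c m k))
    (restrict_sheaf X (D c) (log_forms X ({1..c} - {c}) D (m - k)))
    (\<lambda>U \<omega>. \<omega>) \<rho>"
proof -
  interpret snc_pair X "{1..c}" D c
    by unfold_locales (use assms in auto)
  show ?thesis using pole_filtration_exact[OF assms(6,7)] by blast
qed

end
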